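(* Let $V$ be an affine toric $\mathbb{R}$-variety, and let $S\subseteq V(\mathbb{R})$ be a closed semi-algebraic set that is the closure of its interior. Assume that $B_V(S)=\mathbb{R}$ and that $V$ admits a toric $S$-compatible completion $V\hookrightarrow X$. Then $\mathcal{P}_V(S)$ is totally stable.
   Context: Toric varieties are normal varieties over $\mathbb{R}$ with an action of a split torus $T$ having a dense orbit isomorphic to $T$, i.e. those given by fans. A toric completion of $V$ is an open embedding of $V$ into a complete toric variety $X$ that is compatible with the torus actions. It is $S$-compatible if for every irreducible component $Z$ of $X\setminus V$ the set $Z(\mathbb{R})\cap\overline{S}$ is either empty or Zariski-dense in $Z$, where $\overline{S}$ is the closure of $S$ in $X(\mathbb{R})$ in the Euclidean topology. Closed, closure and interior for $S\subseteq V(\mathbb{R})$ also refer to the Euclidean topology. $B_V(S)=\{f\in\mathbb{R}[V]:\exists\lambda\in\mathbb{R}\ |f|\le\lambda\text{ on }S\}$, and $\mathcal{P}_V(S)=\{f\in\mathbb{R}[V]: f|_S\ge0\}$. $\mathcal{P}_V(S)$ is called totally stable if for every finite-dimensional subspace $U$ of $\mathbb{R}[V]$ there exists a finite-dimensional subspace $W$ of $\mathbb{R}[V]$ such that for all $r\ge2$ and all $f_1,\dots,f_r\in\mathcal{P}_V(S)$: if $f_1+\cdots+f_r\in U$, then $f_1,\dots,f_r\in W$. *)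

theory Defs
  imports "HOL-Analysis.Analysis" "HOL-Library.Poly_Mapping"
begin

section \<open>Cones and fans\<close>

text \<open>
  The lattice of one-parameter subgroups is \<open>N = int ^ 'n\<close>, with real extension \<open>real ^ 'n\<close>,
  and the character lattice \<open>M\<close> is identified with \<open>int ^ 'n\<close> through the standard pairing.
\<close>

definition lattice_vec :: "int ^ 'n \<Rightarrow> real ^ 'n" where
  "lattice_vec v = (\<chi> i. of_int (v $ i))"

definition rational_polyhedral_cone :: "(real ^ 'n) set \<Rightarrow> bool" where
  "rational_polyhedral_cone \<sigma> \<longleftrightarrow> (\<exists>G. finite G \<and> \<sigma> = convex_cone hull (lattice_vec ` G))"

text \<open>Strong convexity: the cone contains no line.\<close>

definition toric_cone :: "(real ^ 'n) set \<Rightarrow> bool" where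
  "toric_cone \<sigma> \<longleftrightarrow> rational_polyhedral_cone \<sigma> \<and> \<sigma> \<inter> uminus ` \<sigma> = {0}"

text \<open>The library relation \<open>face_of\<close> also admits the empty face, which is not a face of a cone.\<close>

definition cone_face :: "(real ^ 'n) set \<Rightarrow> (real ^ 'n) set \<Rightarrow> bool" where
  "cone_face \<tau> \<sigma> \<longleftrightarrow> \<tau> face_of \<sigma> \<and> \<tau> \<noteq> {}"

definition fan :: "(real ^ 'n) set set \<Rightarrow> bool" where
  "fan \<Delta> \<longleftrightarrow> finite \<Delta> \<and> \<Delta> \<noteq> {}
     \<and> (\<forall>\<sigma>\<in>\<Delta>. toric_cone \<sigma>)
     \<and> (\<forall>\<sigma>\<in>\<Delta>. \<forall>\<tau>. cone_face \<tau> \<sigma> \<longrightarrow> \<tau> \<in> \<Delta>)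
     \<and> (\<forall>\<sigma>\<in>\<Delta>. \<forall>\<tau>\<in>\<Delta>. cone_face (\<sigma> \<inter> \<tau>) \<sigma> \<and> cone_face (\<sigma> \<inter> \<tau>) \<tau>)"

section \<open>Affine toric varieties\<close>

text \<open>The characters that extend to the affine toric variety \<open>U\<^sub>\<sigma>\<close>.\<close>

definition cone_monoid :: "(real ^ 'n) set \<Rightarrow> (int ^ 'n) set" where
  "cone_monoid \<sigma> = {m. \<forall>u\<in>\<sigma>. lattice_vec m \<bullet> u \<ge> 0}"

text \<open>
  The \<open>K\<close>-points of \<open>U\<^sub>\<sigma>\<close> are the monoid homomorphisms from \<open>cone_monoid \<sigma>\<close> to
  the multiplicative monoid of \<open>K\<close>; the value at \<open>m\<close> is the value of the character \<open>m\<close> at the point.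
  They are extended by \<open>0\<close> outside \<open>cone_monoid \<sigma>\<close>.
  For \<open>\<sigma> = {0}\<close> these are the \<open>K\<close>-points of the torus.
\<close>

definition aff_points :: "(real ^ 'n) set \<Rightarrow> (int ^ 'n \<Rightarrow> 'k::real_field) set" where
  "aff_points \<sigma> = {x. x 0 = 1
     \<and> (\<forall>a\<in>cone_monoid \<sigma>. \<forall>b\<in>cone_monoid \<sigma>. x (a + b) = x a * x b)
     \<and> (\<forall>m. m \<notin> cone_monoid \<sigma> \<longrightarrow> x m = 0)}"

text \<open>
  The coordinate ring of \<open>U\<^sub>\<sigma>\<close> is the monoid algebra of \<open>cone_monoid \<sigma>\<close> over the reals,
  a subring of the ring of Laurent polynomials.
\<close>

definition coord_ring :: "(real ^ 'n) set \<Rightarrow> (int ^ 'n \<Rightarrow>\<^sub>0 real) set" where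
  "coord_ring \<sigma> = {f. Poly_Mapping.keys f \<subseteq> cone_monoid \<sigma>}"

definition feval :: "(int ^ 'n \<Rightarrow>\<^sub>0 real) \<Rightarrow> (int ^ 'n \<Rightarrow> 'k::real_field) \<Rightarrow> 'k" where
  "feval f x = (\<Sum>m\<in>Poly_Mapping.keys f. of_real (Poly_Mapping.lookup f m) * x m)"

instantiation poly_mapping :: (type, real_vector) real_vector
begin

definition scaleR_poly_mapping :: "real \<Rightarrow> ('a \<Rightarrow>\<^sub>0 'b) \<Rightarrow> ('a \<Rightarrow>\<^sub>0 'b)" where
  "scaleR_poly_mapping r f = Poly_Mapping.map (scaleR r) f"

lemma lookup_scaleR [simp]: "Poly_Mapping.lookup (r *\<^sub>R f) k = r *\<^sub>R Poly_Mapping.lookup f k"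
  for f :: "'a \<Rightarrow>\<^sub>0 'b"
  by (simp add: scaleR_poly_mapping_def map.rep_eq when_def)

instance
  by standard (auto intro!: poly_mapping_eqI simp: lookup_add scaleR_add_right scaleR_add_left)

end

section \<open>Semi-algebraic sets and positive polynomials\<close>

inductive semialgebraic :: "(real ^ 'n) set \<Rightarrow> (int ^ 'n \<Rightarrow> real) set \<Rightarrow> bool"
  for \<sigma> :: "(real ^ 'n) set"
where
  pos: "f \<in> coord_ring \<sigma> \<Longrightarrow> semialgebraic \<sigma> {x \<in> aff_points \<sigma>. feval f x > 0}"
| compl: "semialgebraic \<sigma> A \<Longrightarrow> semialgebraic \<sigma> (aff_points \<sigma> - A)"
| inter: "semialgebraic \<sigma> A \<Longrightarrow> semialgebraic \<sigma> B \<Longrightarrow> semialgebraic \<sigma> (A \<inter> B)"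

definition bounded_ring ::
  "(real ^ 'n) set \<Rightarrow> (int ^ 'n \<Rightarrow> real) set \<Rightarrow> (int ^ 'n \<Rightarrow>\<^sub>0 real) set" where
  "bounded_ring \<sigma> S = {f \<in> coord_ring \<sigma>. \<exists>c. \<forall>x\<in>S. \<bar>feval f x\<bar> \<le> c}"

definition psd_cone ::
  "(real ^ 'n) set \<Rightarrow> (int ^ 'n \<Rightarrow> real) set \<Rightarrow> (int ^ 'n \<Rightarrow>\<^sub>0 real) set" where
  "psd_cone \<sigma> S = {f \<in> coord_ring \<sigma>. \<forall>x\<in>S. feval f x \<ge> 0}"

definition fin_dim_subspace :: "'a::real_vector set \<Rightarrow> bool" where
  "fin_dim_subspace U \<longleftrightarrow> (\<exists>B. finite B \<and> U = span B)"

definition totally_stable :: "(real ^ 'n) set \<Rightarrow> (int ^ 'n \<Rightarrow> real) set \<Rightarrow> bool" where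
  "totally_stable \<sigma> S \<longleftrightarrow>
     (\<forall>U. U \<subseteq> coord_ring \<sigma> \<and> fin_dim_subspace U \<longrightarrow>
       (\<exists>W. W \<subseteq> coord_ring \<sigma> \<and> fin_dim_subspace W \<and>
         (\<forall>r\<ge>2. \<forall>f :: nat \<Rightarrow> (int ^ 'n \<Rightarrow>\<^sub>0 real).
            (\<forall>i\<in>{1..r}. f i \<in> psd_cone \<sigma> S) \<and> (\<Sum>i\<in>{1..r}. f i) \<in> U
              \<longrightarrow> (\<forall>i\<in>{1..r}. f i \<in> W))))"

section \<open>Toric varieties as glued spaces\<close>

text \<open>
  An \<open>\<real>\<close>-variety is represented by its set of complex points with the Zariski topology
  whose closed sets are defined by polynomials with real coefficients. The closed points of the
  scheme are the orbits of complex conjugation on this space, so its closed subsets, irreducible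
  components etc. are in bijection with those of the scheme over the reals.

  The toric variety of a fan \<open>\<Delta>\<close> is glued from the \<open>U\<^sub>\<tau>\<close> for
  \<open>\<tau>\<close> in \<open>\<Delta>\<close>, two of which are identified along the affine toric variety of
  the intersection of their cones. Its points are the equivalence classes of pairs \<open>(\<tau>, x)\<close>.
\<close>

type_synonym 'n toric_point = "((real ^ 'n) set \<times> (int ^ 'n \<Rightarrow> complex)) set"

definition restr :: "(real ^ 'n) set \<Rightarrow> (int ^ 'n \<Rightarrow> complex) \<Rightarrow> (int ^ 'n \<Rightarrow> complex)" where
  "restr \<tau> y = (\<lambda>m. if m \<in> cone_monoid \<tau> then y m else 0)"

definition glue_rel :: "(real ^ 'n) set set \<Rightarrow>
    (((real ^ 'n) set \<times> (int ^ 'n \<Rightarrow> complex)) \<times> ((real ^ 'n) set \<times> (int ^ 'n \<Rightarrow> complex))) set" where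
  "glue_rel \<Delta> = {((\<tau>, x), (\<tau>', x')). \<tau> \<in> \<Delta> \<and> \<tau>' \<in> \<Delta> \<and>
     (\<exists>y\<in>aff_points (\<tau> \<inter> \<tau>'). x = restr \<tau> y \<and> x' = restr \<tau>' y)}"

definition chart :: "(real ^ 'n) set set \<Rightarrow> (real ^ 'n) set \<Rightarrow> (int ^ 'n \<Rightarrow> complex) \<Rightarrow> 'n toric_point" where
  "chart \<Delta> \<tau> x = glue_rel \<Delta> `` {(\<tau>, x)}"

text \<open>The final topology on the union of the images of a family of maps.\<close>

definition glued_topology :: "'i set \<Rightarrow> ('i \<Rightarrow> 'a topology) \<Rightarrow> ('i \<Rightarrow> 'a \<Rightarrow> 'b) \<Rightarrow> 'b topology" where
  "glued_topology I T c = topology (\<lambda>W. W \<subseteq> (\<Union>i\<in>I. c i ` topspace (T i)) \<and>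
     (\<forall>i\<in>I. openin (T i) {x \<in> topspace (T i). c i x \<in> W}))"

lemma openin_glued_topology:
  "openin (glued_topology I T c) W \<longleftrightarrow> W \<subseteq> (\<Union>i\<in>I. c i ` topspace (T i)) \<and>
     (\<forall>i\<in>I. openin (T i) {x \<in> topspace (T i). c i x \<in> W})"
proof -
  define P where "P = (\<lambda>W. W \<subseteq> (\<Union>i\<in>I. c i ` topspace (T i)) \<and>
     (\<forall>i\<in>I. openin (T i) {x \<in> topspace (T i). c i x \<in> W}))"
  have "istopology P"
    unfolding istopology_def
  proof (intro conjI allI impI)
    fix A B assume "P A" "P B"
    moreover have "{x \<in> topspace (T i). c i x \<in> A \<inter> B} =
        {x \<in> topspace (T i). c i x \<in> A} \<inter> {x \<in> topspace (T i). c i x \<in> B}" for i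
      by blast
    ultimately show "P (A \<inter> B)"
      unfolding P_def by auto
  next
    fix \<K> assume *: "\<forall>K\<in>\<K>. P K"
    have "{x \<in> topspace (T i). c i x \<in> \<Union>\<K>} =
        \<Union> ((\<lambda>K. {x \<in> topspace (T i). c i x \<in> K}) ` \<K>)" for i
      by blast
    with * show "P (\<Union>\<K>)"
      unfolding P_def by (auto intro!: openin_Union)
  qed
  then show ?thesis
    by (simp add: glued_topology_def P_def topology_inverse')
qed

text \<open>
  The Zariski topology on \<open>C\<close> defined by a ring \<open>A\<close> of functions: the principal open sets
  form a basis.
\<close>

definition zariski :: "'a set \<Rightarrow> ('a \<Rightarrow> complex) set \<Rightarrow> 'a topology" where
  "zariski C A = topology_generated_by ((\<lambda>f. {x \<in> C. f x \<noteq> 0}) ` A)"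

definition zariski_aff :: "(real ^ 'n) set \<Rightarrow> (int ^ 'n \<Rightarrow> complex) topology" where
  "zariski_aff \<sigma> = zariski (aff_points \<sigma>) (feval ` coord_ring \<sigma>)"

definition zariski_toric :: "(real ^ 'n) set set \<Rightarrow> 'n toric_point topology" where
  "zariski_toric \<Delta> = glued_topology \<Delta> zariski_aff (chart \<Delta>)"

text \<open>
  The Euclidean topology on \<open>U\<^sub>\<tau>(K)\<close> is the coarsest one making all characters continuous, that is,
  the topology of pointwise convergence.
\<close>

definition euclidean_toric :: "(real ^ 'n) set set \<Rightarrow> 'n toric_point topology" where
  "euclidean_toric \<Delta> = glued_topology \<Delta> (\<lambda>\<tau>. top_of_set (aff_points \<tau>)) (chart \<Delta>)"

definition complexify :: "(int ^ 'n \<Rightarrow> real) \<Rightarrow> (int ^ 'n \<Rightarrow> complex)" where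
  "complexify x = (\<lambda>m. of_real (x m))"

definition real_points :: "(real ^ 'n) set set \<Rightarrow> 'n toric_point set" where
  "real_points \<Delta> = (\<Union>\<tau>\<in>\<Delta>. (\<lambda>x. chart \<Delta> \<tau> (complexify x)) ` aff_points \<tau>)"

section \<open>Completeness\<close>

inductive_set real_subalgebra :: "('a \<Rightarrow> complex) set \<Rightarrow> ('a \<Rightarrow> complex) set"
  for G :: "('a \<Rightarrow> complex) set"
where
  const: "(\<lambda>_. of_real r) \<in> real_subalgebra G"
| gen: "g \<in> G \<Longrightarrow> g \<in> real_subalgebra G"
| add: "f \<in> real_subalgebra G \<Longrightarrow> g \<in> real_subalgebra G \<Longrightarrow> (\<lambda>x. f x + g x) \<in> real_subalgebra G"
| mult: "f \<in> real_subalgebra G \<Longrightarrow> g \<in> real_subalgebra G \<Longrightarrow> (\<lambda>x. f x * g x) \<in> real_subalgebra G"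

definition affine_space :: "nat \<Rightarrow> (nat \<Rightarrow> complex) set" where
  "affine_space k = {y. \<forall>i\<ge>k. y i = 0}"

definition zariski_affine_space :: "nat \<Rightarrow> (nat \<Rightarrow> complex) topology" where
  "zariski_affine_space k = zariski (affine_space k) (real_subalgebra {\<lambda>y. y i | i. i < k})"

text \<open>The Zariski topology of the product variety, which is finer than the product topology.\<close>

definition zariski_aff_prod ::
  "(real ^ 'n) set \<Rightarrow> nat \<Rightarrow> ((int ^ 'n \<Rightarrow> complex) \<times> (nat \<Rightarrow> complex)) topology" where
  "zariski_aff_prod \<tau> k = zariski (aff_points \<tau> \<times> affine_space k)
     (real_subalgebra ({\<lambda>(x, y). feval f x | f. f \<in> coord_ring \<tau>} \<union> {\<lambda>(x, y). y i | i. i < k}))"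

definition zariski_toric_prod ::
  "(real ^ 'n) set set \<Rightarrow> nat \<Rightarrow> ('n toric_point \<times> (nat \<Rightarrow> complex)) topology" where
  "zariski_toric_prod \<Delta> k =
     glued_topology \<Delta> (\<lambda>\<tau>. zariski_aff_prod \<tau> k) (\<lambda>\<tau> (x, y). (chart \<Delta> \<tau> x, y))"

text \<open>
  The varieties considered are separated and of finite type, so completeness is universal
  closedness: \<open>X \<times> Y \<rightarrow> Y\<close> is closed for all \<open>Y\<close>. As usual it is enough
  to let \<open>Y\<close> range over the affine spaces.
\<close>

definition complete_toric :: "(real ^ 'n) set set \<Rightarrow> bool" where
  "complete_toric \<Delta> \<longleftrightarrow>
     (\<forall>k. closed_map (zariski_toric_prod \<Delta> k) (zariski_affine_space k) snd)"

section \<open>Toric completions\<close>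

text \<open>
  Regular functions are locally quotients of elements of the coordinate ring. Since coefficients
  are real, these are the sections of the structure sheaf of the variety over the reals.
\<close>

definition regular_aff ::
  "(real ^ 'n) set \<Rightarrow> (int ^ 'n \<Rightarrow> complex) set \<Rightarrow> ((int ^ 'n \<Rightarrow> complex) \<Rightarrow> complex) \<Rightarrow> bool" where
  "regular_aff \<sigma> W g \<longleftrightarrow> openin (zariski_aff \<sigma>) W \<and>
     (\<forall>x\<in>W. \<exists>a\<in>coord_ring \<sigma>. \<exists>b\<in>coord_ring \<sigma>. feval b x \<noteq> 0 \<and>
        (\<forall>y\<in>W. feval b y \<noteq> 0 \<longrightarrow> g y = feval a y / feval b y))"

definition regular_toric ::
  "(real ^ 'n) set set \<Rightarrow> 'n toric_point set \<Rightarrow> ('n toric_point \<Rightarrow> complex) \<Rightarrow> bool" where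
  "regular_toric \<Delta> W g \<longleftrightarrow> openin (zariski_toric \<Delta>) W \<and>
     (\<forall>\<tau>\<in>\<Delta>. regular_aff \<tau> {x \<in> aff_points \<tau>. chart \<Delta> \<tau> x \<in> W} (g \<circ> chart \<Delta> \<tau>))"

text \<open>An isomorphism, as spaces with sheaves of functions, onto an open subvariety.\<close>

definition open_immersion ::
  "(real ^ 'n) set \<Rightarrow> (real ^ 'n) set set \<Rightarrow> ((int ^ 'n \<Rightarrow> complex) \<Rightarrow> 'n toric_point) \<Rightarrow> bool" where
  "open_immersion \<sigma> \<Delta> \<iota> \<longleftrightarrow>
     embedding_map (zariski_aff \<sigma>) (zariski_toric \<Delta>) \<iota> \<and>
     openin (zariski_toric \<Delta>) (\<iota> ` aff_points \<sigma>) \<and>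
     (\<forall>W g. openin (zariski_aff \<sigma>) W \<longrightarrow>
        (regular_toric \<Delta> (\<iota> ` W) g \<longleftrightarrow> regular_aff \<sigma> W (g \<circ> \<iota>)))"

definition torus_act ::
  "(int ^ 'n \<Rightarrow> complex) \<Rightarrow> (int ^ 'n \<Rightarrow> complex) \<Rightarrow> (int ^ 'n \<Rightarrow> complex)" where
  "torus_act t x = (\<lambda>m. t m * x m)"

text \<open>The action on a point of a glued variety, computed on all representatives of its class.\<close>

definition torus_act_toric ::
  "(int ^ 'n \<Rightarrow> complex) \<Rightarrow> 'n toric_point \<Rightarrow> 'n toric_point" where
  "torus_act_toric t p = (\<lambda>(\<tau>, x). (\<tau>, torus_act t x)) ` p"

definition toric_completion ::
  "(real ^ 'n) set \<Rightarrow> (real ^ 'n) set set \<Rightarrow> ((int ^ 'n \<Rightarrow> complex) \<Rightarrow> 'n toric_point) \<Rightarrow> bool" where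
  "toric_completion \<sigma> \<Delta> \<iota> \<longleftrightarrow> fan \<Delta> \<and> complete_toric \<Delta> \<and> open_immersion \<sigma> \<Delta> \<iota> \<and>
     (\<forall>t\<in>aff_points {0}. \<forall>x\<in>aff_points \<sigma>.
        \<iota> (torus_act t x) = torus_act_toric t (\<iota> x))"

definition irreducible_in :: "'a topology \<Rightarrow> 'a set \<Rightarrow> bool" where
  "irreducible_in T Z \<longleftrightarrow> Z \<noteq> {} \<and> Z \<subseteq> topspace T \<and>
     (\<forall>A B. closedin T A \<and> closedin T B \<and> Z \<subseteq> A \<union> B \<longrightarrow> Z \<subseteq> A \<or> Z \<subseteq> B)"

definition irreducible_component :: "'a topology \<Rightarrow> 'a set \<Rightarrow> 'a set \<Rightarrow> bool" where
  "irreducible_component T Y Z \<longleftrightarrow> Z \<subseteq> Y \<and> irreducible_in T Z \<and>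
     (\<forall>Z'. Z \<subseteq> Z' \<and> Z' \<subseteq> Y \<and> irreducible_in T Z' \<longrightarrow> Z' = Z)"

definition S_compatible :: "(real ^ 'n) set \<Rightarrow> (real ^ 'n) set set \<Rightarrow>
    ((int ^ 'n \<Rightarrow> complex) \<Rightarrow> 'n toric_point) \<Rightarrow> (int ^ 'n \<Rightarrow> real) set \<Rightarrow> bool" where
  "S_compatible \<sigma> \<Delta> \<iota> S \<longleftrightarrow>
     (let Sbar = subtopology (euclidean_toric \<Delta>) (real_points \<Delta>)
                   closure_of ((\<lambda>x. \<iota> (complexify x)) ` S)
      in \<forall>Z. irreducible_component (zariski_toric \<Delta>)
               (topspace (zariski_toric \<Delta>) - \<iota> ` aff_points \<sigma>) Z \<longrightarrow>
             Z \<inter> real_points \<Delta> \<inter> Sbar = {} \<or>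
             Z \<subseteq> zariski_toric \<Delta> closure_of (Z \<inter> real_points \<Delta> \<inter> Sbar))"

end

theory Submission
  imports Defs
begin

text \<open>
  Let \<open>0 \<le> g \<le> f\<close> on \<open>S\<close>. If a boundary divisor \<open>D\<close> of the completion meets the closure of \<open>S\<close>, then by
  compatibility the closure of \<open>S\<close> is Zariski dense in \<open>D\<close>, so \<open>g / f\<close> has no pole along \<open>D\<close>: the order of \<open>g\<close>
  along \<open>D\<close> is at least the order of \<open>f\<close>. Orders along toric divisors are minima of linear forms on exponents,
  so it suffices that only finitely many exponents \<open>m\<close> of characters of \<open>V\<close> satisfy \<open>\<langle>m, u\<rangle> \<ge> - n\<^sub>u\<close> for
  the rays \<open>u\<close> of these divisors. By Dickson's lemma an infinite set of such exponents contains two whose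
  difference \<open>m \<noteq> 0\<close> is the exponent of a character of \<open>V\<close> with \<open>\<langle>m, u\<rangle> \<ge> 0\<close> for all these \<open>u\<close>.
  This character has no poles near the closure of \<open>S\<close>, which is compact because the completion is complete, so it
  is bounded on \<open>S\<close>, contradicting \<open>B\<^sub>V(S) = \<real>\<close>.
\<close>

text \<open>No valuations are used. A pole of \<open>g / f\<close> shows up, after division of both
  by the leading character of \<open>g\<close>, as the strict inequality
  \<open>norm f < norm g\<close> at a point of the divisor in the closure of \<open>S\<close>. This
  condition is open in the Euclidean topology, so it reaches \<open>S\<close> itself and contradicts
  \<open>g \<le> f\<close>. A priori the closure of \<open>S\<close> may meet a divisor only in its
  deeper orbits; Zariski density moves the point to the open orbit, where the chart of the ray is
  just the torus and the divisor.

  The embedding need not send the unit of the torus of \<open>V\<close> to that of \<open>X\<close>.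
  Equivariance makes it a translation on the torus, and the translation has to be real before real
  points of \<open>V\<close> and \<open>X\<close> can be compared.

  Boundedness of a character is first obtained on the torus points of \<open>S\<close>, sorted by
  the cones that contain their logarithms. Passing to all of \<open>S\<close> requires every real
  point of \<open>V\<close> to be a limit of real torus points. The difficulty is one of signs:
  characters with nonzero real values on a subgroup of the lattice must extend to the whole lattice,
  which works because the subgroups that arise are saturated.\<close>

abbreviation keys :: "('a \<Rightarrow>\<^sub>0 'b::zero) \<Rightarrow> 'a set" where
  "keys \<equiv> Poly_Mapping.keys"

abbreviation lookup :: "('a \<Rightarrow>\<^sub>0 'b::zero) \<Rightarrow> 'a \<Rightarrow> 'b" where
  "lookup \<equiv> Poly_Mapping.lookup"

abbreviation torus :: "(int ^ 'n \<Rightarrow> 'k::real_field) set" where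
  "torus \<equiv> aff_points {0}"

section \<open>Lattice vectors and rational cones\<close>

lemma lattice_vec_nth [simp]: "lattice_vec v $ i = of_int (v $ i)"
  by (simp add: lattice_vec_def)

lemma lattice_vec_0 [simp]: "lattice_vec 0 = 0"
  and lattice_vec_add: "lattice_vec (a + b) = lattice_vec a + lattice_vec b"
  and lattice_vec_minus: "lattice_vec (- a) = - lattice_vec a"
  and lattice_vec_diff: "lattice_vec (a - b) = lattice_vec a - lattice_vec b"
  by (simp_all add: vec_eq_iff)

lemma lattice_vec_eq_iff [simp]: "lattice_vec a = lattice_vec b \<longleftrightarrow> a = b"
  by (simp add: vec_eq_iff)

definition nsmul :: "nat \<Rightarrow> int ^ 'n \<Rightarrow> int ^ 'n" where
  "nsmul k a = (\<chi> i. int k * a $ i)"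

lemma nsmul_0 [simp]: "nsmul 0 a = 0"
  and nsmul_Suc: "nsmul (Suc k) a = a + nsmul k a"
  by (simp_all add: vec_eq_iff nsmul_def algebra_simps)

definition pairing :: "int ^ 'n \<Rightarrow> int ^ 'n \<Rightarrow> int" where
  "pairing m w = (\<Sum>i\<in>UNIV. m $ i * w $ i)"

lemma inner_lattice_vec: "lattice_vec m \<bullet> lattice_vec w = of_int (pairing m w)"
  by (simp add: inner_vec_def pairing_def)

lemma pairing_add_left: "pairing (a + b) w = pairing a w + pairing b w"
  by (simp add: pairing_def sum.distrib algebra_simps)

lemma pairing_0_left [simp]: "pairing 0 w = 0"
  by (simp add: pairing_def)

text \<open>A rational vector close to \<open>a\<close> need not keep the vanishing inner products
  zero. Simultaneous Dirichlet approximation does: a multiple \<open>q * a\<close> lies so close to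
  an integral \<open>m\<close> that every inner product moves by less than \<open>d\<close>, and an
  integer of modulus below 1 is 0.\<close>

lemma rational_approximation_of_signs:
  fixes a :: "real ^ 'n"
  assumes "finite A"
  obtains m where "\<And>g. g \<in> A \<Longrightarrow> sgn (lattice_vec m \<bullet> lattice_vec g) = sgn (a \<bullet> lattice_vec g)"
proof -
  define L where "L g = (\<Sum>i\<in>UNIV. \<bar>real_of_int (g $ i)\<bar>)" for g :: "int ^ 'n"
  \<comment> \<open>The 1 makes \<open>D\<close> nonempty and gives \<open>d \<le> 1\<close>, which
    forces integral pairings to vanish where \<open>a\<close> does.\<close>
  define D where "D = insert 1 ((\<lambda>g. \<bar>a \<bullet> lattice_vec g\<bar>) ` {g \<in> A. a \<bullet> lattice_vec g \<noteq> 0})"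
  have D: "finite D" "D \<noteq> {}"
    using assms by (auto simp: D_def)
  define d where "d = Min D"
  have d: "0 < d" "d \<le> 1"
    using D Min_le[OF D(1), of 1] by (auto simp: d_def Min_gr_iff D_def simp del: Min_insert Min.insert_remove)
  have dle: "d \<le> \<bar>a \<bullet> lattice_vec g\<bar>" if "g \<in> A" "a \<bullet> lattice_vec g \<noteq> 0" for g
    unfolding d_def using D that by (intro Min_le) (auto simp: D_def)
  define C where "C = (\<Sum>g\<in>A. L g)"
  have LC: "L g \<le> C" "0 \<le> L g" if "g \<in> A" for g
    using assms that member_le_sum[of g A L] by (auto simp: C_def L_def sum_nonneg)
  have C0: "0 \<le> C" unfolding C_def L_def by (intro sum_nonneg) auto
  obtain N :: nat where N: "real N > (C + 1) / d"
    using reals_Archimedean2 by blast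
  have Npos: "N > 0" using N d C0
    by (metis divide_nonneg_pos gr0I linorder_not_le of_nat_0 add_nonneg_nonneg zero_le_one)
  have CN: "C / N < d"
    using N d Npos by (simp add: field_simps)
  \<comment> \<open>Dirichlet's theorem is indexed by natural numbers, so \<open>h\<close> numbers
    the coordinates.\<close>
  obtain h where h: "bij_betw h (UNIV :: 'n set) {..<CARD('n)}"
    using ex_bij_betw_finite_nat[of "UNIV :: 'n set"] by (auto simp: lessThan_atLeast0)
  obtain q p where qp: "0 < (q::int)"
     "\<And>i. i < CARD('n) \<Longrightarrow> \<bar>of_int q * (a $ (the_inv h i)) - of_int (p i)\<bar> < 1 / N"
    using Dirichlet_approx_simult[OF Npos, of "CARD('n)" "\<lambda>i. a $ (the_inv h i)"] by metis
  define m :: "int ^ 'n" where "m = (\<chi> i. p (h i))"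
  have inj: "inj h" using h by (auto simp: bij_betw_def)
  have near: "\<bar>of_int q * a $ i - of_int (m $ i)\<bar> \<le> 1 / N" for i
  proof -
    have "h i < CARD('n)" using h by (auto simp: bij_betw_def)
    from qp(2)[OF this] show ?thesis by (simp add: m_def the_inv_f_f[OF inj] less_imp_le)
  qed
  have est: "\<bar>of_int q * (a \<bullet> lattice_vec g) - lattice_vec m \<bullet> lattice_vec g\<bar> < d" if "g \<in> A" for g
  proof -
    have "of_int q * (a \<bullet> lattice_vec g) - lattice_vec m \<bullet> lattice_vec g
        = (\<Sum>i\<in>UNIV. (of_int q * a $ i - of_int (m $ i)) * of_int (g $ i))"
      by (simp add: inner_vec_def sum_subtractf sum_distrib_left algebra_simps)
    also have "\<bar>\<dots>\<bar> \<le> (\<Sum>i\<in>UNIV. \<bar>of_int q * a $ i - of_int (m $ i)\<bar> * \<bar>of_int (g $ i)\<bar>)"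
      by (rule order_trans[OF sum_abs]) (simp add: abs_mult)
    also have "\<dots> \<le> (\<Sum>i\<in>UNIV. 1 / N * \<bar>of_int (g $ i)\<bar>)"
      by (intro sum_mono mult_right_mono near) auto
    also have "\<dots> = L g / N"
      by (simp add: L_def sum_divide_distrib)
    also have "\<dots> \<le> C / N" using LC that by (simp add: divide_right_mono)
    finally show ?thesis using CN by linarith
  qed
  show thesis
  proof
    fix g assume g: "g \<in> A"
    have q1: "1 \<le> real_of_int q" using qp(1) by linarith
    consider "a \<bullet> lattice_vec g = 0" | "a \<bullet> lattice_vec g > 0" | "a \<bullet> lattice_vec g < 0" by linarith
    then show "sgn (lattice_vec m \<bullet> lattice_vec g) = sgn (a \<bullet> lattice_vec g)"
    proof cases
      case 1
      then have "\<bar>real_of_int (pairing m g)\<bar> < 1"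
        using est[OF g] d by (simp add: inner_lattice_vec)
      then have "pairing m g = 0" by linarith
      then show ?thesis using 1 by (simp add: inner_lattice_vec)
    next
      case 2
      then have "d \<le> 1 * (a \<bullet> lattice_vec g)" using dle[OF g] by simp
      also have "\<dots> \<le> of_int q * (a \<bullet> lattice_vec g)" using 2 q1 by (intro mult_right_mono) auto
      finally show ?thesis using est[OF g] 2 by (simp add: sgn_if)
    next
      case 3
      then have "d \<le> 1 * - (a \<bullet> lattice_vec g)" using dle[OF g] by simp
      also have "\<dots> \<le> of_int q * - (a \<bullet> lattice_vec g)" using 3 q1 by (intro mult_right_mono) auto
      finally have "lattice_vec m \<bullet> lattice_vec g < 0" using est[OF g] by linarith
      then show ?thesis using 3 by simp
    qed
  qed
qed

section \<open>Cone monoids, faces and localization\<close>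

lemma cone_monoid_0 [simp]: "0 \<in> cone_monoid \<tau>"
  and cone_monoid_add: "a \<in> cone_monoid \<tau> \<Longrightarrow> b \<in> cone_monoid \<tau> \<Longrightarrow> a + b \<in> cone_monoid \<tau>"
  and cone_monoid_antimono: "\<gamma> \<subseteq> \<tau> \<Longrightarrow> cone_monoid \<tau> \<subseteq> cone_monoid \<gamma>"
  and cone_monoid_zero_cone [simp]: "cone_monoid {0} = UNIV"
  by (auto simp: cone_monoid_def lattice_vec_add inner_add_left)

lemma cone_monoid_nsmul: "a \<in> cone_monoid \<tau> \<Longrightarrow> nsmul k a \<in> cone_monoid \<tau>"
  by (induction k) (auto simp: nsmul_Suc cone_monoid_add)

lemma cone_monoid_sum: "(\<And>i. i \<in> I \<Longrightarrow> f i \<in> cone_monoid \<tau>) \<Longrightarrow> sum f I \<in> cone_monoid \<tau>"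
  by (induction I rule: infinite_finite_induct) (auto simp: cone_monoid_add)

lemma inner_ge_0_cone_hull:
  assumes "\<And>g. g \<in> G \<Longrightarrow> a \<bullet> g \<ge> 0" "u \<in> convex_cone hull G"
  shows "a \<bullet> u \<ge> 0"
  using hull_minimal[of G "{x. a \<bullet> x \<ge> 0}" convex_cone] convex_cone_halfspace_ge[of a] assms by auto

lemma cone_monoid_hull:
  "m \<in> cone_monoid (convex_cone hull (lattice_vec ` G)) \<longleftrightarrow> (\<forall>g\<in>G. pairing m g \<ge> 0)"
proof
  assume m: "\<forall>g\<in>G. pairing m g \<ge> 0"
  show "m \<in> cone_monoid (convex_cone hull (lattice_vec ` G))"
    unfolding cone_monoid_def mem_Collect_eq
    by (rule ballI, rule inner_ge_0_cone_hull[of "lattice_vec ` G"]) (use m in \<open>auto simp: inner_lattice_vec\<close>)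
next
  assume m: "m \<in> cone_monoid (convex_cone hull (lattice_vec ` G))"
  show "\<forall>g\<in>G. pairing m g \<ge> 0"
  proof
    fix g assume "g \<in> G"
    then have "lattice_vec g \<in> convex_cone hull (lattice_vec ` G)" by (simp add: hull_inc)
    then have "lattice_vec m \<bullet> lattice_vec g \<ge> 0" using m unfolding cone_monoid_def by blast
    then show "pairing m g \<ge> 0" by (simp add: inner_lattice_vec)
  qed
qed

lemma in_cone_hull_image_iff:
  fixes f :: "'a \<Rightarrow> 'b::real_vector"
  assumes "finite G"
  shows "x \<in> convex_cone hull (f ` G) \<longleftrightarrow> (\<exists>c. (\<forall>g\<in>G. 0 \<le> c g) \<and> x = (\<Sum>g\<in>G. c g *\<^sub>R f g))"
proof
  assume x: "x \<in> convex_cone hull (f ` G)"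
    let ?Q = "{x. \<exists>c. (\<forall>g\<in>G. 0 \<le> c g) \<and> x = (\<Sum>g\<in>G. (c g :: real) *\<^sub>R f g)}"
    have "convex_cone ?Q"
      unfolding convex_cone_iff
    proof (intro conjI ballI allI impI)
      show "0 \<in> ?Q" by (auto intro!: exI[of _ "\<lambda>_. 0"])
    next
      fix x y assume "x \<in> ?Q" "y \<in> ?Q"
      then obtain c d where "\<forall>g\<in>G. 0 \<le> c g" "\<forall>g\<in>G. 0 \<le> d g"
        "x = (\<Sum>g\<in>G. (c g :: real) *\<^sub>R f g)" "y = (\<Sum>g\<in>G. (d g :: real) *\<^sub>R f g)" by auto
      then show "x + y \<in> ?Q"
        by (auto intro!: exI[of _ "\<lambda>g. c g + d g"] simp: sum.distrib scaleR_add_left)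
    next
      fix x and k :: real assume "x \<in> ?Q" "0 \<le> k"
      then obtain c where "\<forall>g\<in>G. 0 \<le> c g" "x = (\<Sum>g\<in>G. (c g :: real) *\<^sub>R f g)" by auto
      with \<open>0 \<le> k\<close> show "k *\<^sub>R x \<in> ?Q"
        by (auto intro!: exI[of _ "\<lambda>g. k * c g"] simp: scaleR_sum_right)
    qed
    moreover have "f ` G \<subseteq> ?Q"
    proof
      fix x assume "x \<in> f ` G"
      then obtain g where g: "g \<in> G" "x = f g" by auto
      then show "x \<in> ?Q" using assms
        by (auto intro!: exI[of _ "\<lambda>h. if h = g then 1 else 0"] simp: if_distrib[of "\<lambda>c. c *\<^sub>R _"] cong: if_cong)
    qed
    ultimately show "\<exists>c. (\<forall>g\<in>G. 0 \<le> c g) \<and> x = (\<Sum>g\<in>G. c g *\<^sub>R f g)"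
      using x hull_minimal[of "f ` G" ?Q convex_cone] by blast
  next
  assume "\<exists>c. (\<forall>g\<in>G. 0 \<le> c g) \<and> x = (\<Sum>g\<in>G. c g *\<^sub>R f g)"
  then obtain c where c: "\<forall>g\<in>G. 0 \<le> c g" "x = (\<Sum>g\<in>G. c g *\<^sub>R f g)" by blast
  have "(\<Sum>g\<in>H. c g *\<^sub>R f g) \<in> convex_cone hull (f ` G)" if "H \<subseteq> G" for H
    using finite_subset[OF that assms] that
  proof (induction H rule: finite_induct)
    case (insert h H)
    then show ?case using c(1)
      by (auto intro!: convex_cone_hull_add convex_cone_hull_mul simp: hull_inc)
  qed (simp add: convex_cone_hull_contains_0)
  then show "x \<in> convex_cone hull (f ` G)" using c(2) by blast
qed

text \<open>A separating real functional is nonnegative on the cone by scaling; an integral vector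
  with the same signs on \<open>w\<close> and on the generators inherits both properties.\<close>

lemma rational_separation:
  assumes "rational_polyhedral_cone \<tau>" "lattice_vec w \<notin> \<tau>"
  obtains m where "m \<in> cone_monoid \<tau>" "pairing m w < 0"
proof -
  obtain G where G: "finite G" "\<tau> = convex_cone hull (lattice_vec ` G)"
    using assms by (auto simp: rational_polyhedral_cone_def)
  have cl: "closed \<tau>" "convex \<tau>"
    using G by (auto simp: closed_convex_cone_hull convex_convex_cone_hull)
  obtain a b where ab: "a \<bullet> lattice_vec w < b" "\<And>x. x \<in> \<tau> \<Longrightarrow> b < a \<bullet> x"
    using separating_hyperplane_closed_point[OF cl(2,1) assms(2)] by blast
  have b: "b < 0" using ab(2)[of 0] G by (simp add: convex_cone_hull_contains_0)
  have pos: "0 \<le> a \<bullet> x" if "x \<in> \<tau>" for x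
  proof (rule ccontr)
    assume neg: "\<not> 0 \<le> a \<bullet> x"
    \<comment> \<open>\<open>b\<close> and \<open>a \<bullet> x\<close> are both negative. This
      positive multiple of \<open>x\<close> takes the value \<open>b\<close> itself, which strict
      separation excludes.\<close>
    have "(b / (a \<bullet> x)) *\<^sub>R x \<in> \<tau>"
      using that G b neg by (auto intro!: convex_cone_hull_mul divide_nonpos_neg)
    from ab(2)[OF this] show False using neg by simp
  qed
  obtain m where m: "\<And>g. g \<in> insert w G \<Longrightarrow> sgn (lattice_vec m \<bullet> lattice_vec g) = sgn (a \<bullet> lattice_vec g)"
    using rational_approximation_of_signs[of "insert w G" a] G by auto
  show thesis
  proof
    have "pairing m g \<ge> 0" if "g \<in> G" for g
      using m[of g] that pos[of "lattice_vec g"] G(2) hull_inc[of "lattice_vec g" "lattice_vec ` G"]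
      by (auto simp: inner_lattice_vec sgn_if split: if_splits)
    then show "m \<in> cone_monoid \<tau>" using G cone_monoid_hull by blast
    show "pairing m w < 0" using m[of w] ab b
      by (auto simp: inner_lattice_vec sgn_if split: if_splits)
  qed
qed

text \<open>\<open>U\<^sub>\<gamma>\<close> is then the principal open subset of
  \<open>U\<^sub>\<tau>\<close> on which the character \<open>e\<close> does not vanish.\<close>

definition exposes :: "int ^ 'n \<Rightarrow> (real ^ 'n) set \<Rightarrow> (real ^ 'n) set \<Rightarrow> bool" where
  "exposes e \<gamma> \<tau> \<longleftrightarrow> e \<in> cone_monoid \<tau> \<and> \<gamma> = {x \<in> \<tau>. lattice_vec e \<bullet> x = 0}"

text \<open>Faces of polyhedra are exposed by real functionals; an integral one is obtained by
  copying the signs on the generators.\<close>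

lemma face_exposed:
  assumes "rational_polyhedral_cone \<tau>" "cone_face \<gamma> \<tau>"
  obtains e where "exposes e \<gamma> \<tau>"
proof -
  obtain G where G: "finite G" "\<tau> = convex_cone hull (lattice_vec ` G)"
    using assms by (auto simp: rational_polyhedral_cone_def)
  have "polyhedron \<tau>"
    using G by (simp add: polyhedron_convex_cone_hull)
  then have "\<gamma> exposed_face_of \<tau>"
    using assms exposed_face_of_polyhedron by (auto simp: cone_face_def)
  then obtain a b where ab: "\<tau> \<subseteq> {x. a \<bullet> x \<le> b}" "\<gamma> = \<tau> \<inter> {x. a \<bullet> x = b}"
    by (auto simp: exposed_face_of_def)
  have mul: "c *\<^sub>R x \<in> \<tau>" if "x \<in> \<tau>" "0 \<le> c" for c x
    using that G by (auto intro: convex_cone_hull_mul)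
  obtain x where x: "x \<in> \<gamma>" using assms by (auto simp: cone_face_def)
  \<comment> \<open>The functional equals \<open>b\<close> at \<open>x\<close> and is at most
    \<open>b\<close> at the multiples 0 and 2 of \<open>x\<close>; this forces
    \<open>b = 0\<close>.\<close>
  have "2 *\<^sub>R x \<in> \<tau>" "0 *\<^sub>R x \<in> \<tau>"
    using x ab mul[of x 2] mul[of x 0] by auto
  then have "a \<bullet> (2 *\<^sub>R x) \<le> b" "a \<bullet> (0 *\<^sub>R x) \<le> b"
    using ab(1) by blast+
  then have b: "b = 0" using x ab by auto
  obtain e where e: "\<And>g. g \<in> G \<Longrightarrow> sgn (lattice_vec e \<bullet> lattice_vec g) = sgn (- a \<bullet> lattice_vec g)"
    using rational_approximation_of_signs[of G "- a"] G by metis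
  have gG: "lattice_vec g \<in> \<tau>" if "g \<in> G" for g
    using that G by (simp add: hull_inc)
  have epos: "e \<in> cone_monoid \<tau>"
    unfolding G(2) cone_monoid_hull
  proof
    fix g assume "g \<in> G"
    then show "0 \<le> pairing e g" using e[of g] gG[of g] ab(1) b
      by (auto simp: inner_lattice_vec sgn_if split: if_splits)
  qed
  \<comment> \<open>Both functionals vanish on a nonnegative combination exactly when they vanish on every generator used.\<close>
  have "lattice_vec e \<bullet> x = 0 \<longleftrightarrow> a \<bullet> x = 0" if x: "x \<in> \<tau>" for x
  proof -
    obtain c where c: "\<forall>g\<in>G. 0 \<le> c g" "x = (\<Sum>g\<in>G. c g *\<^sub>R lattice_vec g)"
      using x in_cone_hull_image_iff[OF G(1)] G(2) by blast
    have 1: "lattice_vec e \<bullet> lattice_vec g \<ge> 0" if "g \<in> G" for g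
      using epos gG[OF that] by (auto simp: cone_monoid_def)
    have 2: "a \<bullet> lattice_vec g \<le> 0" if "g \<in> G" for g
      using ab(1) b gG[OF that] by auto
    have "lattice_vec e \<bullet> x = 0 \<longleftrightarrow> (\<forall>g\<in>G. c g * (lattice_vec e \<bullet> lattice_vec g) = 0)"
      unfolding c(2) inner_sum_right inner_scaleR_right
      using c 1 by (intro sum_nonneg_eq_0_iff G) auto
    also have "\<dots> \<longleftrightarrow> (\<forall>g\<in>G. c g * (- a \<bullet> lattice_vec g) = 0)"
    proof (intro ball_cong refl)
      fix g assume "g \<in> G"
      then show "c g * (lattice_vec e \<bullet> lattice_vec g) = 0 \<longleftrightarrow> c g * (- a \<bullet> lattice_vec g) = 0"
        using e[of g] by (metis mult_eq_0_iff sgn_eq_0_iff)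
    qed
    also have "\<dots> \<longleftrightarrow> - a \<bullet> x = 0"
      unfolding c(2) inner_sum_right inner_scaleR_right
      using c 2 by (intro sum_nonneg_eq_0_iff[symmetric] G) (auto simp: mult_nonneg_nonpos)
    finally show ?thesis by simp
  qed
  then have "exposes e \<gamma> \<tau>" using epos ab b by (auto simp: exposes_def)
  then show thesis by (rule that)
qed

text \<open>A generator on which \<open>e\<close> is 0 lies in \<open>\<gamma>\<close>, so
  \<open>m\<close> is already nonnegative on it. On the others \<open>e\<close> is at least 1 by
  integrality, and a large multiple of it outweighs \<open>m\<close>.\<close>

lemma localization:
  assumes "rational_polyhedral_cone \<tau>" "e \<in> cone_monoid \<tau>"
    and "\<And>x. x \<in> \<tau> \<Longrightarrow> lattice_vec e \<bullet> x = 0 \<Longrightarrow> x \<in> \<gamma>"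
    and "m \<in> cone_monoid \<gamma>"
  shows "\<exists>N. \<forall>k\<ge>N. m + nsmul k e \<in> cone_monoid \<tau>"
proof -
  obtain G where G: "finite G" "\<tau> = convex_cone hull (lattice_vec ` G)"
    using assms by (auto simp: rational_polyhedral_cone_def)
  define N where "N = (\<Sum>g\<in>G. nat \<bar>pairing m g\<bar>)"
  have "m + nsmul k e \<in> cone_monoid \<tau>" if k: "k \<ge> N" for k
    unfolding G(2) cone_monoid_hull
  proof
    fix g assume g: "g \<in> G"
    have gt: "lattice_vec g \<in> \<tau>" using g G by (simp add: hull_inc)
    have ns: "pairing (nsmul k e) g = int k * pairing e g"
      by (simp add: pairing_def nsmul_def sum_distrib_left mult.assoc)
    have e0: "pairing e g \<ge> 0" using assms(2) g unfolding G(2) cone_monoid_hull by auto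
    show "0 \<le> pairing (m + nsmul k e) g"
    proof (cases "pairing e g = 0")
      case True
      then have "lattice_vec g \<in> \<gamma>" using assms(3)[OF gt] by (simp add: inner_lattice_vec)
      then have "pairing m g \<ge> 0" using assms(4) by (force simp: cone_monoid_def inner_lattice_vec)
      then show ?thesis using True by (simp add: pairing_add_left ns)
    next
      case False
      have "nat \<bar>pairing m g\<bar> \<le> k"
        using k g G(1) member_le_sum[of g G "\<lambda>g. nat \<bar>pairing m g\<bar>"] by (simp add: N_def)
      moreover have "int k \<le> int k * pairing e g" using False e0 by (simp add: mult_le_cancel_left1)
      ultimately show ?thesis by (simp add: pairing_add_left ns)
    qed
  qed
  then show ?thesis by blast
qed

section \<open>Strongly convex cones and their rays\<close>

lemma toric_cone_pointed:
  assumes "toric_cone \<tau>" "x \<in> \<tau>" "- x \<in> \<tau>"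
  shows "x = 0"
proof -
  have "x = - (- x)" by simp
  then have "x \<in> \<tau> \<inter> uminus ` \<tau>" using assms by blast
  then have "x \<in> {0}" using assms(1) unfolding toric_cone_def by blast
  then show ?thesis by simp
qed

lemma toric_cone_convex_cone: "toric_cone \<tau> \<Longrightarrow> convex_cone \<tau>"
  unfolding toric_cone_def rational_polyhedral_cone_def
  using convex_cone_convex_cone_hull by blast

lemma toric_cone_closed: "toric_cone \<tau> \<Longrightarrow> closed \<tau>"
  unfolding toric_cone_def rational_polyhedral_cone_def
  by (metis closed_convex_cone_hull finite_imageI)

lemma zero_cone_face:
  assumes "toric_cone \<tau>"
  shows "cone_face {0} \<tau>"
  unfolding cone_face_def face_of_def
proof (intro conjI ballI impI)
  have cc: "convex_cone \<tau>" using assms by (rule toric_cone_convex_cone)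
  then show "{0} \<subseteq> \<tau>" by (simp add: convex_cone_contains_0)
  show "convex {0 :: real ^ 'a}" "{0 :: real ^ 'a} \<noteq> {}" by simp_all
  fix a b x assume ab: "a \<in> \<tau>" "b \<in> \<tau>" "x \<in> {0}" "x \<in> open_segment a b"
  obtain u where u: "0 < u" "u < 1" "x = (1 - u) *\<^sub>R a + u *\<^sub>R b"
    using ab(4) unfolding in_segment by blast
  have sum0: "(1 - u) *\<^sub>R a + u *\<^sub>R b = 0" using u(3) ab(3) by simp
  then have "- ((1 - u) *\<^sub>R a) = u *\<^sub>R b" by (metis add_eq_0_iff)
  moreover have "(1 - u) *\<^sub>R a \<in> \<tau>" "u *\<^sub>R b \<in> \<tau>"
    using u(1,2) ab(1,2) by (simp_all add: convex_cone_scaleR[OF cc])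
  ultimately have "(1 - u) *\<^sub>R a = 0"
    by (metis toric_cone_pointed[OF assms])
  then have "a = 0" using u(2) by simp
  moreover have "b = 0" using u(1) sum0 \<open>a = 0\<close> by simp
  ultimately show "a \<in> {0}" "b \<in> {0}" by simp_all
qed

lemma convex_cone_sum_in:
  assumes "convex_cone C" "\<And>i. i \<in> I \<Longrightarrow> x i \<in> C"
  shows "(\<Sum>i\<in>I. x i) \<in> C"
  using assms(2)
  by (induction I rule: infinite_finite_induct)
    (simp_all add: convex_cone_add[OF assms(1)] convex_cone_contains_0[OF assms(1)])

lemma toric_cone_sum_eq_0:
  assumes "toric_cone \<tau>" "finite I" "\<And>i. i \<in> I \<Longrightarrow> x i \<in> \<tau>" "(\<Sum>i\<in>I. x i) = 0" "i \<in> I"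
  shows "x i = 0"
proof (rule toric_cone_pointed[OF assms(1)])
  have cc: "convex_cone \<tau>" using assms(1) by (rule toric_cone_convex_cone)
  have "- x i = (\<Sum>j\<in>I - {i}. x j)"
    using assms(4) sum.remove[OF assms(2,5), of x] by (metis add_eq_0_iff)
  also have "\<dots> \<in> \<tau>"
    by (rule convex_cone_sum_in[OF cc]) (use assms(3) in blast)
  finally show "- x i \<in> \<tau>" .
qed (use assms(3,5) in blast)

text \<open>In a generating set of least cardinality no generator is a nonnegative combination of
  the others. In a pointed cone this makes each of them span an extreme ray.\<close>

lemma toric_cone_rays:
  assumes "toric_cone \<tau>"
  obtains G where "finite G" "0 \<notin> G" "\<tau> = convex_cone hull (lattice_vec ` G)"
    "\<And>g. g \<in> G \<Longrightarrow> cone_face (convex_cone hull {lattice_vec g}) \<tau>"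
proof -
  define Q where "Q G \<longleftrightarrow> finite G \<and> \<tau> = convex_cone hull (lattice_vec ` G)" for G :: "(int ^ 'a) set"
  obtain G0 where "Q G0"
    using assms unfolding Q_def toric_cone_def rational_polyhedral_cone_def by blast
  then obtain G where G: "Q G" and least: "\<And>H. Q H \<Longrightarrow> card G \<le> card H"
    using ex_has_least_nat[of Q G0 card] by blast
  have fin: "finite G" and \<tau>: "\<tau> = convex_cone hull (lattice_vec ` G)"
    using G by (auto simp: Q_def)
  have cc: "convex_cone \<tau>" using assms by (rule toric_cone_convex_cone)
  have gt: "lattice_vec g \<in> \<tau>" if "g \<in> G" for g
    using that \<tau> by (simp add: hull_inc)
  have irr: "lattice_vec g \<notin> convex_cone hull (lattice_vec ` (G - {g}))" if g: "g \<in> G" for g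
  proof
    assume *: "lattice_vec g \<in> convex_cone hull (lattice_vec ` (G - {g}))"
    have "lattice_vec ` G \<subseteq> convex_cone hull (lattice_vec ` (G - {g}))"
    proof
      fix x assume "x \<in> lattice_vec ` G"
      then obtain h where "h \<in> G" "x = lattice_vec h" by blast
      then show "x \<in> convex_cone hull (lattice_vec ` (G - {g}))"
        using * by (cases "h = g") (auto intro!: hull_inc)
    qed
    then have "\<tau> = convex_cone hull (lattice_vec ` (G - {g}))"
      unfolding \<tau> by (intro antisym hull_minimal hull_mono convex_cone_convex_cone_hull) auto
    then have "Q (G - {g})" using fin by (simp add: Q_def)
    from least[OF this] show False
      using g fin by (metis card_Diff1_less linorder_not_less)
  qed
  have nz: "0 \<notin> G" using irr[of 0] by (auto simp: convex_cone_hull_contains_0)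
  have ray: "cone_face (convex_cone hull {lattice_vec g}) \<tau>" (is "cone_face ?\<rho> \<tau>") if g: "g \<in> G" for g
    unfolding cone_face_def face_of_def
  proof (intro conjI ballI impI)
    show sub: "?\<rho> \<subseteq> \<tau>" using gt[OF g] cc by (intro hull_minimal) auto
    show "convex ?\<rho>" by (rule convex_convex_cone_hull)
    show "?\<rho> \<noteq> {}" by (rule convex_cone_hull_nonempty)
    fix a b x assume ab: "a \<in> \<tau>" "b \<in> \<tau>" "x \<in> ?\<rho>" "x \<in> open_segment a b"
    obtain u where u: "0 < u" "u < 1" "x = (1 - u) *\<^sub>R a + u *\<^sub>R b"
      using ab by (auto simp: in_segment)
    obtain k where k: "0 \<le> k" "x = k *\<^sub>R lattice_vec g"
      using ab(3) in_cone_hull_image_iff[of "{g}" x lattice_vec] by auto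
    obtain c where c: "\<forall>g\<in>G. 0 \<le> c g" "a = (\<Sum>g\<in>G. c g *\<^sub>R lattice_vec g)"
      using ab(1) \<tau> in_cone_hull_image_iff[OF fin] by blast
    obtain d where d: "\<forall>g\<in>G. 0 \<le> d g" "b = (\<Sum>g\<in>G. d g *\<^sub>R lattice_vec g)"
      using ab(2) \<tau> in_cone_hull_image_iff[OF fin] by blast
    define s where "s h = (1 - u) * c h + u * d h" for h
    have s0: "0 \<le> s h" if "h \<in> G" for h using c d u that by (simp add: s_def)
    have xs: "x = (\<Sum>h\<in>G. s h *\<^sub>R lattice_vec h)"
      unfolding u(3) c(2) d(2) s_def
      by (simp add: scaleR_sum_right scaleR_add_left sum.distrib)
    also have "\<dots> = s g *\<^sub>R lattice_vec g + (\<Sum>h\<in>G-{g}. s h *\<^sub>R lattice_vec h)"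
      using fin g by (simp add: sum.remove)
    finally have split: "(k - s g) *\<^sub>R lattice_vec g = (\<Sum>h\<in>G-{g}. s h *\<^sub>R lattice_vec h)"
      using k by (simp add: algebra_simps)
    \<comment> \<open>Otherwise \<open>split\<close> could be divided by \<open>k - s g > 0\<close>,
      and \<open>g\<close> would be a combination of the other generators.\<close>
    have "k \<le> s g"
    proof (rule ccontr)
      assume "\<not> k \<le> s g"
      then have "lattice_vec g = (\<Sum>h\<in>G-{g}. (s h / (k - s g)) *\<^sub>R lattice_vec h)"
        using arg_cong[OF split, of "\<lambda>v. (1 / (k - s g)) *\<^sub>R v"] by (simp add: scaleR_sum_right)
      then have "lattice_vec g \<in> convex_cone hull (lattice_vec ` (G - {g}))"
        using fin s0 \<open>\<not> k \<le> s g\<close> by (subst in_cone_hull_image_iff) (auto intro!: exI[of _ "\<lambda>h. s h / (k - s g)"])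
      then show False using irr[OF g] by blast
    qed
    \<comment> \<open>The coefficients of a relation between nonnegative terms with sum 0.
      Pointedness makes all of them vanish, and with them the parts of \<open>a\<close> and
      \<open>b\<close> off the ray.\<close>
    define s' where "s' h = (if h = g then s g - k else s h)" for h
    have "(\<Sum>h\<in>G - {g}. s' h *\<^sub>R lattice_vec h) = (k - s g) *\<^sub>R lattice_vec g"
      unfolding split by (intro sum.cong) (auto simp: s'_def)
    then have "(\<Sum>h\<in>G. s' h *\<^sub>R lattice_vec h) = 0"
      unfolding sum.remove[OF fin g] by (simp add: s'_def algebra_simps)
    moreover have "s' h *\<^sub>R lattice_vec h \<in> \<tau>" if "h \<in> G" for h
      using that s0 \<open>k \<le> s g\<close> gt by (auto simp: s'_def intro!: convex_cone_scaleR[OF cc])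
    ultimately have s'0: "s' h = 0" if "h \<in> G" for h
      using toric_cone_sum_eq_0[OF assms fin, of "\<lambda>h. s' h *\<^sub>R lattice_vec h" h] nz that
        lattice_vec_eq_iff[of h 0] by fastforce
    have cd0: "c h = 0" "d h = 0" if "h \<in> G" "h \<noteq> g" for h
      using s'0[OF that(1)] that u c(1) d(1) by (auto simp: s'_def s_def add_nonneg_eq_0_iff)
    have "a = c g *\<^sub>R lattice_vec g"
      unfolding c(2) sum.remove[OF fin g] using cd0(1) by (auto intro!: sum.neutral)
    moreover have "b = d g *\<^sub>R lattice_vec g"
      unfolding d(2) sum.remove[OF fin g] using cd0(2) by (auto intro!: sum.neutral)
    ultimately show "a \<in> ?\<rho>" "b \<in> ?\<rho>"
      using c(1) d(1) g by (auto intro!: convex_cone_hull_mul simp: hull_inc)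
  qed
  show thesis using that[OF fin nz \<tau> ray] .
qed

section \<open>Points of affine toric varieties\<close>

lemma aff_points_0: "x \<in> aff_points \<tau> \<Longrightarrow> x 0 = 1"
  and aff_points_add: "x \<in> aff_points \<tau> \<Longrightarrow> a \<in> cone_monoid \<tau> \<Longrightarrow> b \<in> cone_monoid \<tau> \<Longrightarrow> x (a + b) = x a * x b"
  and aff_points_outside: "x \<in> aff_points \<tau> \<Longrightarrow> m \<notin> cone_monoid \<tau> \<Longrightarrow> x m = 0"
  by (simp_all add: aff_points_def)

lemma aff_points_nsmul:
  "x \<in> aff_points \<tau> \<Longrightarrow> a \<in> cone_monoid \<tau> \<Longrightarrow> x (nsmul k a) = x a ^ k"
  by (induction k) (simp_all add: aff_points_0 aff_points_add nsmul_Suc cone_monoid_nsmul)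

lemma aff_points_sum:
  "finite I \<Longrightarrow> x \<in> aff_points \<tau> \<Longrightarrow> (\<And>i. i \<in> I \<Longrightarrow> f i \<in> cone_monoid \<tau>)
    \<Longrightarrow> x (sum f I) = (\<Prod>i\<in>I. x (f i))"
  by (induction I rule: finite_induct) (simp_all add: aff_points_0 aff_points_add cone_monoid_sum)

lemma torus_iff: "t \<in> torus \<longleftrightarrow> t 0 = 1 \<and> (\<forall>a b. t (a + b) = t a * t b)"
  by (simp add: aff_points_def)

lemma torus_add: "t \<in> torus \<Longrightarrow> t (a + b) = t a * t b"
  by (simp add: torus_iff)

lemma torus_uminus: "t \<in> torus \<Longrightarrow> t (- a) = inverse (t a)"
  by (metis add.right_inverse inverse_unique torus_iff)

lemma torus_diff: "t \<in> torus \<Longrightarrow> t (a - b) = t a / t b"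
  using torus_add[of t a "- b"] by (simp add: torus_uminus divide_inverse)

lemma torus_nonzero: "t \<in> torus \<Longrightarrow> t a \<noteq> 0"
  by (metis add.right_inverse mult_zero_left torus_iff zero_neq_one)

lemma torus_mult: "s \<in> torus \<Longrightarrow> t \<in> torus \<Longrightarrow> (\<lambda>m. s m * t m) \<in> torus"
  and torus_inverse: "t \<in> torus \<Longrightarrow> (\<lambda>m. inverse (t m)) \<in> torus"
  and torus_divide: "s \<in> torus \<Longrightarrow> t \<in> torus \<Longrightarrow> (\<lambda>m. s m / t m) \<in> torus"
  and torus_one: "(\<lambda>m. 1) \<in> torus"
  by (simp_all add: torus_iff)

lemma torus_complexify: "t \<in> torus \<Longrightarrow> complexify t \<in> torus"
  by (simp add: torus_iff complexify_def)

lemma aff_points_complexify: "x \<in> aff_points \<tau> \<Longrightarrow> complexify x \<in> aff_points \<tau>"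
  by (simp add: aff_points_def complexify_def)

lemma restr_apply: "m \<in> cone_monoid \<tau> \<Longrightarrow> restr \<tau> y m = y m"
  by (simp add: restr_def)

lemma restr_in_aff_points: "\<gamma> \<subseteq> \<tau> \<Longrightarrow> y \<in> aff_points \<gamma> \<Longrightarrow> restr \<tau> y \<in> aff_points \<tau>"
  using cone_monoid_antimono[of \<gamma> \<tau>] by (auto simp: aff_points_def restr_def cone_monoid_add subset_iff)

lemma restr_restr: "\<gamma> \<subseteq> \<tau> \<Longrightarrow> restr \<tau> (restr \<gamma> y) = restr \<tau> y"
  using cone_monoid_antimono[of \<gamma> \<tau>] by (auto simp: restr_def fun_eq_iff)

lemma restr_self: "x \<in> aff_points \<tau> \<Longrightarrow> restr \<tau> x = x"
  by (auto simp: restr_def aff_points_def)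

lemma localize_nonzero:
  assumes "y \<in> aff_points \<gamma>" "e \<in> cone_monoid \<gamma>" "- e \<in> cone_monoid \<gamma>"
  shows "y e \<noteq> 0"
  using aff_points_add[OF assms] aff_points_0[OF assms(1)] by auto

lemma exposes_subset: "exposes e \<gamma> \<tau> \<Longrightarrow> \<gamma> \<subseteq> \<tau>"
  and exposes_mem: "exposes e \<gamma> \<tau> \<Longrightarrow> e \<in> cone_monoid \<tau>"
  by (auto simp: exposes_def)

lemma exposes_face_mem:
  assumes "exposes e \<gamma> \<tau>"
  shows "e \<in> cone_monoid \<gamma>" "- e \<in> cone_monoid \<gamma>"
  using assms by (auto simp: exposes_def cone_monoid_def lattice_vec_minus)

lemma exposes_localization:
  assumes "rational_polyhedral_cone \<tau>" "exposes e \<gamma> \<tau>" "m \<in> cone_monoid \<gamma>"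
  obtains N where "\<And>k. k \<ge> N \<Longrightarrow> m + nsmul k e \<in> cone_monoid \<tau>"
  using localization[of \<tau> e \<gamma> m] assms by (auto simp: exposes_def)

text \<open>Every character on \<open>U\<^sub>\<gamma>\<close> becomes one on
  \<open>U\<^sub>\<tau>\<close> after multiplication by a power of \<open>e\<close>, and
  \<open>e\<close> has nonzero values on \<open>U\<^sub>\<gamma>\<close>.\<close>

lemma localize_unique:
  assumes "rational_polyhedral_cone \<tau>" "exposes e \<gamma> \<tau>"
    and y: "y \<in> aff_points \<gamma>" "y' \<in> aff_points \<gamma>" and eq: "restr \<tau> y = restr \<tau> y'"
  shows "y = y'"
proof
  fix m
  show "y m = y' m"
  proof (cases "m \<in> cone_monoid \<gamma>")
    case True
    obtain N where N: "m + nsmul N e \<in> cone_monoid \<tau>"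
      using exposes_localization[OF assms(1,2) True] by blast
    have e: "e \<in> cone_monoid \<gamma>" "y e \<noteq> 0"
      using exposes_face_mem[OF assms(2)] localize_nonzero[OF y(1)] by auto
    have "y e = y' e"
      using fun_cong[OF eq, of e] exposes_mem[OF assms(2)] by (simp add: restr_apply)
    moreover have "y (m + nsmul N e) = y' (m + nsmul N e)"
      using fun_cong[OF eq, of "m + nsmul N e"] N by (simp add: restr_apply)
    ultimately show ?thesis
      using y e True by (simp add: aff_points_add cone_monoid_nsmul aff_points_nsmul)
  qed (use y in \<open>simp add: aff_points_outside\<close>)
qed

text \<open>The value at \<open>m\<close> is forced to be \<open>x (m + nsmul k e) / x e ^ k\<close>
  for large \<open>k\<close>; multiplicativity of \<open>x\<close> makes this independent of
  \<open>k\<close>.\<close>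

lemma localize_exists:
  assumes rp: "rational_polyhedral_cone \<tau>" and e: "e \<in> cone_monoid \<tau>" "- e \<in> cone_monoid \<gamma>" and sub: "\<gamma> \<subseteq> \<tau>"
    and vanish: "\<And>u. u \<in> \<tau> \<Longrightarrow> lattice_vec e \<bullet> u = 0 \<Longrightarrow> u \<in> \<gamma>"
    and x: "x \<in> aff_points \<tau>" "x e \<noteq> 0"
  obtains y where "y \<in> aff_points \<gamma>" "restr \<tau> y = x"
proof -
  have "\<forall>m\<in>cone_monoid \<gamma>. \<exists>N. \<forall>k\<ge>N. m + nsmul k e \<in> cone_monoid \<tau>"
    using localization[OF rp e(1) vanish] by blast
  then obtain N where N: "\<And>m k. m \<in> cone_monoid \<gamma> \<Longrightarrow> k \<ge> N m \<Longrightarrow> m + nsmul k e \<in> cone_monoid \<tau>"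
    by metis
  define y where "y m = (if m \<in> cone_monoid \<gamma> then x (m + nsmul (N m) e) / x e ^ N m else 0)" for m
  have y: "y m = x (m + nsmul k e) / x e ^ k" if "m \<in> cone_monoid \<gamma>" "m + nsmul k e \<in> cone_monoid \<tau>" for m k
  proof -
    have "(m + nsmul k e) + nsmul (N m) e = (m + nsmul (N m) e) + nsmul k e" by (simp add: ac_simps)
    from arg_cong[OF this, of x] have "x (m + nsmul k e) * x e ^ N m = x (m + nsmul (N m) e) * x e ^ k"
      using x(1) e that N[of m "N m"] by (simp add: aff_points_add cone_monoid_nsmul aff_points_nsmul)
    then show ?thesis using x(2) that by (simp add: y_def divide_simps mult.commute)
  qed
  have nsmul_add: "nsmul (j + k) e = nsmul j e + nsmul k e" for j k
    by (simp add: nsmul_def vec_eq_iff algebra_simps)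
  show thesis
  proof
    show "y \<in> aff_points \<gamma>"
      unfolding aff_points_def
    proof (intro CollectI conjI ballI allI impI)
      show "y 0 = 1" using y[of 0 0] x(1) by (simp add: aff_points_0)
    next
      fix a b assume ab: "a \<in> cone_monoid \<gamma>" "b \<in> cone_monoid \<gamma>"
      have "a + b + nsmul (N a + N b) e = (a + nsmul (N a) e) + (b + nsmul (N b) e)"
        by (simp add: nsmul_add ac_simps)
      with y[of "a + b" "N a + N b"] show "y (a + b) = y a * y b"
        using ab x(1) N[of a "N a"] N[of b "N b"]
        by (simp add: cone_monoid_add aff_points_add y power_add)
    qed (simp add: y_def)
    show "restr \<tau> y = x"
    proof
      fix m
      show "restr \<tau> y m = x m"
        using y[of m 0] cone_monoid_antimono[OF sub] x(1)
        by (cases "m \<in> cone_monoid \<tau>") (auto simp: restr_def aff_points_outside)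
    qed
  qed
qed

section \<open>Evaluation of Laurent polynomials\<close>

lemma feval_superset:
  "finite K \<Longrightarrow> keys f \<subseteq> K \<Longrightarrow>
    feval f x = (\<Sum>m\<in>K. of_real (lookup f m) * x m)"
  unfolding feval_def by (intro sum.mono_neutral_left) (auto simp: in_keys_iff)

lemma feval_single [simp]: "feval (Poly_Mapping.single k c) x = of_real c * x k"
  by (subst feval_superset[of "{k}"]) auto

lemma feval_one [simp]: "feval 1 x = x 0"
  using feval_single[of 0 1 x] by simp

lemma one_in_coord_ring: "1 \<in> coord_ring \<tau>"
  by (simp add: coord_ring_def)

lemma feval_0 [simp]: "feval 0 x = 0"
  by (simp add: feval_def)

lemma feval_add: "feval (f + g) x = feval f x + feval g x"
proof -
  let ?K = "keys f \<union> keys g"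
  have "feval (f + g) x = (\<Sum>m\<in>?K. of_real (lookup (f + g) m) * x m)"
    using keys_add[of f g] by (intro feval_superset) auto
  then show ?thesis
    by (simp add: lookup_add algebra_simps sum.distrib
        feval_superset[of ?K f] feval_superset[of ?K g])
qed

lemma feval_sum: "feval (sum f I) x = (\<Sum>i\<in>I. feval (f i) x)"
  by (induction I rule: infinite_finite_induct) (simp_all add: feval_add)

lemma feval_complexify: "feval f (complexify x) = of_real (feval f x)"
  by (simp add: feval_def complexify_def)

lemma feval_restr: "f \<in> coord_ring \<tau> \<Longrightarrow> feval f (restr \<tau> y) = feval f y"
  unfolding feval_def coord_ring_def by (intro sum.cong) (auto simp: restr_apply)

definition laurent :: "'a set \<Rightarrow> ('a \<Rightarrow> real) \<Rightarrow> ('a \<Rightarrow> int ^ 'n) \<Rightarrow> (int ^ 'n \<Rightarrow>\<^sub>0 real)" where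
  "laurent K c \<phi> = (\<Sum>k\<in>K. Poly_Mapping.single (\<phi> k) (c k))"

lemma feval_laurent: "feval (laurent K c \<phi>) x = (\<Sum>k\<in>K. of_real (c k) * x (\<phi> k))"
  by (simp add: laurent_def feval_sum)

lemma coord_ring_sum: "(\<And>i. i \<in> I \<Longrightarrow> f i \<in> coord_ring \<tau>) \<Longrightarrow> sum f I \<in> coord_ring \<tau>"
  using keys_sum[of f I] unfolding coord_ring_def by blast

lemma laurent_in_coord_ring: "(\<And>k. k \<in> K \<Longrightarrow> \<phi> k \<in> cone_monoid \<tau>) \<Longrightarrow> laurent K c \<phi> \<in> coord_ring \<tau>"
  unfolding laurent_def by (intro coord_ring_sum) (auto simp: coord_ring_def)

lemma coord_ring_mult:
  assumes "f \<in> coord_ring \<tau>" "g \<in> coord_ring \<tau>"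
  obtains h where "h \<in> coord_ring \<tau>" "\<And>x :: int ^ 'n \<Rightarrow> complex. x \<in> aff_points \<tau> \<Longrightarrow> feval h x = feval f x * feval g x"
proof
  let ?c = "\<lambda>(k, l). lookup f k * lookup g l"
  let ?h = "laurent (keys f \<times> keys g) ?c (\<lambda>(k, l). k + l)"
  show "?h \<in> coord_ring \<tau>"
    using assms by (intro laurent_in_coord_ring) (auto simp: coord_ring_def subset_iff intro!: cone_monoid_add)
  fix x :: "int ^ 'n \<Rightarrow> complex" assume x: "x \<in> aff_points \<tau>"
  have "feval f x * feval g x = (\<Sum>(k, l)\<in>keys f \<times> keys g.
      of_real (lookup f k) * x k * (of_real (lookup g l) * x l))"
    by (simp add: feval_def sum_product sum.cartesian_product)
  also have "\<dots> = feval ?h x"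
    unfolding feval_laurent
  proof (intro sum.cong refl)
    fix p assume "p \<in> keys f \<times> keys g"
    then have "fst p \<in> cone_monoid \<tau>" "snd p \<in> cone_monoid \<tau>"
      using assms by (auto simp: coord_ring_def)
    with x show "(case p of (k, l) \<Rightarrow> of_real (lookup f k) * x k * (of_real (lookup g l) * x l)) =
        of_real (?c p) * x (case p of (k, l) \<Rightarrow> k + l)"
      by (auto simp: aff_points_add split: prod.splits)
  qed
  finally show "feval ?h x = feval f x * feval g x" by simp
qed

lemma continuous_on_feval: "continuous_on A (feval f :: (int ^ 'n \<Rightarrow> complex) \<Rightarrow> complex)"
  unfolding feval_def
  by (intro continuous_intros continuous_on_subset[OF continuous_on_product_coordinates]) simp

section \<open>Zariski topologies\<close>

lemma openin_zariski_basic: "f \<in> A \<Longrightarrow> openin (zariski C A) {x \<in> C. f x \<noteq> 0}"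
  unfolding zariski_def by (intro topology_generated_by_Basis) auto

lemma topspace_zariski:
  assumes "f \<in> A" "\<And>x. x \<in> C \<Longrightarrow> f x \<noteq> 0"
  shows "topspace (zariski C A) = C"
  using assms by (auto simp: zariski_def)

text \<open>A generated topology has the given sets only as a subbasis; closure of \<open>A\<close>
  under products turns it into a basis.\<close>

lemma openin_zariski_elim:
  assumes "openin (zariski C A) W" "x \<in> W"
    and mult: "\<And>f g. f \<in> A \<Longrightarrow> g \<in> A \<Longrightarrow> \<exists>h\<in>A. \<forall>x\<in>C. h x = f x * g x"
  obtains f where "f \<in> A" "f x \<noteq> 0" "{y \<in> C. f y \<noteq> 0} \<subseteq> W"
proof -
  have "generate_topology_on ((\<lambda>f. {x \<in> C. f x \<noteq> 0}) ` A) W"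
    using assms(1) by (simp add: zariski_def openin_topology_generated_by_iff)
  then have "\<forall>x\<in>W. x \<in> C \<and> (\<exists>f\<in>A. f x \<noteq> 0 \<and> {y \<in> C. f y \<noteq> 0} \<subseteq> W)"
  proof induction
    case (Int a b)
    show ?case
    proof (intro ballI conjI)
      fix x assume "x \<in> a \<inter> b"
      then obtain f g where x: "x \<in> C" and fg: "f \<in> A" "g \<in> A" "f x \<noteq> 0" "g x \<noteq> 0"
          "{y \<in> C. f y \<noteq> 0} \<subseteq> a" "{y \<in> C. g y \<noteq> 0} \<subseteq> b"
        using Int.IH by blast
      obtain h where h: "h \<in> A" "\<And>x. x \<in> C \<Longrightarrow> h x = f x * g x"
        using mult[OF fg(1,2)] by blast
      show "x \<in> C" by fact
      show "\<exists>f\<in>A. f x \<noteq> 0 \<and> {y \<in> C. f y \<noteq> 0} \<subseteq> a \<inter> b"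
        using h fg x by (intro bexI[of _ h]) auto
    qed
  next
    case (UN K)
    then show ?case by (meson UnionE UnionI subset_iff)
  qed auto
  then show thesis using assms(2) that by blast
qed

lemma topspace_zariski_aff [simp]: "topspace (zariski_aff \<tau>) = aff_points \<tau>"
  unfolding zariski_aff_def
  by (rule topspace_zariski[of "feval 1"]) (auto simp: aff_points_0 one_in_coord_ring)

lemma openin_zariski_aff_basic:
  "f \<in> coord_ring \<tau> \<Longrightarrow> openin (zariski_aff \<tau>) {x \<in> aff_points \<tau>. feval f x \<noteq> 0}"
  unfolding zariski_aff_def by (rule openin_zariski_basic) auto

lemma openin_zariski_aff_elim:
  assumes "openin (zariski_aff \<tau>) W" "x \<in> W"
  obtains f where "f \<in> coord_ring \<tau>" "feval f x \<noteq> 0" "{y \<in> aff_points \<tau>. feval f y \<noteq> 0} \<subseteq> W"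
proof -
  have "\<exists>h\<in>feval ` coord_ring \<tau>. \<forall>x\<in>aff_points \<tau>. h x = f x * g x"
    if fg: "f \<in> feval ` coord_ring \<tau>" "g \<in> feval ` coord_ring \<tau>" for f g :: "(int ^ 'a \<Rightarrow> complex) \<Rightarrow> complex"
  proof -
    obtain f' g' where "f' \<in> coord_ring \<tau>" "g' \<in> coord_ring \<tau>" "f = feval f'" "g = feval g'"
      using fg by blast
    then show ?thesis using coord_ring_mult[of f' \<tau> g'] by (metis image_eqI)
  qed
  from openin_zariski_elim[OF assms(1)[unfolded zariski_aff_def] assms(2) this]
  show thesis using that by blast
qed

lemma exposes_iff: "exposes e \<gamma> \<tau> \<Longrightarrow> u \<in> \<gamma> \<longleftrightarrow> u \<in> \<tau> \<and> lattice_vec e \<bullet> u = 0"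
  by (auto simp: exposes_def)

lemma cone_monoid_nonneg: "m \<in> cone_monoid \<tau> \<Longrightarrow> u \<in> \<tau> \<Longrightarrow> 0 \<le> lattice_vec m \<bullet> u"
  by (simp add: cone_monoid_def)

lemma topspace_glued_topology: "topspace (glued_topology I T c) = (\<Union>i\<in>I. c i ` topspace (T i))"
proof -
  let ?X = "\<Union>i\<in>I. c i ` topspace (T i)"
  have "openin (glued_topology I T c) ?X"
    unfolding openin_glued_topology
  proof (intro conjI ballI)
    fix i assume "i \<in> I"
    then have "{x \<in> topspace (T i). c i x \<in> ?X} = topspace (T i)"
      by auto
    then show "openin (T i) {x \<in> topspace (T i). c i x \<in> ?X}"
      by (metis openin_topspace)
  qed simp
  then have "?X \<subseteq> topspace (glued_topology I T c)"
    by (rule openin_subset)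
  moreover have "topspace (glued_topology I T c) \<subseteq> ?X"
    using openin_topspace[of "glued_topology I T c"] unfolding openin_glued_topology by simp
  ultimately show ?thesis by blast
qed

section \<open>The toric variety of a fan\<close>

locale fan_variety =
  fixes \<Delta> :: "(real ^ 'n) set set"
  assumes fan: "fan \<Delta>"
begin

lemma cone_toric: "\<tau> \<in> \<Delta> \<Longrightarrow> toric_cone \<tau>"
  using fan by (simp add: fan_def)

lemma cone_rational: "\<tau> \<in> \<Delta> \<Longrightarrow> rational_polyhedral_cone \<tau>"
  using cone_toric by (simp add: toric_cone_def)

lemma face_in_fan: "\<tau> \<in> \<Delta> \<Longrightarrow> cone_face \<gamma> \<tau> \<Longrightarrow> \<gamma> \<in> \<Delta>"
  using fan by (simp add: fan_def)

lemma inter_face: "\<tau> \<in> \<Delta> \<Longrightarrow> \<tau>' \<in> \<Delta> \<Longrightarrow> cone_face (\<tau> \<inter> \<tau>') \<tau>"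
  using fan by (simp add: fan_def)

lemma zero_in_fan: "{0} \<in> \<Delta>"
proof -
  obtain \<tau> where "\<tau> \<in> \<Delta>" using fan by (auto simp: fan_def)
  then show ?thesis using zero_cone_face[OF cone_toric] face_in_fan by blast
qed

lemma zero_subset: "\<tau> \<in> \<Delta> \<Longrightarrow> {0} \<subseteq> \<tau>"
  using toric_cone_convex_cone[OF cone_toric] convex_cone_contains_0 by blast

lemma zero_inter: "\<tau> \<in> \<Delta> \<Longrightarrow> {0} \<inter> \<tau> = {0}" "\<tau> \<in> \<Delta> \<Longrightarrow> \<tau> \<inter> {0} = {0}"
  using zero_subset by auto

lemma inter_exposed:
  assumes "\<tau> \<in> \<Delta>" "\<tau>' \<in> \<Delta>"
  obtains e where "exposes e (\<tau> \<inter> \<tau>') \<tau>"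
  using face_exposed[OF cone_rational inter_face] assms by blast

lemma glue_rel_iff:
  "((\<tau>, x), (\<tau>', x')) \<in> glue_rel \<Delta> \<longleftrightarrow> \<tau> \<in> \<Delta> \<and> \<tau>' \<in> \<Delta> \<and>
     (\<exists>y\<in>aff_points (\<tau> \<inter> \<tau>'). x = restr \<tau> y \<and> x' = restr \<tau>' y)"
  by (simp add: glue_rel_def)

lemma glue_rel_refl: "\<tau> \<in> \<Delta> \<Longrightarrow> x \<in> aff_points \<tau> \<Longrightarrow> ((\<tau>, x), (\<tau>, x)) \<in> glue_rel \<Delta>"
  by (auto simp: glue_rel_iff restr_self intro!: bexI[of _ x])

lemma glue_rel_sym: "(p, q) \<in> glue_rel \<Delta> \<Longrightarrow> (q, p) \<in> glue_rel \<Delta>"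
  by (cases p; cases q) (auto simp: glue_rel_iff Int_commute)

text \<open>The two localizations of the middle chart are both defined on the triple intersection, where
  the sum of the two exposing functionals is invertible.\<close>

lemma glue_rel_trans:
  assumes "((\<tau>1, x1), (\<tau>2, x2)) \<in> glue_rel \<Delta>" "((\<tau>2, x2), (\<tau>3, x3)) \<in> glue_rel \<Delta>"
  shows "((\<tau>1, x1), (\<tau>3, x3)) \<in> glue_rel \<Delta>"
proof -
  have \<tau>: "\<tau>1 \<in> \<Delta>" "\<tau>2 \<in> \<Delta>" "\<tau>3 \<in> \<Delta>" using assms by (auto simp: glue_rel_iff)
  obtain y where y: "y \<in> aff_points (\<tau>2 \<inter> \<tau>1)" "x1 = restr \<tau>1 y" "x2 = restr \<tau>2 y"
    using assms(1) by (auto simp: glue_rel_iff Int_commute)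
  obtain z where z: "z \<in> aff_points (\<tau>2 \<inter> \<tau>3)" "x2 = restr \<tau>2 z" "x3 = restr \<tau>3 z"
    using assms(2) by (auto simp: glue_rel_iff)
  obtain d where d: "exposes d (\<tau>2 \<inter> \<tau>1) \<tau>2" using inter_exposed \<tau> by blast
  obtain e where e: "exposes e (\<tau>2 \<inter> \<tau>3) \<tau>2" using inter_exposed \<tau> by blast
  have x2: "x2 \<in> aff_points \<tau>2" using y(1) restr_in_aff_points[of "\<tau>2 \<inter> \<tau>1" \<tau>2 y] y(3) by simp
  have "x2 d \<noteq> 0"
    using localize_nonzero[OF y(1) exposes_face_mem[OF d]] exposes_mem[OF d] y(3) by (simp add: restr_apply)
  moreover have "x2 e \<noteq> 0"
    using localize_nonzero[OF z(1) exposes_face_mem[OF e]] exposes_mem[OF e] z(2) by (simp add: restr_apply)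
  ultimately have nz: "x2 (d + e) \<noteq> 0"
    using x2 exposes_mem[OF d] exposes_mem[OF e] by (simp add: aff_points_add)
  let ?\<gamma> = "\<tau>2 \<inter> \<tau>1 \<inter> \<tau>3"
  have mem: "d + e \<in> cone_monoid \<tau>2"
    using exposes_mem[OF d] exposes_mem[OF e] by (rule cone_monoid_add)
  have neg: "- (d + e) \<in> cone_monoid ?\<gamma>"
  proof -
    have "lattice_vec d \<bullet> u = 0" "lattice_vec e \<bullet> u = 0" if "u \<in> ?\<gamma>" for u
      using exposes_iff[OF d, of u] exposes_iff[OF e, of u] that by simp_all
    then show ?thesis
      by (simp add: cone_monoid_def lattice_vec_minus lattice_vec_diff inner_diff_left)
  qed
  have van: "u \<in> ?\<gamma>" if "u \<in> \<tau>2" "lattice_vec (d + e) \<bullet> u = 0" for u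
  proof -
    have "lattice_vec d \<bullet> u \<ge> 0" "lattice_vec e \<bullet> u \<ge> 0"
      using exposes_mem[OF d] exposes_mem[OF e] that(1) by (simp_all add: cone_monoid_nonneg)
    then have "lattice_vec d \<bullet> u = 0" "lattice_vec e \<bullet> u = 0"
      using that(2) by (auto simp: lattice_vec_add inner_add_left)
    then have "u \<in> \<tau>2 \<inter> \<tau>1" "u \<in> \<tau>2 \<inter> \<tau>3"
      using exposes_iff[OF d, of u] exposes_iff[OF e, of u] that(1) by simp_all
    then show ?thesis by blast
  qed
  obtain w where w: "w \<in> aff_points ?\<gamma>" "restr \<tau>2 w = x2"
    using localize_exists[OF cone_rational[OF \<tau>(2)] mem neg _ van x2 nz] by blast
  have "restr (\<tau>2 \<inter> \<tau>1) w = y"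
  proof (rule localize_unique[OF cone_rational[OF \<tau>(2)] d _ y(1)])
    show "restr (\<tau>2 \<inter> \<tau>1) w \<in> aff_points (\<tau>2 \<inter> \<tau>1)" using w by (intro restr_in_aff_points[of ?\<gamma>]) auto
    show "restr \<tau>2 (restr (\<tau>2 \<inter> \<tau>1) w) = restr \<tau>2 y" using w y by (simp add: restr_restr)
  qed
  then have 1: "x1 = restr \<tau>1 w" using y by (metis Int_lower2 restr_restr)
  have "restr (\<tau>2 \<inter> \<tau>3) w = z"
  proof (rule localize_unique[OF cone_rational[OF \<tau>(2)] e _ z(1)])
    show "restr (\<tau>2 \<inter> \<tau>3) w \<in> aff_points (\<tau>2 \<inter> \<tau>3)" using w by (intro restr_in_aff_points[of ?\<gamma>]) auto
    show "restr \<tau>2 (restr (\<tau>2 \<inter> \<tau>3) w) = restr \<tau>2 z" using w z by (simp add: restr_restr)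
  qed
  then have 3: "x3 = restr \<tau>3 w" using z by (metis Int_lower2 restr_restr)
  have "restr (\<tau>1 \<inter> \<tau>3) w \<in> aff_points (\<tau>1 \<inter> \<tau>3)" using w by (intro restr_in_aff_points[of ?\<gamma>]) auto
  then show ?thesis
    using \<tau> 1 3 by (auto simp: glue_rel_iff restr_restr intro!: bexI[of _ "restr (\<tau>1 \<inter> \<tau>3) w"])
qed

lemma chart_eq_iff:
  assumes "\<tau>' \<in> \<Delta>" "x' \<in> aff_points \<tau>'"
  shows "chart \<Delta> \<tau> x = chart \<Delta> \<tau>' x' \<longleftrightarrow> ((\<tau>, x), (\<tau>', x')) \<in> glue_rel \<Delta>"
proof
  assume "chart \<Delta> \<tau> x = chart \<Delta> \<tau>' x'"
  moreover have "(\<tau>', x') \<in> chart \<Delta> \<tau>' x'"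
    using glue_rel_refl[OF assms] by (simp add: chart_def)
  ultimately have "(\<tau>', x') \<in> chart \<Delta> \<tau> x" by simp
  then show "((\<tau>, x), (\<tau>', x')) \<in> glue_rel \<Delta>" by (simp add: chart_def)
next
  assume *: "((\<tau>, x), (\<tau>', x')) \<in> glue_rel \<Delta>"
  show "chart \<Delta> \<tau> x = chart \<Delta> \<tau>' x'"
  proof (rule set_eqI)
    fix p :: "(real ^ 'n) set \<times> (int ^ 'n \<Rightarrow> complex)"
    obtain \<tau>'' x'' where p: "p = (\<tau>'', x'')" by (cases p)
    show "p \<in> chart \<Delta> \<tau> x \<longleftrightarrow> p \<in> chart \<Delta> \<tau>' x'"
      unfolding chart_def Image_singleton_iff p
      using glue_rel_trans[OF *] glue_rel_trans[OF glue_rel_sym[OF *]] by blast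
  qed
qed

lemma chart_restr:
  assumes "\<gamma> \<in> \<Delta>" "\<tau> \<in> \<Delta>" "\<gamma> \<subseteq> \<tau>" "y \<in> aff_points \<gamma>"
  shows "chart \<Delta> \<tau> (restr \<tau> y) = chart \<Delta> \<gamma> y"
proof -
  have "\<tau> \<inter> \<gamma> = \<gamma>" using assms by auto
  then show ?thesis
    using assms by (subst chart_eq_iff) (auto simp: glue_rel_iff restr_self)
qed

lemma chart_torus: "\<tau> \<in> \<Delta> \<Longrightarrow> t \<in> torus \<Longrightarrow> chart \<Delta> \<tau> (restr \<tau> t) = chart \<Delta> {0} t"
  using chart_restr[OF zero_in_fan _ zero_subset] by blast

lemma chart_inj:
  assumes "\<tau> \<in> \<Delta>" "x \<in> aff_points \<tau>" "x' \<in> aff_points \<tau>" "chart \<Delta> \<tau> x = chart \<Delta> \<tau> x'"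
  shows "x = x'"
proof -
  have "((\<tau>, x), (\<tau>, x')) \<in> glue_rel \<Delta>" using assms chart_eq_iff by blast
  then show ?thesis unfolding glue_rel_iff by blast
qed

lemma chart_eq_torus:
  assumes "\<tau> \<in> \<Delta>" "x \<in> aff_points \<tau>" "t \<in> torus" "chart \<Delta> \<tau> x = chart \<Delta> {0} t"
  shows "x = restr \<tau> t"
  using assms chart_inj[of \<tau> x "restr \<tau> t"] restr_in_aff_points[OF zero_subset, of \<tau> t] chart_torus[of \<tau> t]
  by simp

section \<open>Openness of charts and of strict inequalities\<close>

lemma chart_preimage:
  assumes "\<tau> \<in> \<Delta>" "\<tau>' \<in> \<Delta>" "Q \<subseteq> aff_points \<tau>"
  shows "{x \<in> aff_points \<tau>'. chart \<Delta> \<tau>' x \<in> chart \<Delta> \<tau> ` Q}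
    = restr \<tau>' ` {y \<in> aff_points (\<tau>' \<inter> \<tau>). restr \<tau> y \<in> Q}"
proof -
  have "chart \<Delta> \<tau>' x \<in> chart \<Delta> \<tau> ` Q \<longleftrightarrow> (\<exists>y\<in>aff_points (\<tau>' \<inter> \<tau>). x = restr \<tau>' y \<and> restr \<tau> y \<in> Q)"
    for x
  proof -
    have "chart \<Delta> \<tau>' x \<in> chart \<Delta> \<tau> ` Q \<longleftrightarrow> (\<exists>q\<in>Q. ((\<tau>', x), (\<tau>, q)) \<in> glue_rel \<Delta>)"
      using assms chart_eq_iff[OF assms(1)] by blast
    then show ?thesis using assms by (auto simp: glue_rel_iff)
  qed
  then show ?thesis using restr_in_aff_points[of "\<tau>' \<inter> \<tau>" \<tau>'] by auto
qed

text \<open>Functions of one chart may have poles in another, of bounded order along the locus where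
  \<open>e\<close> vanishes. One power of \<open>e\<close> for the whole family \<open>F\<close>
  keeps comparisons between its members meaningful.\<close>

lemma clear_denominators:
  assumes "\<tau> \<in> \<Delta>" "\<tau>' \<in> \<Delta>" "exposes e (\<tau>' \<inter> \<tau>) \<tau>'" "finite F" "F \<subseteq> coord_ring \<tau>"
  obtains N T where "\<And>f. f \<in> F \<Longrightarrow> T f \<in> coord_ring \<tau>'"
    "\<And>f y. f \<in> F \<Longrightarrow> y \<in> aff_points (\<tau>' \<inter> \<tau>) \<Longrightarrow> feval (T f) (restr \<tau>' y) = y e ^ N * feval f (restr \<tau> y)"
proof -
  let ?\<gamma> = "\<tau>' \<inter> \<tau>"
  define K where "K = (\<Union>f\<in>F. keys f)"
  have K: "finite K" "K \<subseteq> cone_monoid \<tau>"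
    using assms by (auto simp: K_def coord_ring_def)
  then have K\<gamma>: "K \<subseteq> cone_monoid ?\<gamma>" using cone_monoid_antimono[of ?\<gamma> \<tau>] by auto
  have "\<forall>m\<in>K. \<exists>N. \<forall>k\<ge>N. m + nsmul k e \<in> cone_monoid \<tau>'"
    using exposes_localization[OF cone_rational[OF assms(2)] assms(3)] K\<gamma> by (metis subset_iff)
  then obtain M where M: "\<And>m k. m \<in> K \<Longrightarrow> k \<ge> M m \<Longrightarrow> m + nsmul k e \<in> cone_monoid \<tau>'"
    by metis
  define N where "N = (\<Sum>m\<in>K. M m)"
  have MN: "M m \<le> N" if "m \<in> K" for m
    using K that by (simp add: N_def member_le_sum)
  define T where "T f = laurent (keys f) (lookup f) (\<lambda>k. k + nsmul N e)" for f
  show thesis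
  proof
    fix f assume f: "f \<in> F"
    show Tf: "T f \<in> coord_ring \<tau>'"
      unfolding T_def using f M MN by (intro laurent_in_coord_ring) (auto simp: K_def)
    fix y :: "int ^ 'n \<Rightarrow> complex" assume y: "y \<in> aff_points ?\<gamma>"
    have "feval (T f) (restr \<tau>' y) = feval (T f) y" by (rule feval_restr[OF Tf])
    also have "\<dots> = (\<Sum>k\<in>keys f. of_real (lookup f k) * (y k * y e ^ N))"
      unfolding T_def feval_laurent
    proof (intro sum.cong refl)
      fix k assume "k \<in> keys f"
      then have "k \<in> cone_monoid ?\<gamma>" using K\<gamma> f by (auto simp: K_def)
      then show "of_real (lookup f k) * y (k + nsmul N e) =
          of_real (lookup f k) * (y k * y e ^ N)"
        using y exposes_face_mem(1)[OF assms(3)] by (simp add: aff_points_add aff_points_nsmul cone_monoid_nsmul)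
    qed
    also have "\<dots> = y e ^ N * feval f y"
      by (simp add: feval_def sum_distrib_left algebra_simps)
    also have "feval f y = feval f (restr \<tau> y)"
      using f assms(5) by (metis feval_restr subset_iff)
    finally show "feval (T f) (restr \<tau>' y) = y e ^ N * feval f (restr \<tau> y)" .
  qed
qed

lemma exposed_locus:
  assumes "\<tau>' \<in> \<Delta>" "exposes e \<gamma> \<tau>'"
  shows "restr \<tau>' ` aff_points \<gamma> = {x \<in> aff_points \<tau>'. x e \<noteq> 0}"
proof (intro equalityI subsetI)
  fix x assume "x \<in> restr \<tau>' ` aff_points \<gamma>"
  then obtain y where y: "y \<in> aff_points \<gamma>" "x = restr \<tau>' y" by blast
  then show "x \<in> {x \<in> aff_points \<tau>'. x e \<noteq> 0}"
    using localize_nonzero[OF y(1) exposes_face_mem[OF assms(2)]] exposes_subset[OF assms(2)]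
      exposes_mem[OF assms(2)] by (simp add: restr_in_aff_points restr_apply)
next
  fix x :: "int ^ 'n \<Rightarrow> complex" assume "x \<in> {x \<in> aff_points \<tau>'. x e \<noteq> 0}"
  then obtain y where "y \<in> aff_points \<gamma>" "restr \<tau>' y = x"
    using localize_exists[OF cone_rational[OF assms(1)] exposes_mem[OF assms(2)]
        exposes_face_mem(2)[OF assms(2)] exposes_subset[OF assms(2)], of x]
      exposes_iff[OF assms(2)] by auto
  then show "x \<in> restr \<tau>' ` aff_points \<gamma>" by blast
qed

lemma chart_preimage_condition:
  assumes "\<tau> \<in> \<Delta>" "\<tau>' \<in> \<Delta>" "exposes e (\<tau>' \<inter> \<tau>) \<tau>'"
    and P': "\<And>y. y \<in> aff_points (\<tau>' \<inter> \<tau>) \<Longrightarrow> P' (restr \<tau>' y) \<longleftrightarrow> P (restr \<tau> y)"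
  shows "{x \<in> aff_points \<tau>'. chart \<Delta> \<tau>' x \<in> chart \<Delta> \<tau> ` {x \<in> aff_points \<tau>. P x}}
    = {x \<in> aff_points \<tau>'. x e \<noteq> 0} \<inter> {x \<in> aff_points \<tau>'. P' x}"
proof -
  have "{x \<in> aff_points \<tau>'. chart \<Delta> \<tau>' x \<in> chart \<Delta> \<tau> ` {x \<in> aff_points \<tau>. P x}}
    = restr \<tau>' ` {y \<in> aff_points (\<tau>' \<inter> \<tau>). P (restr \<tau> y)}"
    using restr_in_aff_points[of "\<tau>' \<inter> \<tau>" \<tau>] by (subst chart_preimage[OF assms(1,2)]) auto
  also have "\<dots> = {x \<in> restr \<tau>' ` aff_points (\<tau>' \<inter> \<tau>). P' x}" using P' by auto
  finally show ?thesis using exposed_locus[OF assms(2,3)] by auto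
qed

lemma topspace_zariski_toric: "topspace (zariski_toric \<Delta>) = (\<Union>\<tau>\<in>\<Delta>. chart \<Delta> \<tau> ` aff_points \<tau>)"
  by (simp add: zariski_toric_def topspace_glued_topology)

lemma topspace_euclidean_toric: "topspace (euclidean_toric \<Delta>) = (\<Union>\<tau>\<in>\<Delta>. chart \<Delta> \<tau> ` aff_points \<tau>)"
  by (simp add: euclidean_toric_def topspace_glued_topology)

lemma chart_in_topspace: "\<tau> \<in> \<Delta> \<Longrightarrow> x \<in> aff_points \<tau> \<Longrightarrow> chart \<Delta> \<tau> x \<in> topspace (zariski_toric \<Delta>)"
  unfolding topspace_zariski_toric by blast

lemma openin_zariski_toric_preimage:
  "openin (zariski_toric \<Delta>) W \<Longrightarrow> \<tau> \<in> \<Delta> \<Longrightarrow> openin (zariski_aff \<tau>) {x \<in> aff_points \<tau>. chart \<Delta> \<tau> x \<in> W}"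
  unfolding zariski_toric_def openin_glued_topology by simp

lemma openin_euclidean_toric_preimage:
  "openin (euclidean_toric \<Delta>) W \<Longrightarrow> \<tau> \<in> \<Delta> \<Longrightarrow>
    openin (top_of_set (aff_points \<tau>)) {x \<in> aff_points \<tau>. chart \<Delta> \<tau> x \<in> W}"
  unfolding euclidean_toric_def openin_glued_topology by simp

lemma openin_zariski_toric_chart:
  assumes "\<tau> \<in> \<Delta>" "f \<in> coord_ring \<tau>"
  shows "openin (zariski_toric \<Delta>) (chart \<Delta> \<tau> ` {x \<in> aff_points \<tau>. feval f x \<noteq> 0})"
  unfolding zariski_toric_def openin_glued_topology topspace_zariski_aff
proof (intro conjI ballI)
  show "chart \<Delta> \<tau> ` {x \<in> aff_points \<tau>. feval f x \<noteq> 0} \<subseteq> (\<Union>i\<in>\<Delta>. chart \<Delta> i ` aff_points i)"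
    using assms by blast
  fix \<tau>' assume \<tau>': "\<tau>' \<in> \<Delta>"
  obtain e where e: "exposes e (\<tau>' \<inter> \<tau>) \<tau>'" using inter_exposed[OF \<tau>' assms(1)] .
  obtain N T where "\<And>h. h \<in> {f} \<Longrightarrow> T h \<in> coord_ring \<tau>'"
    "\<And>h y. h \<in> {f} \<Longrightarrow> y \<in> aff_points (\<tau>' \<inter> \<tau>) \<Longrightarrow> feval (T h) (restr \<tau>' y) = y e ^ N * feval h (restr \<tau> y)"
    by (rule clear_denominators[OF assms(1) \<tau>' e, of "{f}"]) (use assms in auto)
  then have T: "T f \<in> coord_ring \<tau>'"
    "\<And>y. y \<in> aff_points (\<tau>' \<inter> \<tau>) \<Longrightarrow> feval (T f) (restr \<tau>' y) = y e ^ N * feval f (restr \<tau> y)"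
    by simp_all
  have 1: "{x \<in> aff_points \<tau>'. chart \<Delta> \<tau>' x \<in> chart \<Delta> \<tau> ` {x \<in> aff_points \<tau>. feval f x \<noteq> 0}}
    = {x \<in> aff_points \<tau>'. x e \<noteq> 0} \<inter> {x \<in> aff_points \<tau>'. feval (T f) x \<noteq> 0}"
    using T(2) localize_nonzero[OF _ exposes_face_mem[OF e]]
    by (intro chart_preimage_condition[OF assms(1) \<tau>' e]) auto
  have "{x \<in> aff_points \<tau>'. x e \<noteq> 0} = {x \<in> aff_points \<tau>'. feval (Poly_Mapping.single e 1) x \<noteq> 0}"
    by simp
  then have "openin (zariski_aff \<tau>') {x \<in> aff_points \<tau>'. x e \<noteq> 0}"
    using openin_zariski_aff_basic[of "Poly_Mapping.single e 1" \<tau>'] exposes_mem[OF e]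
    by (simp add: coord_ring_def)
  then show "openin (zariski_aff \<tau>') {x \<in> aff_points \<tau>'. chart \<Delta> \<tau>' x \<in> chart \<Delta> \<tau> ` {x \<in> aff_points \<tau>. feval f x \<noteq> 0}}"
    unfolding 1 using openin_zariski_aff_basic[OF T(1)] by (rule openin_Int)
qed

text \<open>The strict inequality is homogeneous, so it survives the multiplication of both sides by
  the power of \<open>e\<close> that clears denominators and can be tested in every chart.\<close>

lemma openin_euclidean_toric_chart:
  assumes "\<tau> \<in> \<Delta>" "f \<in> coord_ring \<tau>" "g \<in> coord_ring \<tau>"
  shows "openin (euclidean_toric \<Delta>) (chart \<Delta> \<tau> ` {x \<in> aff_points \<tau>. norm (feval f x) < norm (feval g x)})"
    (is "openin _ (chart \<Delta> \<tau> ` ?Q)")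
  unfolding euclidean_toric_def openin_glued_topology topspace_euclidean_subtopology
proof (intro conjI ballI)
  show "chart \<Delta> \<tau> ` ?Q \<subseteq> (\<Union>i\<in>\<Delta>. chart \<Delta> i ` aff_points i)"
    using assms by blast
  fix \<tau>' assume \<tau>': "\<tau>' \<in> \<Delta>"
  obtain e where e: "exposes e (\<tau>' \<inter> \<tau>) \<tau>'" using inter_exposed[OF \<tau>' assms(1)] .
  obtain N T where "\<And>h. h \<in> {f, g} \<Longrightarrow> T h \<in> coord_ring \<tau>'"
    and T: "\<And>h y. h \<in> {f, g} \<Longrightarrow> y \<in> aff_points (\<tau>' \<inter> \<tau>) \<Longrightarrow> feval (T h) (restr \<tau>' y) = y e ^ N * feval h (restr \<tau> y)"
    by (rule clear_denominators[OF assms(1) \<tau>' e, of "{f, g}"]) (use assms in auto)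
  have 1: "{x \<in> aff_points \<tau>'. chart \<Delta> \<tau>' x \<in> chart \<Delta> \<tau> ` ?Q}
    = {x \<in> aff_points \<tau>'. x e \<noteq> 0} \<inter> {x \<in> aff_points \<tau>'. norm (feval (T f) x) < norm (feval (T g) x)}"
  proof (rule chart_preimage_condition[OF assms(1) \<tau>' e])
    fix y :: "int ^ 'n \<Rightarrow> complex" assume y: "y \<in> aff_points (\<tau>' \<inter> \<tau>)"
    then have "0 < norm (y e ^ N)"
      using localize_nonzero[OF y exposes_face_mem[OF e]] by simp
    then show "norm (feval (T f) (restr \<tau>' y)) < norm (feval (T g) (restr \<tau>' y)) \<longleftrightarrow>
        norm (feval f (restr \<tau> y)) < norm (feval g (restr \<tau> y))"
      using T[of f y] T[of g y] y by (simp add: norm_mult del: norm_power)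
  qed
  also have "\<dots> = aff_points \<tau>' \<inter> ({x. x e \<noteq> 0} \<inter> {x. norm (feval (T f) x) < norm (feval (T g) x)})"
    by auto
  finally have 1: "{x \<in> aff_points \<tau>'. chart \<Delta> \<tau>' x \<in> chart \<Delta> \<tau> ` ?Q} = \<dots>" .
  have "open ({x::int ^ 'n \<Rightarrow> complex. x e \<noteq> 0} \<inter> {x. norm (feval (T f) x) < norm (feval (T g) x)})"
    by (intro open_Int open_Collect_neq open_Collect_less continuous_on_norm continuous_on_feval
        continuous_on_product_coordinates continuous_on_const)
  then show "openin (top_of_set (aff_points \<tau>')) {x \<in> aff_points \<tau>'. chart \<Delta> \<tau>' x \<in> chart \<Delta> \<tau> ` ?Q}"
    unfolding 1 by (rule openin_open_Int)
qed

end

section \<open>Torus points\<close>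

lemma complexify_apply: "complexify x m = of_real (x m)"
  by (simp add: complexify_def)

text \<open>With this sign, characters positive on \<open>u\<close> tend to 0 along
  \<open>exp_torus (real j *\<^sub>R u)\<close> as \<open>j\<close> grows, so for \<open>u\<close>
  in a cone the sequence converges in the chart of that cone.\<close>

definition exp_torus :: "real ^ 'n \<Rightarrow> int ^ 'n \<Rightarrow> real" where
  "exp_torus u m = exp (- (lattice_vec m \<bullet> u))"

lemma exp_torus_in_torus: "exp_torus u \<in> torus"
  by (simp add: torus_iff exp_torus_def lattice_vec_add inner_add_left flip: exp_add)

text \<open>Finitely many hyperplanes do not cover the space: moving \<open>v\<close> along
  \<open>a\<close> hits each of them for at most one parameter.\<close>

lemma generic_direction:
  fixes A :: "(real ^ 'n) set"
  assumes "finite A" "0 \<notin> A"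
  obtains v where "\<And>a. a \<in> A \<Longrightarrow> a \<bullet> v \<noteq> 0"
proof -
  have "\<exists>v. \<forall>a\<in>A. a \<bullet> v \<noteq> 0"
    using assms
  proof (induction A rule: finite_induct)
    case (insert a A)
    then obtain v where v: "\<forall>b\<in>A. b \<bullet> v \<noteq> 0" by auto
    have a: "a \<bullet> a \<noteq> 0" using insert.prems by auto
    \<comment> \<open>The bad parameters. If \<open>b \<bullet> a = 0\<close>, the quotient is 0 by
      convention, and excluding 0 does no harm.\<close>
    define X where "X = insert (- (a \<bullet> v) / (a \<bullet> a)) ((\<lambda>b. - (b \<bullet> v) / (b \<bullet> a)) ` A)"
    have "finite X" using insert.hyps by (simp add: X_def)
    then obtain r :: real where r: "r \<notin> X" using ex_new_if_finite infinite_UNIV_char_0 by blast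
    have "b \<bullet> (v + r *\<^sub>R a) \<noteq> 0" if b: "b \<in> insert a A" for b
    proof
      assume *: "b \<bullet> (v + r *\<^sub>R a) = 0"
      have ne: "b \<bullet> a \<noteq> 0" using * a v b by (auto simp: inner_add_right)
      have "b \<bullet> v + r * (b \<bullet> a) = 0" using * by (simp add: inner_add_right)
      then have "r = - (b \<bullet> v) / (b \<bullet> a)" using ne by (simp add: field_simps)
      then show False using r b by (auto simp: X_def)
    qed
    then show ?case by blast
  qed simp
  then show thesis using that by blast
qed

text \<open>In a direction that separates the exponents, the one with the least inner product
  dominates; after division by its exponential every other term tends to 0.\<close>

lemma eventually_exp_torus_nonvanishing:
  fixes c :: "int ^ 'n \<Rightarrow> real"
  assumes K: "finite K" "k1 \<in> K" "c k1 \<noteq> 0"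
    and v: "\<And>k k'. k \<in> K \<Longrightarrow> k' \<in> K \<Longrightarrow> k \<noteq> k' \<Longrightarrow> lattice_vec (k - k') \<bullet> v \<noteq> 0"
  shows "eventually (\<lambda>j. (\<Sum>k\<in>K. c k * exp_torus (real j *\<^sub>R v) k) \<noteq> 0) sequentially"
proof -
  let ?K = "{k \<in> K. c k \<noteq> 0}"
  let ?p = "\<lambda>k. lattice_vec k \<bullet> v"
  have fin: "finite ?K" "?K \<noteq> {}" using K by auto
  define k0 where "k0 = arg_min_on ?p ?K"
  have k0: "k0 \<in> ?K" and min: "\<And>k. k \<in> ?K \<Longrightarrow> ?p k0 \<le> ?p k"
    using arg_min_if_finite[OF fin, of ?p] by (auto simp: k0_def not_less)
  have "(\<lambda>j. \<Sum>k\<in>?K. c k * exp (- (?p k - ?p k0)) ^ j) \<longlonglongrightarrow> (\<Sum>k\<in>?K. if k = k0 then c k else 0)"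
  proof (rule tendsto_sum)
    fix k assume k: "k \<in> ?K"
    show "(\<lambda>j. c k * exp (- (?p k - ?p k0)) ^ j) \<longlonglongrightarrow> (if k = k0 then c k else 0)"
    proof (cases "k = k0")
      case False
      then have "?p k - ?p k0 \<noteq> 0" using v[of k k0] k k0 by (simp add: lattice_vec_diff inner_diff_left)
      then have "?p k - ?p k0 > 0" using min[OF k] by simp
      then have "(\<lambda>j. exp (- (?p k - ?p k0)) ^ j) \<longlonglongrightarrow> 0" by (intro LIMSEQ_realpow_zero) auto
      from tendsto_mult[OF tendsto_const[of "c k"] this] show ?thesis using False by simp
    qed simp
  qed
  moreover have "(\<Sum>k\<in>?K. if k = k0 then c k else 0) = c k0" using k0 fin by (simp add: sum.delta)
  ultimately have "eventually (\<lambda>j. (\<Sum>k\<in>?K. c k * exp (- (?p k - ?p k0)) ^ j) \<noteq> 0) sequentially"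
    using k0 by (intro tendsto_imp_eventually_ne) auto
  then show ?thesis
  proof eventually_elim
    case (elim j)
    have "(\<Sum>k\<in>K. c k * exp_torus (real j *\<^sub>R v) k) = (\<Sum>k\<in>?K. c k * exp_torus (real j *\<^sub>R v) k)"
      using K(1) by (intro sum.mono_neutral_right) auto
    also have "\<dots> = (\<Sum>k\<in>?K. exp (- (real j * ?p k0)) * (c k * exp (- (?p k - ?p k0)) ^ j))"
      by (intro sum.cong refl)
        (simp add: exp_torus_def algebra_simps exp_of_nat_mult[symmetric] flip: exp_add)
    also have "\<dots> = exp (- (real j * ?p k0)) * (\<Sum>k\<in>?K. c k * exp (- (?p k - ?p k0)) ^ j)"
      by (simp add: sum_distrib_left)
    finally show ?case using elim by simp
  qed
qed

text \<open>Two Laurent polynomials are nonzero far out in a direction that separates all their exponents.\<close>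

lemma torus_nonvanishing_pair:
  fixes c d :: "int ^ 'n \<Rightarrow> real"
  assumes "finite K" "k \<in> K" "c k \<noteq> 0" "finite L" "l \<in> L" "d l \<noteq> 0"
  obtains t where "t \<in> torus" "(\<Sum>k\<in>K. c k * t k) \<noteq> 0" "(\<Sum>k\<in>L. d k * t k) \<noteq> 0"
proof -
  let ?I = "(K \<union> L) \<times> (K \<union> L) - Id"
  define A where "A = (\<lambda>p. lattice_vec (fst p - snd p)) ` ?I"
  have "finite ?I" using assms(1,4) by (intro finite_Diff finite_cartesian_product) simp_all
  then have "finite A" unfolding A_def by (rule finite_imageI)
  moreover have "0 \<notin> A"
  proof
    assume "0 \<in> A"
    then obtain p where "0 = lattice_vec (fst p - snd p)" "p \<in> ?I" unfolding A_def by (rule imageE)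
    then show False using lattice_vec_eq_iff[of "fst p - snd p" 0] by (cases p) simp
  qed
  ultimately obtain v where v: "\<And>a. a \<in> A \<Longrightarrow> a \<bullet> v \<noteq> 0" using generic_direction by blast
  have v': "lattice_vec (k - k') \<bullet> v \<noteq> 0" if "k \<in> K \<union> L" "k' \<in> K \<union> L" "k \<noteq> k'" for k k'
  proof (rule v)
    have "(k, k') \<in> ?I" using that by simp
    then show "lattice_vec (k - k') \<in> A" unfolding A_def by (rule rev_image_eqI) simp
  qed
  have "eventually (\<lambda>j. (\<Sum>k\<in>K. c k * exp_torus (real j *\<^sub>R v) k) \<noteq> 0) sequentially"
    "eventually (\<lambda>j. (\<Sum>k\<in>L. d k * exp_torus (real j *\<^sub>R v) k) \<noteq> 0) sequentially"
    using eventually_exp_torus_nonvanishing[of K k c v]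
      eventually_exp_torus_nonvanishing[of L l d v] assms v' by simp_all
  then have "eventually (\<lambda>j. (\<Sum>k\<in>K. c k * exp_torus (real j *\<^sub>R v) k) \<noteq> 0 \<and>
      (\<Sum>k\<in>L. d k * exp_torus (real j *\<^sub>R v) k) \<noteq> 0) sequentially"
    by (rule eventually_conj)
  then obtain j where "(\<Sum>k\<in>K. c k * exp_torus (real j *\<^sub>R v) k) \<noteq> 0"
      "(\<Sum>k\<in>L. d k * exp_torus (real j *\<^sub>R v) k) \<noteq> 0"
    using eventually_happens'[OF sequentially_bot] by blast
  then show thesis using that[OF exp_torus_in_torus] by blast
qed

lemma torus_nonvanishing:
  fixes c :: "int ^ 'n \<Rightarrow> real"
  assumes "finite K" "k \<in> K" "c k \<noteq> 0"
  obtains t where "t \<in> torus" "(\<Sum>k\<in>K. c k * t k) \<noteq> 0"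
  using torus_nonvanishing_pair[of K k c K k c] assms by blast

lemma real_torus_nonvanishing:
  assumes "feval b x \<noteq> (0 :: complex)"
  obtains t :: "int ^ 'n \<Rightarrow> real" where "t \<in> torus" "feval b t \<noteq> 0"
proof -
  have "keys b \<noteq> {}" using assms unfolding feval_def by (metis sum.empty)
  then obtain k where "k \<in> keys b" by blast
  then show thesis
    using torus_nonvanishing[of "keys b" k "lookup b"] that
    by (auto simp: feval_def in_keys_iff)
qed

text \<open>A nonzero Laurent polynomial does not vanish identically on the real torus, so the real
  torus is Zariski dense in every chart.\<close>

lemma torus_meets_open:
  assumes "{0} \<subseteq> \<tau>" "openin (zariski_aff \<tau>) W" "x \<in> W"
  obtains t where "t \<in> torus" "restr \<tau> (complexify t) \<in> W"
proof -
  obtain f where f: "f \<in> coord_ring \<tau>" "feval f x \<noteq> 0" "{y \<in> aff_points \<tau>. feval f y \<noteq> 0} \<subseteq> W"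
    using openin_zariski_aff_elim[OF assms(2,3)] .
  obtain t :: "int ^ 'a \<Rightarrow> real" where t: "t \<in> torus" "feval f t \<noteq> 0"
    using real_torus_nonvanishing[OF f(2)] by blast
  have "restr \<tau> (complexify t) \<in> aff_points \<tau>"
    by (rule restr_in_aff_points[OF assms(1) torus_complexify[OF t(1)]])
  moreover have "feval f (restr \<tau> (complexify t)) \<noteq> 0"
    using t f(1) by (simp add: feval_restr feval_complexify)
  ultimately show thesis using that[OF t(1)] f(3) by blast
qed

section \<open>Equivariant open immersions\<close>

text \<open>The action on glued points runs over all representatives, so it can be computed once the
  class of a torus point is known in full: it has one representative in each chart.\<close>

lemma (in fan_variety) chart_zero_eq:
  assumes "t \<in> torus"
  shows "chart \<Delta> {0} t = (\<lambda>\<tau>. (\<tau>, restr \<tau> t)) ` \<Delta>"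
proof (rule set_eqI)
  fix p :: "(real ^ 'n) set \<times> (int ^ 'n \<Rightarrow> complex)"
  obtain \<tau> x where p: "p = (\<tau>, x)" by (cases p)
  have "p \<in> chart \<Delta> {0} t \<longleftrightarrow> \<tau> \<in> \<Delta> \<and> (\<exists>y\<in>aff_points ({0} \<inter> \<tau>). t = restr {0} y \<and> x = restr \<tau> y)"
    using zero_in_fan by (simp add: chart_def glue_rel_iff p)
  also have "\<dots> \<longleftrightarrow> \<tau> \<in> \<Delta> \<and> (\<exists>y\<in>torus. t = restr {0} y \<and> x = restr \<tau> y)"
    using zero_inter by (metis (no_types, lifting))
  also have "\<dots> \<longleftrightarrow> \<tau> \<in> \<Delta> \<and> x = restr \<tau> t"
    using assms by (metis restr_self)
  finally show "p \<in> chart \<Delta> {0} t \<longleftrightarrow> p \<in> (\<lambda>\<tau>. (\<tau>, restr \<tau> t)) ` \<Delta>"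
    by (auto simp: p)
qed

lemma torus_act_restr: "torus_act s (restr \<tau> t) = restr \<tau> (\<lambda>m. s m * t m)"
  by (auto simp: torus_act_def restr_def)

lemma (in fan_variety) torus_act_chart:
  assumes "s \<in> torus" "t \<in> torus"
  shows "torus_act_toric s (chart \<Delta> {0} t) = chart \<Delta> {0} (\<lambda>m. s m * t m)"
  using assms by (simp add: torus_act_toric_def chart_zero_eq torus_mult image_image torus_act_restr)

locale toric_embedding = fan_variety \<Delta> for \<Delta> :: "(real ^ 'n) set set" +
  fixes \<sigma> :: "(real ^ 'n) set" and \<iota> :: "(int ^ 'n \<Rightarrow> complex) \<Rightarrow> 'n toric_point"
  assumes \<sigma>: "toric_cone \<sigma>"
    and immersion: "open_immersion \<sigma> \<Delta> \<iota>"
    and equivariant: "\<And>t x. t \<in> torus \<Longrightarrow> x \<in> aff_points \<sigma> \<Longrightarrow> \<iota> (torus_act t x) = torus_act_toric t (\<iota> x)"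
begin

lemma \<sigma>_rational: "rational_polyhedral_cone \<sigma>"
  using \<sigma> by (simp add: toric_cone_def)

lemma zero_subset_\<sigma>: "{0} \<subseteq> \<sigma>"
  using toric_cone_convex_cone[OF \<sigma>] convex_cone_contains_0 by blast

lemma restr_\<sigma>: "t \<in> torus \<Longrightarrow> restr \<sigma> t \<in> aff_points \<sigma>"
  by (rule restr_in_aff_points[OF zero_subset_\<sigma>])

lemma \<iota>_inj: "inj_on \<iota> (aff_points \<sigma>)"
  using immersion unfolding open_immersion_def embedding_map_def homeomorphic_map_def by simp

lemma \<iota>_open: "openin (zariski_toric \<Delta>) (\<iota> ` aff_points \<sigma>)"
  using immersion unfolding open_immersion_def by blast

lemma \<iota>_continuous: "continuous_map (zariski_aff \<sigma>) (zariski_toric \<Delta>) \<iota>"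
proof -
  have "homeomorphic_map (zariski_aff \<sigma>) (subtopology (zariski_toric \<Delta>) (\<iota> ` aff_points \<sigma>)) \<iota>"
    using immersion unfolding open_immersion_def embedding_map_def by simp
  then show ?thesis using homeomorphic_imp_continuous_map continuous_map_in_subtopology by metis
qed

text \<open>Both tori are open and dense, so some torus point of \<open>V\<close> goes to a torus
  point of \<open>X\<close>; its inverse moves this back to the unit by equivariance.\<close>

lemma \<iota>_one_in_torus: "\<exists>t0\<in>torus. \<iota> (restr \<sigma> (\<lambda>m. 1)) = chart \<Delta> {0} t0"
proof -
  let ?T = "chart \<Delta> {0} ` torus"
  have T: "openin (zariski_toric \<Delta>) ?T"
    using openin_zariski_toric_chart[OF zero_in_fan one_in_coord_ring[of "{0}"]]
    by (simp add: aff_points_0 cong: conj_cong)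
  have 1: "restr \<sigma> (\<lambda>m. 1) \<in> aff_points \<sigma>" by (rule restr_\<sigma>[OF torus_one])
  then have "\<iota> (restr \<sigma> (\<lambda>m. 1)) \<in> topspace (zariski_toric \<Delta>)"
    using openin_subset[OF \<iota>_open] by blast
  then obtain \<tau> x where \<tau>: "\<tau> \<in> \<Delta>" "x \<in> aff_points \<tau>" "\<iota> (restr \<sigma> (\<lambda>m. 1)) = chart \<Delta> \<tau> x"
    unfolding topspace_zariski_toric by blast
  let ?W = "{x \<in> aff_points \<tau>. chart \<Delta> \<tau> x \<in> \<iota> ` aff_points \<sigma>}"
  have "x \<in> ?W" using \<tau> 1 by (metis (mono_tags, lifting) imageI mem_Collect_eq)
  \<comment> \<open>The image of \<open>V\<close> is open and so contains a torus point of
    \<open>X\<close>. Hence the preimage of the torus of \<open>X\<close> is a nonempty open subset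
    of \<open>V\<close>.\<close>
  then obtain t where t: "t \<in> torus" "restr \<tau> (complexify t) \<in> ?W"
    using torus_meets_open[OF zero_subset openin_zariski_toric_preimage[OF \<iota>_open]] \<tau>(1) by blast
  then have "chart \<Delta> {0} (complexify t) \<in> \<iota> ` aff_points \<sigma>"
    using chart_torus[OF \<tau>(1) torus_complexify[OF t(1)]] by simp
  then obtain z where z: "z \<in> aff_points \<sigma>" "\<iota> z \<in> ?T"
    using torus_complexify[OF t(1)] by auto
  let ?Y = "{z \<in> topspace (zariski_aff \<sigma>). \<iota> z \<in> ?T}"
  have "openin (zariski_aff \<sigma>) ?Y"
    by (rule openin_continuous_map_preimage[OF \<iota>_continuous T])
  moreover have "z \<in> ?Y" using z by simp
  ultimately obtain s where s: "s \<in> torus" "restr \<sigma> (complexify s) \<in> ?Y"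
    using torus_meets_open[OF zero_subset_\<sigma>] by blast
  define s' where "s' = complexify s"
  have s': "s' \<in> torus" unfolding s'_def by (rule torus_complexify[OF s(1)])
  obtain t1 where t1: "t1 \<in> torus" "\<iota> (restr \<sigma> s') = chart \<Delta> {0} t1"
    using s(2) unfolding s'_def by blast
  have "restr \<sigma> (\<lambda>m. 1) = torus_act (\<lambda>m. inverse (s' m)) (restr \<sigma> s')"
    using torus_nonzero[OF s'] by (simp add: torus_act_restr)
  then have "\<iota> (restr \<sigma> (\<lambda>m. 1)) = chart \<Delta> {0} (\<lambda>m. inverse (s' m) * t1 m)"
    using equivariant[OF torus_inverse[OF s'] restr_\<sigma>[OF s']] torus_act_chart[OF torus_inverse[OF s'] t1(1)]
      t1(2) by simp
  then show ?thesis using torus_mult[OF torus_inverse[OF s'] t1(1)] by blast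
qed

text \<open>The embedding is equivariant, so on the torus it is the translation by the image of the unit.\<close>

definition shift :: "int ^ 'n \<Rightarrow> complex" where
  "shift = (SOME t0. t0 \<in> torus \<and> \<iota> (restr \<sigma> (\<lambda>m. 1)) = chart \<Delta> {0} t0)"

lemma shift: "shift \<in> torus" "\<iota> (restr \<sigma> (\<lambda>m. 1)) = chart \<Delta> {0} shift"
  using someI_ex[of "\<lambda>t0. t0 \<in> torus \<and> \<iota> (restr \<sigma> (\<lambda>m. 1)) = chart \<Delta> {0} t0"] \<iota>_one_in_torus
  unfolding shift_def by blast+

lemma \<iota>_torus:
  assumes t: "t \<in> torus"
  shows "\<iota> (restr \<sigma> t) = chart \<Delta> {0} (\<lambda>m. t m * shift m)"
proof -
  have "restr \<sigma> t = torus_act t (restr \<sigma> (\<lambda>m. 1))" by (simp add: torus_act_restr)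
  then show ?thesis
    using equivariant[OF t restr_\<sigma>[OF torus_one]] torus_act_chart[OF t shift(1)] shift(2) by simp
qed

lemma chart_zero_\<iota>:
  assumes t: "t \<in> torus"
  shows "chart \<Delta> {0} t = \<iota> (restr \<sigma> (\<lambda>m. t m / shift m))"
  using \<iota>_torus[OF torus_divide[OF t shift(1)]] torus_nonzero[OF shift(1)] by simp

lemma chart_zero_in_image: "t \<in> torus \<Longrightarrow> chart \<Delta> {0} t \<in> \<iota> ` aff_points \<sigma>"
  using chart_zero_\<iota> restr_\<sigma>[OF torus_divide[OF _ shift(1)]] by blast

text \<open>A character of \<open>V\<close> is a regular function on the image of \<open>V\<close>, hence locally a quotient in each chart.\<close>

lemma character_quotient:
  assumes \<tau>: "\<tau> \<in> \<Delta>" "x \<in> aff_points \<tau>" "chart \<Delta> \<tau> x \<in> \<iota> ` aff_points \<sigma>" and m: "m \<in> cone_monoid \<sigma>"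
  obtains a b where "a \<in> coord_ring \<tau>" "b \<in> coord_ring \<tau>" "feval b x \<noteq> 0"
    "\<And>t. t \<in> torus \<Longrightarrow> feval b t \<noteq> 0 \<Longrightarrow> t m / shift m = feval a t / feval b t"
proof -
  define g where "g p = inv_into (aff_points \<sigma>) \<iota> p m" for p
  have g\<iota>: "g (\<iota> z) = z m" if "z \<in> aff_points \<sigma>" for z
    using that \<iota>_inj by (simp add: g_def)
  have "regular_aff \<sigma> (aff_points \<sigma>) (g \<circ> \<iota>)"
    unfolding regular_aff_def
  proof (intro conjI ballI)
    show "openin (zariski_aff \<sigma>) (aff_points \<sigma>)"
      using openin_topspace[of "zariski_aff \<sigma>"] by simp
    fix z :: "int ^ 'n \<Rightarrow> complex" assume "z \<in> aff_points \<sigma>"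
    then show "\<exists>a\<in>coord_ring \<sigma>. \<exists>b\<in>coord_ring \<sigma>. feval b z \<noteq> 0 \<and>
        (\<forall>y\<in>aff_points \<sigma>. feval b y \<noteq> 0 \<longrightarrow> (g \<circ> \<iota>) y = feval a y / feval b y)"
      using m by (intro bexI[of _ "Poly_Mapping.single m 1"] bexI[of _ 1])
        (auto simp: aff_points_0 g\<iota> one_in_coord_ring, auto simp: coord_ring_def)
  qed
  moreover have "openin (zariski_aff \<sigma>) (aff_points \<sigma>)"
    using openin_topspace[of "zariski_aff \<sigma>"] by simp
  ultimately have "regular_toric \<Delta> (\<iota> ` aff_points \<sigma>) g"
    using immersion unfolding open_immersion_def by blast
  then have "regular_aff \<tau> {x \<in> aff_points \<tau>. chart \<Delta> \<tau> x \<in> \<iota> ` aff_points \<sigma>} (g \<circ> chart \<Delta> \<tau>)"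
    using \<tau>(1) by (simp add: regular_toric_def)
  then obtain a b where ab: "a \<in> coord_ring \<tau>" "b \<in> coord_ring \<tau>" "feval b x \<noteq> 0"
    and q: "\<And>y. y \<in> aff_points \<tau> \<Longrightarrow> chart \<Delta> \<tau> y \<in> \<iota> ` aff_points \<sigma> \<Longrightarrow> feval b y \<noteq> 0 \<Longrightarrow>
      g (chart \<Delta> \<tau> y) = feval a y / feval b y"
    using \<tau>(2,3) unfolding regular_aff_def by fastforce
  show thesis
  proof
    fix t :: "int ^ 'n \<Rightarrow> complex" assume t: "t \<in> torus" "feval b t \<noteq> 0"
    have "chart \<Delta> \<tau> (restr \<tau> t) = chart \<Delta> {0} t" using \<tau>(1) t(1) by (rule chart_torus)
    then have "g (chart \<Delta> {0} t) = feval a t / feval b t"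
      using q[of "restr \<tau> t"] t ab(1,2) chart_zero_in_image[OF t(1)] restr_in_aff_points[OF zero_subset[OF \<tau>(1)] t(1)]
      by (simp add: feval_restr)
    moreover have "g (chart \<Delta> {0} t) = t m / shift m"
      using g\<iota>[OF restr_\<sigma>[OF torus_divide[OF t(1) shift(1)]]] m
      by (simp add: chart_zero_\<iota>[OF t(1)] restr_apply)
    ultimately show "t m / shift m = feval a t / feval b t" by simp
  qed (use ab in auto)
qed

text \<open>Evaluating the quotient at a real point shows that the translation is real,
  because \<open>cone_monoid \<sigma>\<close> generates the character lattice.\<close>

lemma shift_real: "shift m \<in> \<real>"
proof -
  have mem: "shift m \<in> \<real>" if m: "m \<in> cone_monoid \<sigma>" for m
  proof -
    obtain a b where ab: "feval b (complexify (\<lambda>m. 1 :: real)) \<noteq> 0 \<or> feval b (\<lambda>m. 1 :: complex) \<noteq> 0"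
      "\<And>t. t \<in> torus \<Longrightarrow> feval b t \<noteq> 0 \<Longrightarrow> t m / shift m = feval a t / feval b t"
      using character_quotient[OF zero_in_fan torus_one chart_zero_in_image[OF torus_one] m] by metis
    \<comment> \<open>A real point at which the denominator is nonzero is needed; one complex point
      where it is nonzero shows that \<open>b\<close> is not the zero polynomial.\<close>
    obtain t :: "int ^ 'n \<Rightarrow> real" where t: "t \<in> torus" "feval b t \<noteq> 0"
      using real_torus_nonvanishing ab(1) by metis
    have eq: "complex_of_real (t m) / shift m = of_real (feval a t) / of_real (feval b t)"
      using ab(2)[OF torus_complexify[OF t(1)]] t(2) by (simp add: feval_complexify complexify_apply)
    have "t m \<noteq> 0" "shift m \<noteq> 0" using torus_nonzero[OF t(1)] torus_nonzero[OF shift(1)] by auto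
    then have "feval a t \<noteq> 0" using eq by auto
    then have "shift m = of_real (t m * feval b t / feval a t)"
      using eq t(2) \<open>shift m \<noteq> 0\<close> by (simp add: field_simps)
    then show ?thesis by (metis Reals_of_real)
  qed
  obtain e where e: "exposes e {0} \<sigma>"
    using face_exposed[OF \<sigma>_rational zero_cone_face[OF \<sigma>]] .
  obtain N where N: "m + nsmul N e \<in> cone_monoid \<sigma>"
    using exposes_localization[OF \<sigma>_rational e, of m] by (metis UNIV_I cone_monoid_zero_cone order_refl)
  have "m = (m + nsmul N e) - nsmul N e" by simp
  then have "shift m = shift (m + nsmul N e) / shift (nsmul N e)"
    using torus_diff[OF shift(1), of "m + nsmul N e" "nsmul N e"] by metis
  then show ?thesis
    using mem[OF N] mem[OF cone_monoid_nsmul[OF exposes_mem[OF e]]] by simp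
qed

text \<open>Compare the two sides of \<^term>\<open>x m = a / b\<close> along the one-parameter subgroup \<open>exp_torus (j u)\<close>.\<close>

lemma pairing_nonneg_of_orbit_in_image:
  assumes \<tau>: "\<tau> \<in> \<Delta>" "u \<in> \<tau>" and x: "x \<in> aff_points \<tau>" "chart \<Delta> \<tau> x \<in> \<iota> ` aff_points \<sigma>"
    and van: "\<And>k. k \<in> cone_monoid \<tau> \<Longrightarrow> lattice_vec k \<bullet> u > 0 \<Longrightarrow> x k = 0"
    and m: "m \<in> cone_monoid \<sigma>"
  shows "lattice_vec m \<bullet> u \<ge> 0"
proof (rule ccontr)
  assume neg: "\<not> lattice_vec m \<bullet> u \<ge> 0"
  obtain a b where ab: "a \<in> coord_ring \<tau>" "b \<in> coord_ring \<tau>" "feval b x \<noteq> 0"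
    and q: "\<And>t. t \<in> torus \<Longrightarrow> feval b t \<noteq> 0 \<Longrightarrow> t m / shift m = feval a t / feval b t"
    using character_quotient[OF \<tau>(1) x m] by blast
  define K0 where "K0 f = {k \<in> keys f. lattice_vec k \<bullet> u = 0}" for f :: "int ^ 'n \<Rightarrow>\<^sub>0 real"
  have ku: "lattice_vec k \<bullet> u \<ge> 0" if "f \<in> coord_ring \<tau>" "k \<in> keys f" for f k
    using that \<tau>(2) cone_monoid_nonneg[of k \<tau> u] by (auto simp: coord_ring_def)
  have "feval b x = (\<Sum>k\<in>K0 b. of_real (lookup b k) * x k)"
    unfolding feval_def K0_def
  proof (intro sum.mono_neutral_right ballI)
    fix k assume "k \<in> keys b - {k \<in> keys b. lattice_vec k \<bullet> u = 0}"
    then have "k \<in> cone_monoid \<tau>" "lattice_vec k \<bullet> u > 0"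
      using ab(2) ku[OF ab(2), of k] by (auto simp: coord_ring_def)
    then show "of_real (lookup b k) * x k = 0" using van by simp
  qed auto
  \<comment> \<open>At \<open>x\<close> only exponents orthogonal to \<open>u\<close> contribute to
    \<open>b\<close>, so \<open>b\<close> has such exponents.\<close>
  then have "K0 b \<noteq> {}" using ab(3) by auto
  then obtain k where k: "k \<in> K0 b" by blast
  have kb: "lookup b k \<noteq> 0" using k by (auto simp: K0_def in_keys_iff)
  have fin: "finite (K0 b)" by (simp add: K0_def)
  \<comment> \<open>The starting point has to be generic: the limit of \<open>b\<close> along the
    sequence is its part orthogonal to \<open>u\<close>, evaluated at \<open>t\<close>, and must not
    be 0.\<close>
  obtain t :: "int ^ 'n \<Rightarrow> real" where t: "t \<in> torus" and tne: "(\<Sum>k\<in>K0 b. lookup b k * t k) \<noteq> 0"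
    using torus_nonvanishing[OF fin k, of "lookup b"] kb by blast
  define s where "s j = (\<lambda>m. t m * exp_torus (real j *\<^sub>R u) m)" for j :: nat
  have s: "s j \<in> torus" for j
    unfolding s_def by (rule torus_mult[OF t exp_torus_in_torus])
  have lim: "(\<lambda>j. feval f (s j)) \<longlonglongrightarrow> (\<Sum>k\<in>K0 f. lookup f k * t k)"
    if f: "f \<in> coord_ring \<tau>" for f
  proof -
    have "(\<lambda>j. lookup f k * s j k) \<longlonglongrightarrow>
        (if lattice_vec k \<bullet> u = 0 then lookup f k * t k else 0)" if "k \<in> keys f" for k
    proof (cases "lattice_vec k \<bullet> u = 0")
      case False
      then have pos: "lattice_vec k \<bullet> u > 0" using ku[OF f that] by simp
      have "(\<lambda>j. exp (- (real j * (lattice_vec k \<bullet> u)))) \<longlonglongrightarrow> 0"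
        using LIMSEQ_realpow_zero[of "exp (- (lattice_vec k \<bullet> u))"] pos
        by (simp add: exp_of_nat_mult[symmetric])
      from tendsto_mult[OF tendsto_const[of "lookup f k * t k"] this]
      show ?thesis using False by (simp add: s_def exp_torus_def mult.assoc)
    qed (simp add: s_def exp_torus_def)
    then have "(\<lambda>j. \<Sum>k\<in>keys f. lookup f k * s j k) \<longlonglongrightarrow>
       (\<Sum>k\<in>keys f. if lattice_vec k \<bullet> u = 0 then lookup f k * t k else 0)"
      by (rule tendsto_sum)
    then show ?thesis by (simp add: feval_def K0_def sum.inter_filter)
  qed
  have ev: "eventually (\<lambda>j. feval b (s j) \<noteq> 0) sequentially"
    using tendsto_imp_eventually_ne[OF lim[OF ab(2)] tne] .
  have quot: "(\<lambda>j. feval a (s j) / feval b (s j)) \<longlonglongrightarrow>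
     (\<Sum>k\<in>K0 a. lookup a k * t k) / (\<Sum>k\<in>K0 b. lookup b k * t k)"
    by (intro tendsto_divide lim ab tne)
  then have bdd: "Bseq (\<lambda>j. feval a (s j) / feval b (s j))"
    by (intro convergent_imp_Bseq convergentI)
  then obtain B where B: "\<And>j. norm (feval a (s j) / feval b (s j)) \<le> B"
    by (auto simp: Bseq_def)
  have bound: "eventually (\<lambda>j. \<bar>s j m\<bar> \<le> norm (shift m) * B) sequentially"
    using ev
  proof eventually_elim
    case (elim j)
    have nz: "shift m \<noteq> 0" by (rule torus_nonzero[OF shift(1)])
    have "of_real (s j m) / shift m = of_real (feval a (s j) / feval b (s j))"
      using q[OF torus_complexify[OF s[of j]]] elim by (simp add: feval_complexify complexify_apply)
    then have "norm (of_real (s j m) / shift m) = norm (complex_of_real (feval a (s j) / feval b (s j)))" by simp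
    then have "\<bar>s j m\<bar> / norm (shift m) = norm (feval a (s j) / feval b (s j))"
      by (simp add: norm_divide)
    then have "\<bar>s j m\<bar> = norm (shift m) * norm (feval a (s j) / feval b (s j))"
      using nz by (simp add: divide_eq_eq mult.commute)
    also have "\<dots> \<le> norm (shift m) * B" using B[of j] by (intro mult_left_mono) auto
    finally show ?case .
  qed
  \<comment> \<open>The quotient stays bounded, but a negative inner product makes the character
    blow up along the same sequence.\<close>
  have "filterlim (\<lambda>j. \<bar>t m\<bar> * exp (real j * - (lattice_vec m \<bullet> u))) at_top sequentially"
  proof (rule filterlim_tendsto_pos_mult_at_top[OF tendsto_const])
    show "0 < \<bar>t m\<bar>" using torus_nonzero[OF t] by simp
    have "- (lattice_vec m \<bullet> u) > 0" using neg by simp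
    then show "filterlim (\<lambda>j. exp (real j * - (lattice_vec m \<bullet> u))) at_top sequentially"
      by (intro filterlim_compose[OF exp_at_top] filterlim_at_top_mult_tendsto_pos[OF tendsto_const]
          filterlim_real_sequentially)
  qed
  then have "eventually (\<lambda>j. norm (shift m) * B < \<bar>t m\<bar> * exp (real j * - (lattice_vec m \<bullet> u))) sequentially"
    by (simp add: filterlim_at_top_dense)
  then have "eventually (\<lambda>j. norm (shift m) * B < \<bar>s j m\<bar>) sequentially"
    by (simp add: s_def exp_torus_def abs_mult)
  with bound have "eventually (\<lambda>j :: nat. False) sequentially"
    by eventually_elim simp
  then show False by simp
qed

end

section \<open>Completeness\<close>

lemma real_subalgebra_power: "f \<in> real_subalgebra G \<Longrightarrow> (\<lambda>x. f x ^ n) \<in> real_subalgebra G"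
proof (induction n)
  case 0
  show ?case using real_subalgebra.const[of 1 G] by simp
next
  case (Suc n)
  then show ?case using real_subalgebra.mult[of f G "\<lambda>x. f x ^ n"] by simp
qed

lemma openin_zariski_subalgebra_elim:
  assumes "openin (zariski C (real_subalgebra G)) W" "x \<in> W"
  obtains f where "f \<in> real_subalgebra G" "f x \<noteq> 0" "{y \<in> C. f y \<noteq> 0} \<subseteq> W"
proof -
  have "\<exists>h\<in>real_subalgebra G. \<forall>x\<in>C. h x = f x * g x"
    if "f \<in> real_subalgebra G" "g \<in> real_subalgebra G" for f g
    using real_subalgebra.mult[OF that] by (intro bexI[of _ "\<lambda>x. f x * g x"]) simp_all
  from openin_zariski_elim[OF assms this] show thesis using that by blast
qed

lemma topspace_zariski_subalgebra: "topspace (zariski C (real_subalgebra G)) = C"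
  using real_subalgebra.const[of 1 G] by (rule topspace_zariski) simp

text \<open>Polynomials are continuous in the Euclidean topology, so one that is nonzero at the
  origin is nonzero at nearby points, and the origin alone is not Zariski open.\<close>

lemma punctured_line_not_closed:
  "\<not> closedin (zariski_affine_space 1) {y \<in> affine_space 1. y 0 \<noteq> 0}"
proof
  let ?G = "{\<lambda>y :: nat \<Rightarrow> complex. y i | i. i < 1}"
  let ?o = "\<lambda>s :: complex. (\<lambda>i :: nat. if i = 0 then s else 0)"
  have top: "topspace (zariski_affine_space 1) = affine_space 1"
    unfolding zariski_affine_space_def by (rule topspace_zariski_subalgebra)
  have mem: "?o s \<in> affine_space 1" for s by (simp add: affine_space_def)
  assume "closedin (zariski_affine_space 1) {y \<in> affine_space 1. y 0 \<noteq> 0}"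
  then have "openin (zariski_affine_space 1) (affine_space 1 - {y \<in> affine_space 1. y 0 \<noteq> 0})"
    unfolding closedin_def top by blast
  moreover have "?o 0 \<in> affine_space 1 - {y \<in> affine_space 1. y 0 \<noteq> 0}" using mem[of 0] by simp
  ultimately obtain f where f: "f \<in> real_subalgebra ?G" "f (?o 0) \<noteq> 0"
      "{y \<in> affine_space 1. f y \<noteq> 0} \<subseteq> affine_space 1 - {y \<in> affine_space 1. y 0 \<noteq> 0}"
    unfolding zariski_affine_space_def by (rule openin_zariski_subalgebra_elim)
  have "continuous_on UNIV (\<lambda>s. f (?o s))"
    using f(1)
  proof induction
    case (gen g)
    then have "g = (\<lambda>y. y 0)" by auto
    then show ?case by (simp add: continuous_on_id)
  qed (simp_all add: continuous_on_add continuous_on_mult)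
  then have "open {s. f (?o s) \<noteq> 0}"
    by (intro open_Collect_neq continuous_on_const)
  moreover have "0 \<in> {s. f (?o s) \<noteq> 0}" using f(2) by simp
  ultimately obtain e where e: "e > 0" "ball 0 e \<subseteq> {s. f (?o s) \<noteq> 0}"
    by (rule openE)
  have "complex_of_real (e / 2) \<in> ball 0 e" using e(1) by simp
  then have "f (?o (complex_of_real (e / 2))) \<noteq> 0" using e(2) by blast
  then have "?o (complex_of_real (e / 2)) \<in> affine_space 1 - {y \<in> affine_space 1. y 0 \<noteq> 0}"
    using f(3) mem by blast
  then show False using mem e(1) by simp
qed

section \<open>One-parameter subgroups and the support of a complete fan\<close>

definition one_param :: "int ^ 'n \<Rightarrow> complex \<Rightarrow> int ^ 'n \<Rightarrow> complex" where
  "one_param w s m = s powi (pairing m w)"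

lemma one_param_in_torus: "s \<noteq> 0 \<Longrightarrow> one_param w s \<in> torus"
  by (simp add: torus_iff one_param_def pairing_add_left power_int_add)

text \<open>The equation \<open>x m = one_param w (y 0) m\<close> of a graph, multiplied by a power of \<open>y 0\<close> to make it polynomial.\<close>

definition graph_eqn :: "int ^ 'n \<Rightarrow> int ^ 'n \<Rightarrow> (int ^ 'n \<Rightarrow> complex) \<times> (nat \<Rightarrow> complex) \<Rightarrow> complex" where
  "graph_eqn w m = (\<lambda>(x, y). if pairing m w \<ge> 0 then x m - y 0 ^ nat (pairing m w)
     else x m * y 0 ^ nat (- pairing m w) - 1)"

lemma graph_eqn_iff:
  assumes "y 0 \<noteq> 0"
  shows "graph_eqn w m (x, y) = 0 \<longleftrightarrow> x m = one_param w (y 0) m"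
  using assms by (simp add: graph_eqn_def one_param_def power_int_def divide_simps)

lemma graph_eqn_in_subalgebra:
  fixes \<tau> :: "(real ^ 'n) set"
  assumes "m \<in> cone_monoid \<tau>"
  shows "graph_eqn w m \<in> real_subalgebra ({\<lambda>(x, y). feval f x | f. f \<in> coord_ring \<tau>} \<union> {\<lambda>(x, y). y i | i. i < 1})"
    (is "_ \<in> ?A")
proof -
  have "Poly_Mapping.single m 1 \<in> coord_ring \<tau>" using assms by (simp add: coord_ring_def)
  then have "(\<lambda>(x, y). feval (Poly_Mapping.single m 1) x) \<in> ?A"
    by (intro real_subalgebra.gen UnI1) blast
  then have x: "(\<lambda>p. fst p m) \<in> ?A" by (simp add: case_prod_beta')
  have "(\<lambda>(x, y). y 0) \<in> ?A" by (intro real_subalgebra.gen) auto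
  then have "(\<lambda>p. snd p 0) \<in> ?A" by (simp add: case_prod_beta')
  then have y: "(\<lambda>p. snd p 0 ^ n) \<in> ?A" for n by (rule real_subalgebra_power)
  have c: "(\<lambda>p. - 1) \<in> ?A" using real_subalgebra.const[of "- 1"] by simp
  have 1: "(\<lambda>p. fst p m + - 1 * snd p 0 ^ n) \<in> ?A" for n
    by (intro real_subalgebra.add real_subalgebra.mult x y c)
  have 2: "(\<lambda>p. fst p m * snd p 0 ^ n + - 1) \<in> ?A" for n
    by (intro real_subalgebra.add real_subalgebra.mult x y c)
  show ?thesis
    using 1[of "nat (pairing m w)"] 2[of "nat (- pairing m w)"]
    by (cases "pairing m w \<ge> 0") (simp_all add: graph_eqn_def case_prod_beta')
qed

context fan_variety
begin

text \<open>If no cone contained \<open>w\<close>, the graph of the one-parameter subgroup of \<open>w\<close> would be closed, while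
  its projection to the affine line is the punctured line.\<close>

lemma complete_covers_lattice:
  assumes "complete_toric \<Delta>"
  shows "\<exists>\<tau>\<in>\<Delta>. lattice_vec w \<in> \<tau>"
proof (rule ccontr)
  assume none: "\<not> (\<exists>\<tau>\<in>\<Delta>. lattice_vec w \<in> \<tau>)"
  let ?X = "zariski_toric_prod \<Delta> 1"
  let ?c = "\<lambda>\<tau> (x, y). (chart \<Delta> \<tau> x, y :: nat \<Rightarrow> complex)"
  have topp: "topspace (zariski_aff_prod \<tau> 1) = aff_points \<tau> \<times> affine_space 1" for \<tau> :: "(real ^ 'n) set"
    unfolding zariski_aff_prod_def by (rule topspace_zariski_subalgebra)
  have topX: "topspace ?X = (\<Union>\<tau>\<in>\<Delta>. ?c \<tau> ` (aff_points \<tau> \<times> affine_space 1))"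
    unfolding zariski_toric_prod_def topspace_glued_topology topp ..
  define C where "C = {(chart \<Delta> {0} (one_param w (y 0)), y) | y. y \<in> affine_space 1 \<and> y 0 \<noteq> 0}"
  have CX: "C \<subseteq> topspace ?X"
  proof
    fix p assume "p \<in> C"
    then obtain y where y: "p = (chart \<Delta> {0} (one_param w (y 0)), y)" "y \<in> affine_space 1" "y 0 \<noteq> 0"
      unfolding C_def by blast
    have "p = ?c {0} (one_param w (y 0), y)" using y(1) by simp
    moreover have "(one_param w (y 0), y) \<in> torus \<times> affine_space 1"
      using y one_param_in_torus by simp
    ultimately show "p \<in> topspace ?X" unfolding topX using zero_in_fan by blast
  qed
  have inC: "?c \<tau> (x, y) \<in> C \<longleftrightarrow> (\<forall>m\<in>cone_monoid \<tau>. graph_eqn w m (x, y) = 0)"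
    if \<tau>: "\<tau> \<in> \<Delta>" and x: "x \<in> aff_points \<tau>" and y: "y \<in> affine_space 1" for \<tau> x y
  proof
    assume "?c \<tau> (x, y) \<in> C"
    then have y0: "y 0 \<noteq> 0" and "chart \<Delta> \<tau> x = chart \<Delta> {0} (one_param w (y 0))"
      by (auto simp: C_def)
    then have "x = restr \<tau> (one_param w (y 0))"
      using chart_eq_torus[OF \<tau> x one_param_in_torus] by blast
    then show "\<forall>m\<in>cone_monoid \<tau>. graph_eqn w m (x, y) = 0"
      using y0 by (simp add: graph_eqn_iff restr_apply)
  next
    assume eqs: "\<forall>m\<in>cone_monoid \<tau>. graph_eqn w m (x, y) = 0"
    \<comment> \<open>For this \<open>m\<close> the equation reads \<open>x m * y 0 ^ n = 1\<close>
      with \<open>n > 0\<close> and excludes \<open>y 0 = 0\<close>. This is why the graph acquires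
      no limit point in the chart of a cone that misses \<open>w\<close>.\<close>
    obtain m where m: "m \<in> cone_monoid \<tau>" "pairing m w < 0"
      using rational_separation[OF cone_rational[OF \<tau>]] none \<tau> by blast
    then have "x m * y 0 ^ nat (- pairing m w) = 1" using eqs by (force simp: graph_eqn_def)
    then have y0: "y 0 \<noteq> 0" using m by (auto simp: power_0_left split: if_splits)
    then have "x = restr \<tau> (one_param w (y 0))"
      using eqs x by (auto simp: restr_def fun_eq_iff graph_eqn_iff aff_points_outside)
    then have "chart \<Delta> \<tau> x = chart \<Delta> {0} (one_param w (y 0))"
      using chart_torus[OF \<tau> one_param_in_torus[OF y0]] by simp
    then show "?c \<tau> (x, y) \<in> C" using y y0 by (auto simp: C_def)
  qed
  have "openin ?X (topspace ?X - C)"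
    unfolding zariski_toric_prod_def openin_glued_topology
  proof (intro conjI ballI)
    show "topspace (glued_topology \<Delta> (\<lambda>\<tau>. zariski_aff_prod \<tau> 1) ?c) - C
        \<subseteq> (\<Union>i\<in>\<Delta>. ?c i ` topspace (zariski_aff_prod i 1))"
      unfolding topspace_glued_topology by blast
    fix \<tau> assume \<tau>: "\<tau> \<in> \<Delta>"
    let ?B = "\<lambda>m. {p \<in> aff_points \<tau> \<times> affine_space 1. graph_eqn w m p \<noteq> 0}"
    have "{p \<in> topspace (zariski_aff_prod \<tau> 1). ?c \<tau> p \<in> topspace ?X - C}
      = {p \<in> aff_points \<tau> \<times> affine_space 1. ?c \<tau> p \<notin> C}"
      unfolding topp topX using \<tau> by blast
    also have "\<dots> = (\<Union>m\<in>cone_monoid \<tau>. ?B m)"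
    proof (rule set_eqI)
      fix p :: "(int ^ 'n \<Rightarrow> complex) \<times> (nat \<Rightarrow> complex)"
      obtain x y where p: "p = (x, y)" by (cases p)
      show "p \<in> {p \<in> aff_points \<tau> \<times> affine_space 1. ?c \<tau> p \<notin> C} \<longleftrightarrow> p \<in> (\<Union>m\<in>cone_monoid \<tau>. ?B m)"
        unfolding p using inC[OF \<tau>, of x y] by auto
    qed
    finally have eq: "{p \<in> topspace (zariski_aff_prod \<tau> 1). ?c \<tau> p \<in> topspace ?X - C} = (\<Union>m\<in>cone_monoid \<tau>. ?B m)" .
    have "openin (zariski_aff_prod \<tau> 1) (?B m)" if "m \<in> cone_monoid \<tau>" for m
      unfolding zariski_aff_prod_def
      by (rule openin_zariski_basic[OF graph_eqn_in_subalgebra[OF that]])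
    then have "openin (zariski_aff_prod \<tau> 1) (\<Union>m\<in>cone_monoid \<tau>. ?B m)" by blast
    then show "openin (zariski_aff_prod \<tau> 1) {x \<in> topspace (zariski_aff_prod \<tau> 1). ?c \<tau> x \<in>
        topspace (glued_topology \<Delta> (\<lambda>\<tau>. zariski_aff_prod \<tau> 1) ?c) - C}"
      unfolding eq[symmetric] zariski_toric_prod_def .
  qed
  then have "closedin ?X C" using CX by (simp add: closedin_def)
  then have "closedin (zariski_affine_space 1) (snd ` C)"
    using assms unfolding complete_toric_def closed_map_def by blast
  moreover have "snd ` C = {y \<in> affine_space 1. y 0 \<noteq> 0}"
    by (force simp: C_def image_iff)
  ultimately show False using punctured_line_not_closed by simp
qed

text \<open>Rational directions are covered because cones are stable under scaling; they are dense,
  and a finite union of closed cones is closed.\<close>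

lemma complete_covers:
  assumes "complete_toric \<Delta>"
  shows "\<Union>\<Delta> = UNIV"
proof -
  have closed: "closed (\<Union>\<Delta>)"
  proof (rule closed_Union)
    show "finite \<Delta>" using fan by (simp add: fan_def)
    show "\<forall>\<tau>\<in>\<Delta>. closed \<tau>" using cone_toric toric_cone_closed by blast
  qed
  have "x \<in> \<Union>\<Delta>" for x :: "real ^ 'n"
  proof -
    \<comment> \<open>The coordinates of \<open>x\<close> rounded down to multiples of
      \<open>1 / (N + 1)\<close>, hence a rational approximation of \<open>x\<close>.\<close>
    define q where "q N = (1 / real (Suc N)) *\<^sub>R lattice_vec (\<chi> i. \<lfloor>real (Suc N) * x $ i\<rfloor>)" for N
    have "q N \<in> \<Union>\<Delta>" for N
    proof -
      obtain \<tau> where "\<tau> \<in> \<Delta>" "lattice_vec (\<chi> i. \<lfloor>real (Suc N) * x $ i\<rfloor>) \<in> \<tau>"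
        using complete_covers_lattice[OF assms] by blast
      then have "q N \<in> \<tau>"
        unfolding q_def by (intro convex_cone_scaleR[OF toric_cone_convex_cone[OF cone_toric]]) simp_all
      then show ?thesis using \<open>\<tau> \<in> \<Delta>\<close> by blast
    qed
    moreover have "q \<longlonglongrightarrow> x"
    proof (rule vec_tendstoI)
      fix i
      have "\<bar>q N $ i - x $ i\<bar> \<le> inverse (real (Suc N))" for N
      proof -
        define M where "M = real (Suc N)"
        have M: "M > 0" by (simp add: M_def)
        have "q N $ i - x $ i = (of_int \<lfloor>M * x $ i\<rfloor> - M * x $ i) / M"
          using M unfolding q_def M_def[symmetric] by (simp add: diff_divide_distrib)
        moreover have "\<bar>of_int \<lfloor>M * x $ i\<rfloor> - M * x $ i\<bar> \<le> 1" by linarith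
        ultimately have "\<bar>q N $ i - x $ i\<bar> \<le> 1 / M"
          using M by (simp add: divide_right_mono)
        then show ?thesis by (simp add: M_def inverse_eq_divide)
      qed
      then have "(\<lambda>N. q N $ i - x $ i) \<longlonglongrightarrow> 0"
        by (intro Lim_null_comparison[OF _ LIMSEQ_inverse_real_of_nat] always_eventually allI)
          (simp only: real_norm_def)
      then show "(\<lambda>N. q N $ i) \<longlonglongrightarrow> x $ i" by (simp add: LIM_zero_iff)
    qed
    ultimately show ?thesis using closed closed_sequentially by blast
  qed
  then show ?thesis by blast
qed

end

section \<open>Irreducible boundary components\<close>

text \<open>Zorn's lemma applies because two points that witness reducibility of the union of a
  chain lie in a common member of the chain.\<close>

lemma irreducible_in_component:
  assumes E: "irreducible_in T E" "E \<subseteq> Y"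
  obtains Z where "irreducible_component T Y Z" "E \<subseteq> Z"
proof -
  let ?A = "{Z. E \<subseteq> Z \<and> Z \<subseteq> Y \<and> irreducible_in T Z}"
  have "\<exists>M\<in>?A. \<forall>X\<in>?A. M \<subseteq> X \<longrightarrow> X = M"
  proof (rule subset_Zorn_nonempty)
    show "?A \<noteq> {}" using E by blast
    fix \<C> assume ne: "\<C> \<noteq> {}" and chain: "subset.chain ?A \<C>"
    then have sub: "\<C> \<subseteq> ?A" and lin: "\<And>X Z. X \<in> \<C> \<Longrightarrow> Z \<in> \<C> \<Longrightarrow> X \<subseteq> Z \<or> Z \<subseteq> X"
      unfolding subset.chain_def by blast+
    have irr: "irreducible_in T Z" if "Z \<in> \<C>" for Z using that sub by blast
    have "irreducible_in T (\<Union>\<C>)"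
      unfolding irreducible_in_def
    proof (intro conjI allI impI)
      show "\<Union>\<C> \<noteq> {}" using ne irr unfolding irreducible_in_def by blast
      show "\<Union>\<C> \<subseteq> topspace T" using irr unfolding irreducible_in_def by blast
      fix A B assume AB: "closedin T A \<and> closedin T B \<and> \<Union>\<C> \<subseteq> A \<union> B"
      show "\<Union>\<C> \<subseteq> A \<or> \<Union>\<C> \<subseteq> B"
      proof (rule ccontr)
        assume "\<not> ?thesis"
        then obtain p q P Q where pq: "P \<in> \<C>" "p \<in> P" "p \<notin> A" "Q \<in> \<C>" "q \<in> Q" "q \<notin> B" by blast
        then obtain Z where Z: "Z \<in> \<C>" "p \<in> Z" "q \<in> Z" using lin by blast
        then have "Z \<subseteq> A \<or> Z \<subseteq> B" using irr[of Z] AB unfolding irreducible_in_def by blast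
        then show False using Z pq by blast
      qed
    qed
    moreover have "E \<subseteq> \<Union>\<C>" "\<Union>\<C> \<subseteq> Y" using sub ne by auto
    ultimately show "\<Union>\<C> \<in> ?A" by simp
  qed
  then obtain Z where Z: "Z \<in> ?A" and max: "\<forall>X\<in>?A. Z \<subseteq> X \<longrightarrow> X = Z" by (rule bexE)
  have "irreducible_component T Y Z"
    unfolding irreducible_component_def
  proof (intro conjI allI impI)
    show "Z \<subseteq> Y" "irreducible_in T Z" using Z by simp_all
    fix Z' assume Z': "Z \<subseteq> Z' \<and> Z' \<subseteq> Y \<and> irreducible_in T Z'"
    then have "Z' \<in> ?A" using Z by auto
    then show "Z' = Z" using max Z' by simp
  qed
  then show thesis using that Z by simp
qed

text \<open>For \<open>u \<in> \<tau>\<close>, the closure in \<open>U\<^sub>\<tau>\<close> of the orbit of the minimal face of \<open>\<tau>\<close> that contains \<open>u\<close>.\<close>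

definition limit_locus :: "(real ^ 'n) set \<Rightarrow> real ^ 'n \<Rightarrow> (int ^ 'n \<Rightarrow> complex) set" where
  "limit_locus \<tau> u = {x \<in> aff_points \<tau>. \<forall>k\<in>cone_monoid \<tau>. lattice_vec k \<bullet> u > 0 \<longrightarrow> x k = 0}"

text \<open>For \<open>u\<close> in \<open>\<tau>\<close> this is the limit in
  \<open>U\<^sub>\<tau>\<close> of \<open>t\<close> times
  \<open>exp_torus (real j *\<^sub>R u)\<close> as \<open>j\<close> grows.\<close>

definition limit_point :: "(real ^ 'n) set \<Rightarrow> real ^ 'n \<Rightarrow> (int ^ 'n \<Rightarrow> complex) \<Rightarrow> int ^ 'n \<Rightarrow> complex" where
  "limit_point \<tau> u t k = (if k \<in> cone_monoid \<tau> \<and> lattice_vec k \<bullet> u = 0 then t k else 0)"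

lemma limit_point_in_locus:
  assumes "u \<in> \<tau>" "t \<in> torus"
  shows "limit_point \<tau> u t \<in> limit_locus \<tau> u"
proof -
  have "limit_point \<tau> u t (a + b) = limit_point \<tau> u t a * limit_point \<tau> u t b"
    if "a \<in> cone_monoid \<tau>" "b \<in> cone_monoid \<tau>" for a b
    using cone_monoid_nonneg[OF that(1) assms(1)] cone_monoid_nonneg[OF that(2) assms(1)] that
      cone_monoid_add[OF that]
    by (auto simp: limit_point_def lattice_vec_add inner_add_left torus_add[OF assms(2)])
  then show ?thesis
    using aff_points_0[OF assms(2)] by (simp add: limit_locus_def aff_points_def limit_point_def)
qed

lemma restr_limit_point: "\<rho> \<subseteq> \<tau> \<Longrightarrow> restr \<tau> (limit_point \<rho> u t) = limit_point \<tau> u t"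
  using cone_monoid_antimono[of \<rho> \<tau>] by (auto simp: restr_def limit_point_def fun_eq_iff)

lemma feval_limit_point:
  assumes "f \<in> coord_ring \<tau>"
  shows "feval f (limit_point \<tau> u (complexify t)) =
    of_real (\<Sum>k\<in>{k \<in> keys f. lattice_vec k \<bullet> u = 0}. lookup f k * t k)"
proof -
  have "feval f (limit_point \<tau> u (complexify t)) = (\<Sum>k\<in>keys f.
      if lattice_vec k \<bullet> u = 0 then complex_of_real (lookup f k * t k) else 0)"
    unfolding feval_def using assms
    by (intro sum.cong) (auto simp: limit_point_def complexify_def coord_ring_def)
  then show ?thesis
    by (simp add: sum.inter_filter if_distrib[of complex_of_real] cong: if_cong)
qed

lemma limit_locus_keys:
  assumes "u \<in> \<tau>" "f \<in> coord_ring \<tau>" "x \<in> limit_locus \<tau> u" "feval f x \<noteq> 0"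
  obtains k where "k \<in> keys f" "lattice_vec k \<bullet> u = 0"
proof -
  obtain k where k: "k \<in> keys f" "of_real (lookup f k) * x k \<noteq> 0"
    using assms(4) unfolding feval_def by (meson sum.neutral)
  then have "k \<in> cone_monoid \<tau>" "x k \<noteq> 0" using assms(2) by (auto simp: coord_ring_def)
  then have "lattice_vec k \<bullet> u = 0"
    using assms(3) cone_monoid_nonneg[of k \<tau> u] assms(1) by (force simp: limit_locus_def)
  then show thesis using that k by blast
qed

lemma limit_locus_vanish:
  assumes "f \<in> coord_ring \<tau>" "x \<in> limit_locus \<tau> u" "\<And>k. k \<in> keys f \<Longrightarrow> lattice_vec k \<bullet> u > 0"
  shows "feval f x = 0"
  unfolding feval_def using assms by (intro sum.neutral) (auto simp: limit_locus_def coord_ring_def)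

context fan_variety
begin

text \<open>An open set that meets the locus contains a principal open set given by some
  \<open>f\<close> with an exponent orthogonal to \<open>u\<close>. For two such sets, a torus point
  at which both orthogonal parts are nonzero degenerates to a common point in the locus.\<close>

lemma limit_locus_irreducible:
  assumes \<tau>: "\<tau> \<in> \<Delta>" and u: "u \<in> \<tau>"
  shows "irreducible_in (zariski_toric \<Delta>) (chart \<Delta> \<tau> ` limit_locus \<tau> u)"
  unfolding irreducible_in_def
proof (intro conjI allI impI)
  show "chart \<Delta> \<tau> ` limit_locus \<tau> u \<noteq> {}"
    using limit_point_in_locus[OF u torus_one] by blast
  show "chart \<Delta> \<tau> ` limit_locus \<tau> u \<subseteq> topspace (zariski_toric \<Delta>)"
    using chart_in_topspace[OF \<tau>] by (auto simp: limit_locus_def)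
  fix A B
  assume AB: "closedin (zariski_toric \<Delta>) A \<and> closedin (zariski_toric \<Delta>) B \<and> chart \<Delta> \<tau> ` limit_locus \<tau> u \<subseteq> A \<union> B"
  have poly: "\<exists>f\<in>coord_ring \<tau>. (\<exists>k\<in>keys f. lattice_vec k \<bullet> u = 0) \<and>
      (\<forall>y\<in>aff_points \<tau>. feval f y \<noteq> 0 \<longrightarrow> chart \<Delta> \<tau> y \<notin> D)"
    if D: "closedin (zariski_toric \<Delta>) D" and x: "x \<in> limit_locus \<tau> u" "chart \<Delta> \<tau> x \<notin> D" for D x
  proof -
    have xa: "x \<in> aff_points \<tau>" using x by (simp add: limit_locus_def)
    let ?W = "{y \<in> aff_points \<tau>. chart \<Delta> \<tau> y \<in> topspace (zariski_toric \<Delta>) - D}"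
    have "openin (zariski_aff \<tau>) ?W"
      using D \<tau> by (intro openin_zariski_toric_preimage) auto
    moreover have "x \<in> ?W" using x(2) xa chart_in_topspace[OF \<tau>] by blast
    ultimately obtain f where f: "f \<in> coord_ring \<tau>" "feval f x \<noteq> 0" "{y \<in> aff_points \<tau>. feval f y \<noteq> 0} \<subseteq> ?W"
      by (rule openin_zariski_aff_elim)
    obtain k where "k \<in> keys f" "lattice_vec k \<bullet> u = 0"
      using limit_locus_keys[OF u f(1) x(1) f(2)] .
    then show ?thesis using f(1,3) by blast
  qed
  show "chart \<Delta> \<tau> ` limit_locus \<tau> u \<subseteq> A \<or> chart \<Delta> \<tau> ` limit_locus \<tau> u \<subseteq> B"
  proof (rule ccontr)
    assume "\<not> ?thesis"
    then obtain x y where "x \<in> limit_locus \<tau> u" "chart \<Delta> \<tau> x \<notin> A" "y \<in> limit_locus \<tau> u" "chart \<Delta> \<tau> y \<notin> B"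
      by blast
    then obtain f g k l where f: "f \<in> coord_ring \<tau>" "k \<in> keys f" "lattice_vec k \<bullet> u = 0"
        "\<And>y. y \<in> aff_points \<tau> \<Longrightarrow> feval f y \<noteq> 0 \<Longrightarrow> chart \<Delta> \<tau> y \<notin> A"
      and g: "g \<in> coord_ring \<tau>" "l \<in> keys g" "lattice_vec l \<bullet> u = 0"
        "\<And>y. y \<in> aff_points \<tau> \<Longrightarrow> feval g y \<noteq> 0 \<Longrightarrow> chart \<Delta> \<tau> y \<notin> B"
      using poly[of A x] poly[of B y] AB by metis
    let ?K = "\<lambda>f. {k \<in> keys f. lattice_vec k \<bullet> u = 0}"
    obtain t :: "int ^ 'n \<Rightarrow> real" where t: "t \<in> torus"
      "(\<Sum>k\<in>?K f. lookup f k * t k) \<noteq> 0" "(\<Sum>k\<in>?K g. lookup g k * t k) \<noteq> 0"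
      using torus_nonvanishing_pair[of "?K f" k "lookup f" "?K g" l "lookup g"] f g
      by (auto simp: in_keys_iff)
    let ?p = "limit_point \<tau> u (complexify t)"
    have p: "?p \<in> limit_locus \<tau> u" by (rule limit_point_in_locus[OF u torus_complexify[OF t(1)]])
    then have pa: "?p \<in> aff_points \<tau>" by (simp add: limit_locus_def)
    have "chart \<Delta> \<tau> ?p \<notin> A"
      using f(4)[OF pa] t(2) unfolding feval_limit_point[OF f(1)] of_real_eq_0_iff by blast
    moreover have "chart \<Delta> \<tau> ?p \<notin> B"
      using g(4)[OF pa] t(3) unfolding feval_limit_point[OF g(1)] of_real_eq_0_iff by blast
    ultimately show False using p AB by blast
  qed
qed

end

section \<open>Orders along boundary divisors\<close>

locale compatible_completion = toric_embedding \<Delta> \<sigma> \<iota>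
  for \<Delta> :: "(real ^ 'n) set set" and \<sigma> :: "(real ^ 'n) set" and \<iota> :: "(int ^ 'n \<Rightarrow> complex) \<Rightarrow> 'n toric_point" +
  fixes S :: "(int ^ 'n \<Rightarrow> real) set"
  assumes S_sub: "S \<subseteq> aff_points \<sigma>"
    and complete: "complete_toric \<Delta>"
    and compatible: "S_compatible \<sigma> \<Delta> \<iota> S"
begin

definition S_closure :: "'n toric_point set" where
  "S_closure = subtopology (euclidean_toric \<Delta>) (real_points \<Delta>) closure_of ((\<lambda>x. \<iota> (complexify x)) ` S)"

text \<open>The divisor of \<open>u\<close> lies outside \<open>V\<close>, respectively meets the closure of \<open>S\<close>.\<close>

definition boundary_direction :: "real ^ 'n \<Rightarrow> bool" where
  "boundary_direction u \<longleftrightarrow> (\<exists>m\<in>cone_monoid \<sigma>. lattice_vec m \<bullet> u < 0)"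

definition meets :: "real ^ 'n \<Rightarrow> bool" where
  "meets u \<longleftrightarrow> (\<exists>\<tau>\<in>\<Delta>. u \<in> \<tau> \<and> (\<exists>x\<in>limit_locus \<tau> u. chart \<Delta> \<tau> x \<in> S_closure))"

lemma limit_locus_outside:
  assumes "\<tau> \<in> \<Delta>" "u \<in> \<tau>" "boundary_direction u" "x \<in> limit_locus \<tau> u"
  shows "chart \<Delta> \<tau> x \<notin> \<iota> ` aff_points \<sigma>"
proof
  assume *: "chart \<Delta> \<tau> x \<in> \<iota> ` aff_points \<sigma>"
  obtain m where m: "m \<in> cone_monoid \<sigma>" "lattice_vec m \<bullet> u < 0" using assms(3) by (auto simp: boundary_direction_def)
  have "lattice_vec m \<bullet> u \<ge> 0"
    using pairing_nonneg_of_orbit_in_image[OF assms(1,2) _ * _ m(1)] assms(4) by (simp add: limit_locus_def)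
  then show False using m by simp
qed

lemma S_closure_elim:
  assumes "p \<in> S_closure" "openin (euclidean_toric \<Delta>) W" "p \<in> W"
  obtains s where "s \<in> S" "\<iota> (complexify s) \<in> W"
proof -
  have "p \<in> real_points \<Delta>" using assms(1) by (simp add: S_closure_def in_closure_of)
  moreover have "openin (subtopology (euclidean_toric \<Delta>) (real_points \<Delta>)) (W \<inter> real_points \<Delta>)"
    using assms(2) by (auto simp: openin_subtopology)
  ultimately show thesis
    using assms that unfolding S_closure_def in_closure_of by blast
qed

text \<open>A ray has no faces but 0 and itself, so its chart is the torus together with one
  divisor.\<close>

lemma ray_locus_dichotomy:
  assumes \<rho>_def: "\<rho> = convex_cone hull {lattice_vec g}" and \<rho>: "\<rho> \<in> \<Delta>"
    and x: "x \<in> aff_points \<rho>" "x \<notin> limit_locus \<rho> (lattice_vec g)"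
  obtains t where "t \<in> torus" "x = restr \<rho> t"
proof -
  obtain k where k: "k \<in> cone_monoid \<rho>" "lattice_vec k \<bullet> lattice_vec g > 0" "x k \<noteq> 0"
    using x unfolding limit_locus_def by blast
  have van: "v \<in> {0}" if v: "v \<in> \<rho>" "lattice_vec k \<bullet> v = 0" for v
  proof -
    obtain c where "v = c *\<^sub>R lattice_vec g"
      using v(1)[unfolded \<rho>_def] in_cone_hull_image_iff[of "{g}" v lattice_vec] by auto
    then show ?thesis using v(2) k(2) by auto
  qed
  obtain t where "t \<in> torus" "restr \<rho> t = x"
    by (rule localize_exists[OF cone_rational[OF \<rho>] k(1) _ zero_subset[OF \<rho>] van x(1) k(3)]) simp_all
  then show thesis using that by blast
qed

lemma shift_eq: "of_real (Re (shift m)) = shift m"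
  using shift_real[of m] by (rule of_real_Re)

lemma shift_Re_nonzero: "Re (shift m) \<noteq> 0"
  using shift_eq[of m] torus_nonzero[OF shift(1), of m] by (metis of_real_0)

text \<open>The polynomial \<open>f\<close> divided by the character \<open>k0\<close>, in the coordinates of the torus of \<open>X\<close>.\<close>

definition twist :: "int ^ 'n \<Rightarrow> (int ^ 'n \<Rightarrow>\<^sub>0 real) \<Rightarrow> (int ^ 'n \<Rightarrow>\<^sub>0 real)" where
  "twist k0 f = laurent (keys f) (\<lambda>k. lookup f k / Re (shift k)) (\<lambda>k. k - k0)"

lemma lookup_twist: "lookup (twist k0 f) j = lookup f (j + k0) / Re (shift (j + k0))"
proof -
  have "lookup (twist k0 f) j =
      (\<Sum>k\<in>keys f. if k = j + k0 then lookup f k / Re (shift k) else 0)"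
    unfolding twist_def laurent_def lookup_sum
    by (intro sum.cong refl) (simp add: lookup_single when_def diff_eq_eq)
  then show ?thesis by (simp add: in_keys_iff)
qed

lemma keys_twist: "keys (twist k0 f) = (\<lambda>k. k - k0) ` keys f"
proof (rule set_eqI)
  fix j
  have "j \<in> keys (twist k0 f) \<longleftrightarrow> j + k0 \<in> keys f"
    using shift_Re_nonzero by (simp add: in_keys_iff lookup_twist)
  then show "j \<in> keys (twist k0 f) \<longleftrightarrow> j \<in> (\<lambda>k. k - k0) ` keys f"
    by (simp add: image_iff eq_diff_eq)
qed

text \<open>In the torus coordinates \<open>t\<close> of \<open>X\<close> the point of
  \<open>V\<close> is \<open>t / shift\<close>; the translation is absorbed by the coefficients and
  the character \<open>k0\<close> is taken out in front.\<close>

lemma feval_twist: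
  assumes t: "t \<in> torus" and f: "f \<in> coord_ring \<sigma>" and s: "complexify s = restr \<sigma> (\<lambda>m. t m / shift m)"
  shows "of_real (feval f s) = t k0 * feval (twist k0 f) t"
proof -
  have "of_real (feval f s) = feval f (\<lambda>m. t m / shift m)"
    using s f by (simp add: feval_restr flip: feval_complexify)
  also have "\<dots> = t k0 * feval (twist k0 f) t"
    unfolding twist_def feval_laurent unfolding feval_def sum_distrib_left
  proof (intro sum.cong refl)
    fix k
    have "t (k - k0) = t k / t k0" "t k0 \<noteq> 0" using torus_diff[OF t] torus_nonzero[OF t] by auto
    then show "of_real (lookup f k) * (t k / shift k) =
        t k0 * (of_real (lookup f k / Re (shift k)) * t (k - k0))"
      by (simp add: shift_eq)
  qed
  finally show ?thesis .
qed

text \<open>Otherwise \<open>g / f\<close> has a pole along the divisor of \<open>u\<close>; divided by the leading character of \<open>g\<close>,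
  \<open>f\<close> vanishes on this divisor but \<open>g\<close> does not vanish at some point of it in the closure of \<open>S\<close>.\<close>

lemma dominated_order:
  assumes \<rho>: "convex_cone hull {lattice_vec u0} \<in> \<Delta>" and out: "boundary_direction (lattice_vec u0)" and met: "meets (lattice_vec u0)"
    and f: "f \<in> coord_ring \<sigma>" and g: "g \<in> coord_ring \<sigma>"
    and dom: "\<And>s. s \<in> S \<Longrightarrow> \<bar>feval g s\<bar> \<le> \<bar>feval f s\<bar>"
    and k1: "k1 \<in> keys g"
  shows "\<exists>k\<in>keys f. lattice_vec k \<bullet> lattice_vec u0 \<le> lattice_vec k1 \<bullet> lattice_vec u0"
proof (rule ccontr)
  define u where "u = lattice_vec u0"
  define \<rho> where "\<rho> = convex_cone hull {lattice_vec u0}"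
  have \<rho>\<Delta>: "\<rho> \<in> \<Delta>" using assms(1) by (simp add: \<rho>_def)
  have u\<rho>: "u \<in> \<rho>" by (simp add: u_def \<rho>_def hull_inc)
  have \<rho>_monoid: "k \<in> cone_monoid \<rho> \<longleftrightarrow> lattice_vec k \<bullet> u \<ge> 0" for k
    using cone_monoid_hull[of k "{u0}"] by (simp add: \<rho>_def u_def inner_lattice_vec)
  assume "\<not> ?thesis"
  then have big: "lattice_vec k1 \<bullet> u < lattice_vec k \<bullet> u" if "k \<in> keys f" for k
    using that by (auto simp: u_def not_le)
  \<comment> \<open>After division by this exponent, 0 is an exponent of \<open>?g\<close>, so
    \<open>?g\<close> does not vanish identically on the divisor, while all exponents of
    \<open>?f\<close> become positive on \<open>u\<close>.\<close>
  define k0 where "k0 = arg_min_on (\<lambda>k. lattice_vec k \<bullet> u) (keys g)"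
  have ne: "keys g \<noteq> {}" using k1 by blast
  have k0: "k0 \<in> keys g"
    unfolding k0_def by (rule arg_min_if_finite(1)[OF finite_keys ne])
  have "\<not> (\<exists>k\<in>keys g. lattice_vec k \<bullet> u < lattice_vec k0 \<bullet> u)"
    unfolding k0_def by (rule arg_min_if_finite(2)[OF finite_keys ne])
  then have min: "lattice_vec k0 \<bullet> u \<le> lattice_vec k \<bullet> u" if "k \<in> keys g" for k
    using that by (meson not_less)
  let ?f = "twist k0 f" and ?g = "twist k0 g"
  have gr: "?g \<in> coord_ring \<rho>"
    using min by (auto simp: coord_ring_def keys_twist \<rho>_monoid lattice_vec_diff inner_diff_left)
  have fpos: "lattice_vec k \<bullet> u > 0" if "k \<in> keys ?f" for k
    using that big min[OF k1] by (force simp: keys_twist lattice_vec_diff inner_diff_left)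
  then have fr: "?f \<in> coord_ring \<rho>" by (auto simp: coord_ring_def \<rho>_monoid less_imp_le)
  obtain \<tau> x where \<tau>: "\<tau> \<in> \<Delta>" "u \<in> \<tau>" and x: "x \<in> limit_locus \<tau> u" "chart \<Delta> \<tau> x \<in> S_closure"
    using met unfolding meets_def u_def by blast
  have \<rho>\<tau>: "\<rho> \<subseteq> \<tau>"
    unfolding \<rho>_def
  proof (rule hull_minimal)
    show "{lattice_vec u0} \<subseteq> \<tau>" using \<tau>(2) by (simp add: u_def)
    show "convex_cone \<tau>" by (rule toric_cone_convex_cone[OF cone_toric[OF \<tau>(1)]])
  qed
  have out': "boundary_direction u" using out by (simp add: u_def)
  let ?E = "chart \<Delta> \<tau> ` limit_locus \<tau> u"
  let ?Y = "topspace (zariski_toric \<Delta>) - \<iota> ` aff_points \<sigma>"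
  have EY: "?E \<subseteq> ?Y"
  proof
    fix p assume p: "p \<in> ?E"
    then have "p \<notin> \<iota> ` aff_points \<sigma>" using limit_locus_outside[OF \<tau> out'] by (elim imageE) simp
    moreover have "?E \<subseteq> topspace (zariski_toric \<Delta>)"
      using limit_locus_irreducible[OF \<tau>] by (simp add: irreducible_in_def)
    ultimately show "p \<in> ?Y" using p by (meson DiffI subsetD)
  qed
  \<comment> \<open>The locus only has to lie in some component; density of the closure of
    \<open>S\<close> in that component is enough.\<close>
  obtain Z where Z: "irreducible_component (zariski_toric \<Delta>) ?Y Z" "?E \<subseteq> Z"
    using irreducible_in_component[OF limit_locus_irreducible[OF \<tau>] EY] .
  have ZY: "Z \<subseteq> ?Y" using Z(1) by (simp add: irreducible_component_def)
  have "chart \<Delta> \<tau> x \<in> Z \<inter> real_points \<Delta> \<inter> S_closure"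
    using Z(2) x by (auto simp: S_closure_def in_closure_of)
  then have dense: "Z \<subseteq> zariski_toric \<Delta> closure_of (Z \<inter> real_points \<Delta> \<inter> S_closure)"
    using compatible Z(1) unfolding S_compatible_def Let_def S_closure_def[symmetric] by blast
  \<comment> \<open>\<open>?W\<close> lies in the chart of the ray, so a point of \<open>?W\<close>
    outside \<open>V\<close> sits on the open orbit of the divisor, even if \<open>\<tau>\<close> is
    larger and \<open>x\<close> lies in a deeper orbit.\<close>
  let ?W = "chart \<Delta> \<rho> ` {y \<in> aff_points \<rho>. feval ?g y \<noteq> 0}"
  have W: "openin (zariski_toric \<Delta>) ?W" by (rule openin_zariski_toric_chart[OF \<rho>\<Delta> gr])
  have "\<exists>p. p \<in> Z \<inter> ?W"
  proof -
    let ?K = "{k \<in> keys ?g. lattice_vec k \<bullet> u = 0}"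
    have 0: "0 \<in> ?K" using k0 by (auto simp: keys_twist image_iff)
    obtain t :: "int ^ 'n \<Rightarrow> real" where t: "t \<in> torus" "(\<Sum>k\<in>?K. lookup ?g k * t k) \<noteq> 0"
      using torus_nonvanishing[of ?K 0 "lookup ?g"] 0 by (auto simp: in_keys_iff)
    let ?y = "limit_point \<rho> u (complexify t)"
    have y: "?y \<in> limit_locus \<rho> u" by (rule limit_point_in_locus[OF u\<rho> torus_complexify[OF t(1)]])
    have "feval ?g ?y \<noteq> 0" using t(2) unfolding feval_limit_point[OF gr] of_real_eq_0_iff .
    then have "chart \<Delta> \<rho> ?y \<in> ?W" using y by (auto simp: limit_locus_def)
    moreover have "chart \<Delta> \<rho> ?y = chart \<Delta> \<tau> (limit_point \<tau> u (complexify t))"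
      using chart_restr[OF \<rho>\<Delta> \<tau>(1) \<rho>\<tau>, of ?y] y restr_limit_point[OF \<rho>\<tau>] by (simp add: limit_locus_def)
    moreover have "limit_point \<tau> u (complexify t) \<in> limit_locus \<tau> u"
      by (rule limit_point_in_locus[OF \<tau>(2) torus_complexify[OF t(1)]])
    ultimately have "chart \<Delta> \<rho> ?y \<in> Z \<inter> ?W" using Z(2) by auto
    then show ?thesis by blast
  qed
  then obtain q where q: "q \<in> Z" "q \<in> ?W" by (elim exE IntE)
  then have "q \<in> zariski_toric \<Delta> closure_of (Z \<inter> real_points \<Delta> \<inter> S_closure)"
    using dense by (elim subsetD)
  then obtain p where "p \<in> Z \<inter> real_points \<Delta> \<inter> S_closure" and pW: "p \<in> ?W"
    unfolding in_closure_of using q(2) W by meson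
  then have p: "p \<in> Z" "p \<in> S_closure" "p \<in> ?W" by simp_all
  then obtain y where y: "y \<in> aff_points \<rho>" "feval ?g y \<noteq> 0" "p = chart \<Delta> \<rho> y"
    by auto
  have notV: "p \<notin> \<iota> ` aff_points \<sigma>" using p(1) ZY by blast
  have "y \<in> limit_locus \<rho> u"
  proof (rule ccontr)
    assume "y \<notin> limit_locus \<rho> u"
    then obtain t where "t \<in> torus" "y = restr \<rho> t"
      using ray_locus_dichotomy[OF \<rho>_def \<rho>\<Delta> y(1)] unfolding u_def by metis
    then show False using notV y(3) chart_torus[OF \<rho>\<Delta>] chart_zero_in_image by simp
  qed
  then have "feval ?f y = 0" by (rule limit_locus_vanish[OF fr _ fpos])
  \<comment> \<open>At \<open>y\<close> the left side is 0 and the right side is not. The inequality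
    is an open condition at a point of the closure of \<open>S\<close>, so it also holds at some
    point of \<open>S\<close>.\<close>
  then have "p \<in> chart \<Delta> \<rho> ` {y \<in> aff_points \<rho>. norm (feval ?f y) < norm (feval ?g y)}"
    using y by auto
  then obtain s where s: "s \<in> S" "\<iota> (complexify s) \<in> chart \<Delta> \<rho> ` {y \<in> aff_points \<rho>. norm (feval ?f y) < norm (feval ?g y)}"
    by (rule S_closure_elim[OF p(2) openin_euclidean_toric_chart[OF \<rho>\<Delta> fr gr]])
  then obtain z where z: "z \<in> aff_points \<rho>" "norm (feval ?f z) < norm (feval ?g z)" "\<iota> (complexify s) = chart \<Delta> \<rho> z"
    by auto
  have s\<sigma>: "complexify s \<in> aff_points \<sigma>" using s(1) S_sub aff_points_complexify by blast
  \<comment> \<open>A point of \<open>V\<close> avoids the divisor, so \<open>z\<close> comes from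
    the torus, where the division by the character \<open>k0\<close> can be undone.\<close>
  have "z \<notin> limit_locus \<rho> u"
  proof
    assume "z \<in> limit_locus \<rho> u"
    from limit_locus_outside[OF \<rho>\<Delta> u\<rho> out' this] show False using z(3) s\<sigma> by (metis imageI)
  qed
  then obtain t where t: "t \<in> torus" "z = restr \<rho> t"
    using ray_locus_dichotomy[OF \<rho>_def \<rho>\<Delta> z(1)] unfolding u_def by metis
  have "\<iota> (complexify s) = \<iota> (restr \<sigma> (\<lambda>m. t m / shift m))"
    using z(3) t chart_torus[OF \<rho>\<Delta> t(1)] chart_zero_\<iota>[OF t(1)] by simp
  then have st: "complexify s = restr \<sigma> (\<lambda>m. t m / shift m)"
    using \<iota>_inj s\<sigma> restr_\<sigma>[OF torus_divide[OF t(1) shift(1)]] by (auto dest: inj_onD)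
  have val: "\<bar>feval h s\<bar> = norm (t k0) * norm (feval (twist k0 h) z)"
    if "h \<in> coord_ring \<sigma>" "twist k0 h \<in> coord_ring \<rho>" for h
  proof -
    have "\<bar>feval h s\<bar> = norm (complex_of_real (feval h s))" by simp
    also have "\<dots> = norm (t k0) * norm (feval (twist k0 h) t)"
      unfolding feval_twist[OF t(1) that(1) st, of k0] by (rule norm_mult)
    also have "feval (twist k0 h) t = feval (twist k0 h) z"
      using that(2) t(2) by (simp add: feval_restr)
    finally show ?thesis .
  qed
  have "norm (t k0) > 0" using torus_nonzero[OF t(1)] by simp
  then have "\<bar>feval f s\<bar> < \<bar>feval g s\<bar>"
    unfolding val[OF f fr] val[OF g gr] using z(2) by simp
  then show False using dom[OF s(1)] by simp
qed

end

section \<open>Extension of characters\<close>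

definition zsmul :: "int \<Rightarrow> int ^ 'n \<Rightarrow> int ^ 'n" where
  "zsmul k a = (\<chi> i. k * a $ i)"

lemma zsmul_simps [simp]: "zsmul 0 a = 0" "zsmul 1 a = a"
  and zsmul_add: "zsmul (j + k) a = zsmul j a + zsmul k a"
  and zsmul_zsmul: "zsmul j (zsmul k a) = zsmul (j * k) a"
  by (simp_all add: zsmul_def vec_eq_iff algebra_simps)

text \<open>A homomorphism from a subgroup \<open>A\<close> of the lattice to the nonzero reals; the
  values of \<open>\<phi>\<close> outside \<open>A\<close> are arbitrary.\<close>

definition character_on :: "(int ^ 'n) set \<Rightarrow> (int ^ 'n \<Rightarrow> real) \<Rightarrow> bool" where
  "character_on A \<phi> \<longleftrightarrow> 0 \<in> A \<and> (\<forall>a\<in>A. \<forall>b\<in>A. a - b \<in> A) \<and>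
     (\<forall>a\<in>A. \<forall>b\<in>A. \<phi> (a + b) = \<phi> a * \<phi> b) \<and> (\<forall>a\<in>A. \<phi> a \<noteq> 0)"

lemma character_on_torus: "character_on UNIV t \<longleftrightarrow> t \<in> torus"
proof
  assume t: "character_on UNIV t"
  then have "t (0 + 0) = t 0 * t 0" "t 0 \<noteq> 0" unfolding character_on_def by blast+
  then have "t 0 = 1" by simp
  then show "t \<in> torus" using t by (simp add: torus_iff character_on_def)
next
  assume t: "t \<in> torus"
  then show "character_on UNIV t"
    using torus_nonzero[OF t] by (simp add: character_on_def torus_iff)
qed

context
  fixes A :: "(int ^ 'n) set" and \<phi> :: "int ^ 'n \<Rightarrow> real"
  assumes ch: "character_on A \<phi>"
begin

lemma character_0: "0 \<in> A" "\<phi> 0 = 1"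
proof -
  show "0 \<in> A" using ch by (simp add: character_on_def)
  then have "\<phi> (0 + 0) = \<phi> 0 * \<phi> 0" "\<phi> 0 \<noteq> 0" using ch unfolding character_on_def by blast+
  then show "\<phi> 0 = 1" by simp
qed

lemma character_nonzero: "a \<in> A \<Longrightarrow> \<phi> a \<noteq> 0"
  using ch by (simp add: character_on_def)

lemma character_minus: "a \<in> A \<Longrightarrow> - a \<in> A"
  using ch character_0(1) unfolding character_on_def by (metis diff_0)

lemma character_add: "a \<in> A \<Longrightarrow> b \<in> A \<Longrightarrow> a + b \<in> A" "a \<in> A \<Longrightarrow> b \<in> A \<Longrightarrow> \<phi> (a + b) = \<phi> a * \<phi> b"
proof -
  assume ab: "a \<in> A" "b \<in> A"
  have "a - (- b) \<in> A" using ch ab(1) character_minus[OF ab(2)] unfolding character_on_def by blast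
  then show "a + b \<in> A" by simp
  show "\<phi> (a + b) = \<phi> a * \<phi> b" using ch ab unfolding character_on_def by blast
qed

lemma character_diff: "a \<in> A \<Longrightarrow> b \<in> A \<Longrightarrow> a - b \<in> A" "a \<in> A \<Longrightarrow> b \<in> A \<Longrightarrow> \<phi> (a - b) = \<phi> a / \<phi> b"
proof -
  assume ab: "a \<in> A" "b \<in> A"
  show m: "a - b \<in> A" using ch ab unfolding character_on_def by blast
  have "\<phi> a = \<phi> (a - b) * \<phi> b" using character_add(2)[OF m ab(2)] by simp
  then show "\<phi> (a - b) = \<phi> a / \<phi> b" using character_nonzero[OF ab(2)] by simp
qed

lemma character_zsmul:
  assumes a: "a \<in> A"
  shows "zsmul k a \<in> A \<and> \<phi> (zsmul k a) = \<phi> a powi k"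
proof (induction k rule: int_induct[where k = 0])
  case base
  show ?case using character_0 by simp
next
  case (step1 i)
  then show ?case
    using character_add[OF _ a, of "zsmul i a"] character_nonzero[OF a]
    by (simp add: zsmul_add power_int_add)
next
  case (step2 i)
  have "zsmul (i - 1) a = zsmul i a - a" using zsmul_add[of "i - 1" 1 a] by simp
  then show ?case
    using character_diff[OF _ a, of "zsmul i a"] character_nonzero[OF a] step2
    by (simp add: power_int_diff)
qed

text \<open>Characters that agree on an intersection glue on the sum of the subgroups. The last
  conclusion exhibits each value as a product, so that positivity passes to the extension.\<close>

lemma character_amalgam:
  assumes t: "t \<in> torus" and B: "0 \<in> B" "\<And>a b. a \<in> B \<Longrightarrow> b \<in> B \<Longrightarrow> a - b \<in> B"
    and agree: "\<And>b. b \<in> A \<Longrightarrow> b \<in> B \<Longrightarrow> \<phi> b = t b"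
  obtains C \<phi>' where "character_on C \<phi>'" "A \<subseteq> C" "B \<subseteq> C" "\<forall>a\<in>A. \<phi>' a = \<phi> a" "\<forall>b\<in>B. \<phi>' b = t b"
    "\<forall>c\<in>C. \<exists>a\<in>A. \<phi>' c = \<phi> a * t (c - a)"
proof -
  define C where "C = {a + b | a b. a \<in> A \<and> b \<in> B}"
  \<comment> \<open>A choice of the \<open>A\<close>-part of \<open>c\<close>; agreement on the
    intersection makes \<open>\<phi>'\<close> independent of it.\<close>
  define p where "p c = (SOME a. a \<in> A \<and> c - a \<in> B)" for c
  define \<phi>' where "\<phi>' c = \<phi> (p c) * t (c - p c)" for c
  have wd: "\<phi>' (a + b) = \<phi> a * t b" and pA: "p (a + b) \<in> A" if ab: "a \<in> A" "b \<in> B" for a b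
  proof -
    have "p (a + b) \<in> A \<and> a + b - p (a + b) \<in> B"
      unfolding p_def by (rule someI[of _ a]) (use ab in simp)
    then have p: "p (a + b) \<in> A" "a + b - p (a + b) \<in> B" by auto
    let ?d = "p (a + b) - a"
    have "?d = b - (a + b - p (a + b))" by simp
    then have "?d \<in> B" using B(2)[OF ab(2) p(2)] by metis
    moreover have "?d \<in> A" by (rule character_diff(1)[OF p(1) ab(1)])
    ultimately have "\<phi> (p (a + b)) / \<phi> a = t (p (a + b)) / t a"
      using agree character_diff(2)[OF p(1) ab(1)] torus_diff[OF t] by metis
    then show "\<phi>' (a + b) = \<phi> a * t b"
      using character_nonzero[OF ab(1)] torus_nonzero[OF t]
      by (simp add: \<phi>'_def torus_diff[OF t] torus_add[OF t] field_simps)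
    show "p (a + b) \<in> A" by (rule p(1))
  qed
  have A0: "\<phi>' a = \<phi> a" if "a \<in> A" for a using wd[OF that B(1)] aff_points_0[OF t] by simp
  have B0: "\<phi>' b = t b" if "b \<in> B" for b using wd[OF character_0(1) that] character_0(2) by simp
  have Bm: "- b \<in> B" if "b \<in> B" for b using B(2)[OF B(1) that] by simp
  have "character_on C \<phi>'"
    unfolding character_on_def
  proof (intro conjI ballI)
    show "0 \<in> C" unfolding C_def using character_0(1) B(1) by force
  next
    fix c d assume "c \<in> C" "d \<in> C"
    then obtain a b a' b' where c: "c = a + b" "a \<in> A" "b \<in> B" and d: "d = a' + b'" "a' \<in> A" "b' \<in> B"
      unfolding C_def by blast
    have "c - d = (a - a') + (b - b')" using c d by simp
    then show "c - d \<in> C"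
      unfolding C_def using character_diff(1)[OF c(2) d(2)] B(2)[OF c(3) d(3)] by blast
    have "b + b' = b - (- b')" by simp
    then have bb: "b + b' \<in> B" using B(2)[OF c(3) Bm[OF d(3)]] by simp
    have "c + d = (a + a') + (b + b')" using c d by simp
    then have "\<phi>' (c + d) = \<phi> (a + a') * t (b + b')"
      using wd[OF character_add(1)[OF c(2) d(2)] bb] by simp
    then show "\<phi>' (c + d) = \<phi>' c * \<phi>' d"
      unfolding c(1) d(1) wd[OF c(2,3)] wd[OF d(2,3)] character_add(2)[OF c(2) d(2)] torus_add[OF t]
      by simp
  next
    fix c assume "c \<in> C"
    then obtain a b where c: "c = a + b" "a \<in> A" "b \<in> B" unfolding C_def by blast
    show "\<phi>' c \<noteq> 0" unfolding c(1) wd[OF c(2,3)] using character_nonzero[OF c(2)] torus_nonzero[OF t] by simp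
  qed
  moreover have "A \<subseteq> C"
  proof
    fix a assume "a \<in> A"
    then show "a \<in> C" unfolding C_def using B(1) by force
  qed
  moreover have "B \<subseteq> C"
  proof
    fix b assume "b \<in> B"
    then show "b \<in> C" unfolding C_def using character_0(1) by force
  qed
  moreover have "\<exists>a\<in>A. \<phi>' c = \<phi> a * t (c - a)" if cC: "c \<in> C" for c
  proof -
    obtain a b where c: "c = a + b" "a \<in> A" "b \<in> B" using cC unfolding C_def by blast
    show ?thesis using pA[OF c(2,3)] unfolding c(1) \<phi>'_def by blast
  qed
  ultimately show thesis using A0 B0 by (intro that[of C \<phi>']) simp_all
qed

end

lemma axis_param_in_torus:
  assumes "(c::real) \<noteq> 0"
  shows "(\<lambda>m. c powi (m $ i)) \<in> torus"
  using assms by (simp add: torus_iff power_int_add)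

lemma axis_line_eq: "(\<And>j. j \<noteq> i \<Longrightarrow> b $ j = 0) \<Longrightarrow> b = zsmul (b $ i) (axis i 1)"
  by (auto simp: vec_eq_iff zsmul_def axis_def)

text \<open>The unit vectors generate the lattice and are adjoined one at a time.
  \<open>Good\<close> is an invariant, so the same induction serves different kinds of
  extension.\<close>

lemma extend_character_all:
  fixes Good :: "(int ^ 'n) set \<Rightarrow> (int ^ 'n \<Rightarrow> real) \<Rightarrow> bool"
  assumes ch: "character_on A \<phi>" and good: "Good A \<phi>"
    and step: "\<And>A \<phi> i. character_on A \<phi> \<Longrightarrow> Good A \<phi> \<Longrightarrow> \<exists>A' \<phi>'. character_on A' \<phi>' \<and> Good A' \<phi>' \<and>
      A \<subseteq> A' \<and> axis i 1 \<in> A' \<and> (\<forall>a\<in>A. \<phi>' a = \<phi> a)"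
  obtains t where "t \<in> torus" "Good UNIV t" "\<forall>a\<in>A. t a = \<phi> a"
proof -
  have "\<exists>A' \<phi>'. character_on A' \<phi>' \<and> Good A' \<phi>' \<and> A \<subseteq> A' \<and> (\<forall>i\<in>I. axis i 1 \<in> A') \<and> (\<forall>a\<in>A. \<phi>' a = \<phi> a)"
    if "finite I" for I :: "'n set"
    using that
  proof (induction I rule: finite_induct)
    case empty
    then show ?case using ch good by auto
  next
    case (insert i I)
    then obtain B \<psi> where B: "character_on B \<psi>" "Good B \<psi>" "A \<subseteq> B" "\<forall>i\<in>I. axis i 1 \<in> B" "\<forall>a\<in>A. \<psi> a = \<phi> a"
      by auto
    obtain B' \<psi>' where B': "character_on B' \<psi>'" "Good B' \<psi>'" "B \<subseteq> B'" "axis i 1 \<in> B'" "\<forall>b\<in>B. \<psi>' b = \<psi> b"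
      using step[OF B(1,2), of i] by blast
    have "\<forall>j\<in>insert i I. axis j 1 \<in> B'" using B(4) B'(3,4) by auto
    moreover have "\<forall>a\<in>A. \<psi>' a = \<phi> a" using B(3,5) B'(5) by auto
    moreover have "A \<subseteq> B'" using B(3) B'(3) by simp
    ultimately show ?case using B'(1,2) by blast
  qed
  from this[of UNIV] obtain B t where B: "character_on B t" "Good B t" "\<forall>i. axis i 1 \<in> B" "\<forall>a\<in>A. t a = \<phi> a"
    by auto
  have sum: "(\<Sum>i\<in>I. zsmul (m $ i) (axis i 1)) \<in> B" for m I
    by (induction I rule: infinite_finite_induct)
      (use B(3) character_0(1)[OF B(1)] character_add(1)[OF B(1)] character_zsmul[OF B(1)] in auto)
  have "m = (\<Sum>i\<in>UNIV. zsmul (m $ i) (axis i 1))" for m :: "int ^ 'n"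
    by (simp add: vec_eq_iff zsmul_def axis_def if_distrib[of "\<lambda>x. _ * x"] cong: if_cong)
  then have "B = UNIV" using sum by (metis UNIV_eq_I)
  then have "character_on UNIV t" "Good UNIV t" using B by simp_all
  then show thesis using that[of t] B(4) character_on_torus[of t] by blast
qed

text \<open>Positive reals have positive roots of every order, so nothing obstructs the extension: a
  value at one nonzero multiple of a unit vector determines the value at that vector.\<close>

lemma extend_positive_character:
  assumes "character_on A \<phi>" "\<And>a. a \<in> A \<Longrightarrow> \<phi> a > 0"
  obtains t where "t \<in> torus" "\<And>a. t a > 0" "\<And>a. a \<in> A \<Longrightarrow> t a = \<phi> a"
proof -
  have step: "\<exists>A' \<phi>'. character_on A' \<phi>' \<and> (\<forall>a\<in>A'. \<phi>' a > 0) \<and>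
      A \<subseteq> A' \<and> axis i 1 \<in> A' \<and> (\<forall>a\<in>A. \<phi>' a = \<phi> a)"
    if ch: "character_on A \<phi>" and pos: "\<forall>a\<in>A. \<phi> a > 0" for A :: "(int ^ 'a) set" and \<phi> i
  proof -
    define B where "B = {b :: int ^ 'a. \<forall>j. j \<noteq> i \<longrightarrow> b $ j = 0}"
    have B: "0 \<in> B" "\<And>a b. a \<in> B \<Longrightarrow> b \<in> B \<Longrightarrow> a - b \<in> B" "axis i 1 \<in> B"
      by (auto simp: B_def axis_def)
    have "\<exists>c>0. \<forall>b\<in>A \<inter> B. \<phi> b = c powi (b $ i)"
    proof (cases "\<exists>b\<in>A \<inter> B. b $ i \<noteq> 0")
      case False
      then have "b = 0" if "b \<in> A \<inter> B" for b using that by (auto simp: B_def vec_eq_iff)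
      then show ?thesis using character_0[OF ch] by (intro exI[of _ 1]) auto
    next
      case True
      then obtain b0 where b0: "b0 \<in> A" "b0 \<in> B" "b0 $ i \<noteq> 0" by blast
      \<comment> \<open>The root of order \<open>b0 $ i\<close>, written with logarithms because
        this order may be negative.\<close>
      define c where "c = exp (ln (\<phi> b0) / of_int (b0 $ i))"
      have "\<phi> b = c powi (b $ i)" if b: "b \<in> A" "b \<in> B" for b
      proof -
        have "zsmul (b0 $ i) b = zsmul (b $ i) b0"
          unfolding vec_eq_iff
        proof
          fix j
          show "zsmul (b0 $ i) b $ j = zsmul (b $ i) b0 $ j"
            using b(2) b0(2) by (cases "j = i") (simp_all add: B_def zsmul_def)
        qed
        then have "\<phi> b powi (b0 $ i) = \<phi> b0 powi (b $ i)"
          using character_zsmul[OF ch b(1), of "b0 $ i"] character_zsmul[OF ch b0(1), of "b $ i"] by simp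
        moreover have "ln (y powi k) = of_int k * ln y" if "y > 0" for y :: real and k
          using exp_power_int[of "ln y" k] that by (metis exp_ln ln_exp)
        ultimately have "of_int (b0 $ i) * ln (\<phi> b) = of_int (b $ i) * ln (\<phi> b0)"
          using pos b(1) b0(1) by metis
        then have "ln (\<phi> b) = of_int (b $ i) * (ln (\<phi> b0) / of_int (b0 $ i))"
          using b0(3) by (simp add: field_simps)
        then have "\<phi> b = exp (of_int (b $ i) * (ln (\<phi> b0) / of_int (b0 $ i)))"
          using pos b by (metis exp_ln)
        then show ?thesis by (simp add: c_def exp_power_int mult.commute)
      qed
      then show ?thesis by (intro exI[of _ c]) (auto simp: c_def)
    qed
    then obtain c where c: "c > 0" "\<And>b. b \<in> A \<Longrightarrow> b \<in> B \<Longrightarrow> \<phi> b = c powi (b $ i)" by blast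
    obtain C \<phi>' where C: "character_on C \<phi>'" "A \<subseteq> C" "B \<subseteq> C" "\<forall>a\<in>A. \<phi>' a = \<phi> a"
      "\<forall>b\<in>B. \<phi>' b = c powi (b $ i)"
      "\<forall>d\<in>C. \<exists>a\<in>A. \<phi>' d = \<phi> a * c powi ((d - a) $ i)"
      by (rule character_amalgam[OF ch axis_param_in_torus[of c i] B(1,2) c(2)]) (use c(1) in auto)
    have "\<forall>d\<in>C. \<phi>' d > 0" using C(6) pos c(1) by (metis mult_pos_pos zero_less_power_int)
    then show ?thesis using C(1,2,3,4) B(3) by (intro exI[of _ C] exI[of _ \<phi>']) auto
  qed
  have "\<forall>a\<in>A. \<phi> a > 0" using assms(2) by blast
  then obtain t where t: "t \<in> torus" "\<forall>a\<in>UNIV. t a > 0" "\<forall>a\<in>A. t a = \<phi> a"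
    by (rule extend_character_all[of A \<phi> "\<lambda>A \<phi>. \<forall>a\<in>A. \<phi> a > 0", OF assms(1) _ step])
  show thesis by (rule that[of t]) (use t in simp_all)
qed

text \<open>The sign obstruction vanishes once the character is positive on the even vectors: adjoining \<open>e\<close>, either
  \<open>e\<close> already belongs to the domain or only its even multiples do.\<close>

lemma extend_character_positive_on_even:
  assumes "character_on A \<phi>" "\<And>m. m + m \<in> A \<and> \<phi> (m + m) > 0"
  obtains t where "t \<in> torus" "\<And>a. a \<in> A \<Longrightarrow> t a = \<phi> a"
proof -
  have step: "\<exists>A' \<phi>'. character_on A' \<phi>' \<and> (\<forall>m. m + m \<in> A' \<and> \<phi>' (m + m) > 0) \<and>
      A \<subseteq> A' \<and> axis i 1 \<in> A' \<and> (\<forall>a\<in>A. \<phi>' a = \<phi> a)"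
    if ch: "character_on A \<phi>" and even: "\<forall>m. m + m \<in> A \<and> \<phi> (m + m) > 0" for A :: "(int ^ 'a) set" and \<phi> i
  proof -
    define B where "B = {b :: int ^ 'a. \<forall>j. j \<noteq> i \<longrightarrow> b $ j = 0}"
    let ?e = "axis i 1 :: int ^ 'a"
    have B: "0 \<in> B" "\<And>a b. a \<in> B \<Longrightarrow> b \<in> B \<Longrightarrow> a - b \<in> B" "?e \<in> B"
      by (auto simp: B_def axis_def)
    have line: "b = zsmul (b $ i) ?e" if "b \<in> B" for b
      using that by (intro axis_line_eq) (simp add: B_def)
    have "\<exists>c. c \<noteq> 0 \<and> (\<forall>b\<in>A \<inter> B. \<phi> b = c powi (b $ i))"
    proof (cases "?e \<in> A")
      case True
      have "\<phi> b = \<phi> ?e powi (b $ i)" if "b \<in> A \<inter> B" for b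
        using character_zsmul[OF ch True, of "b $ i"] line that by (metis IntD2)
      then show ?thesis using character_nonzero[OF ch True] by blast
    next
      case False
      \<comment> \<open>\<open>A\<close> contains only even multiples of \<open>?e\<close> here, so
        the square root of the positive value at \<open>?e + ?e\<close> reproduces
        \<open>\<phi>\<close> on them.\<close>
      define c where "c = sqrt (\<phi> (?e + ?e))"
      have c: "c > 0" "c * c = \<phi> (?e + ?e)" using even[rule_format, of ?e] by (auto simp: c_def)
      have "\<phi> b = c powi (b $ i)" if b: "b \<in> A" "b \<in> B" for b
      proof -
        have ee: "?e + ?e = zsmul 2 ?e" using zsmul_add[of 1 1 ?e] by simp
        have "even (b $ i)"
        proof (rule ccontr)
          assume "odd (b $ i)"
          then obtain j where j: "b $ i = 2 * j + 1" by (elim oddE)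
          then have "b = zsmul j (?e + ?e) + ?e"
            using line[OF b(2)] by (simp add: zsmul_add ee zsmul_zsmul mult.commute)
          then have "?e = b - zsmul j (?e + ?e)" by simp
          then have "?e \<in> A" using character_diff(1)[OF ch b(1)] character_zsmul[OF ch] even by metis
          then show False using False by blast
        qed
        then obtain j where j: "b $ i = 2 * j" by (elim evenE)
        then have "b = zsmul j (?e + ?e)" using line[OF b(2)] by (simp add: ee zsmul_zsmul mult.commute)
        then have "\<phi> b = (c * c) powi j" using character_zsmul[OF ch, of "?e + ?e" j] even c(2) by metis
        also have "\<dots> = c powi (b $ i)"
          using c(1) by (simp add: j power_int_mult power2_eq_square)
        finally show ?thesis .
      qed
      then show ?thesis using c(1) by (intro exI[of _ c]) auto
    qed
    then obtain c where c: "c \<noteq> 0" "\<And>b. b \<in> A \<Longrightarrow> b \<in> B \<Longrightarrow> \<phi> b = c powi (b $ i)" by blast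
    obtain C \<phi>' where C: "character_on C \<phi>'" "A \<subseteq> C" "B \<subseteq> C" "\<forall>a\<in>A. \<phi>' a = \<phi> a"
      "\<forall>b\<in>B. \<phi>' b = c powi (b $ i)"
      "\<forall>d\<in>C. \<exists>a\<in>A. \<phi>' d = \<phi> a * c powi ((d - a) $ i)"
      by (rule character_amalgam[OF ch axis_param_in_torus[OF c(1), of i] B(1,2) c(2)])
    have "m + m \<in> C \<and> \<phi>' (m + m) > 0" for m using even[rule_format, of m] C(2,4) by auto
    moreover have "?e \<in> C" using C(3) B(3) by blast
    ultimately show ?thesis using C(1,2,4) by (intro exI[of _ C] exI[of _ \<phi>'] conjI) simp_all
  qed
  have "\<forall>m. m + m \<in> A \<and> \<phi> (m + m) > 0" using assms(2) by blast
  then obtain t where t: "t \<in> torus" "\<forall>a\<in>A. t a = \<phi> a"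
    by (rule extend_character_all[of A \<phi> "\<lambda>A \<phi>. \<forall>m. m + m \<in> A \<and> \<phi> (m + m) > 0", OF assms(1) _ step])
  show thesis by (rule that[of t]) (use t in simp_all)
qed

text \<open>First extend the absolute value; this prescribes positive values on the even vectors,
  compatible with \<open>\<phi>\<close> because \<open>A\<close> is saturated.\<close>

lemma extend_character_saturated:
  assumes ch: "character_on A \<phi>" and sat: "\<And>m. m + m \<in> A \<Longrightarrow> m \<in> A"
  obtains t where "t \<in> torus" "\<And>a. a \<in> A \<Longrightarrow> t a = \<phi> a"
proof -
  have "character_on A (\<lambda>a. \<bar>\<phi> a\<bar>)" using ch by (simp add: character_on_def abs_mult)
  from extend_positive_character[OF this]
  obtain \<psi> where \<psi>: "\<psi> \<in> torus" "\<And>a. \<psi> a > 0" "\<And>a. a \<in> A \<Longrightarrow> \<psi> a = \<bar>\<phi> a\<bar>"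
    using character_nonzero[OF ch] by (metis zero_less_abs_iff)
  define B where "B = {m + m | m :: int ^ 'a. True}"
  have "(0 :: int ^ 'a) = 0 + 0" by simp
  then have B0: "0 \<in> B" unfolding B_def by blast
  have Bd: "a - b \<in> B" if ab: "a \<in> B" "b \<in> B" for a b
  proof -
    obtain m k where "a = m + m" "b = k + k" using ab unfolding B_def by blast
    then have "a - b = (m - k) + (m - k)" by simp
    then show ?thesis unfolding B_def by blast
  qed
  have agree: "\<phi> b = \<psi> b" if b: "b \<in> A" "b \<in> B" for b
  proof -
    obtain m where m: "b = m + m" using b(2) unfolding B_def by blast
    then have mA: "m \<in> A" using sat b(1) by blast
    show ?thesis
      unfolding m character_add(2)[OF ch mA mA] torus_add[OF \<psi>(1)] \<psi>(3)[OF mA] by simp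
  qed
  obtain C \<phi>' where C: "character_on C \<phi>'" "A \<subseteq> C" "B \<subseteq> C" "\<forall>a\<in>A. \<phi>' a = \<phi> a" "\<forall>b\<in>B. \<phi>' b = \<psi> b"
    "\<forall>d\<in>C. \<exists>a\<in>A. \<phi>' d = \<phi> a * \<psi> (d - a)"
    by (rule character_amalgam[OF ch \<psi>(1) B0 Bd agree])
  have "m + m \<in> C \<and> \<phi>' (m + m) > 0" for m
  proof -
    have "m + m \<in> B" unfolding B_def by blast
    then show ?thesis using C(3,5) \<psi>(2)[of "m + m"] by auto
  qed
  from extend_character_positive_on_even[OF C(1) this]
  obtain t where t: "t \<in> torus" "\<And>a. a \<in> C \<Longrightarrow> t a = \<phi>' a" by metis
  show thesis by (rule that[OF t(1)]) (use t(2) C(2,4) in auto)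
qed

section \<open>Density of the real torus\<close>

text \<open>The characters that do not vanish at \<open>x\<close> generate a group \<open>H\<close>
  to which \<open>x\<close> extends multiplicatively. \<open>H\<close> is saturated because
  \<open>cone_monoid \<tau>\<close> is, so signs do not obstruct a further extension to the
  lattice.\<close>

lemma torus_part_of_point:
  fixes x :: "int ^ 'n \<Rightarrow> real"
  assumes x: "x \<in> aff_points \<tau>"
  obtains t where "t \<in> torus" "\<And>m. m \<in> cone_monoid \<tau> \<Longrightarrow> x m \<noteq> 0 \<Longrightarrow> t m = x m"
proof -
  define F where "F = {m \<in> cone_monoid \<tau>. x m \<noteq> 0}"
  have F0: "0 \<in> F" using aff_points_0[OF x] by (simp add: F_def)
  have Fadd: "a + b \<in> F" if "a \<in> F" "b \<in> F" for a b
    using that aff_points_add[OF x] by (simp add: F_def cone_monoid_add)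
  define H where "H = {a - b | a b. a \<in> F \<and> b \<in> F}"
  define q where "q h = (SOME p. fst p \<in> F \<and> snd p \<in> F \<and> h = fst p - snd p)" for h
  define \<phi> where "\<phi> h = x (fst (q h)) / x (snd (q h))" for h
  have \<phi>: "\<phi> (a - b) = x a / x b" if ab: "a \<in> F" "b \<in> F" for a b
  proof -
    have "fst (q (a - b)) \<in> F \<and> snd (q (a - b)) \<in> F \<and> a - b = fst (q (a - b)) - snd (q (a - b))"
      unfolding q_def by (rule someI[of _ "(a, b)"]) (use ab in simp)
    then obtain c d where cd: "q (a - b) = (c, d)" "c \<in> F" "d \<in> F" "a - b = c - d"
      by (metis prod.collapse)
    then have "a + d = c + b" by (simp add: algebra_simps)
    then have "x a * x d = x c * x b"
      using aff_points_add[OF x] ab cd(2,3) unfolding F_def by (metis (no_types, lifting) mem_Collect_eq)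
    then show ?thesis using ab cd(2,3) by (simp add: \<phi>_def cd(1) F_def field_simps)
  qed
  have "character_on H \<phi>"
    unfolding character_on_def
  proof (intro conjI ballI)
    show "0 \<in> H" unfolding H_def using F0 by force
  next
    fix h k assume "h \<in> H" "k \<in> H"
    then obtain a b c d where h: "h = a - b" "a \<in> F" "b \<in> F" and k: "k = c - d" "c \<in> F" "d \<in> F"
      unfolding H_def by blast
    have "h - k = (a + d) - (b + c)" using h k by simp
    then show "h - k \<in> H" unfolding H_def using Fadd h k by blast
    have "h + k = (a + c) - (b + d)" using h k by simp
    then have "\<phi> (h + k) = x (a + c) / x (b + d)" using \<phi>[OF Fadd[OF h(2) k(2)] Fadd[OF h(3) k(3)]] by simp
    also have "\<dots> = \<phi> h * \<phi> k"
      unfolding h(1) k(1) \<phi>[OF h(2,3)] \<phi>[OF k(2,3)]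
      using aff_points_add[OF x] h k by (simp add: F_def)
    finally show "\<phi> (h + k) = \<phi> h * \<phi> k" .
  next
    fix h assume "h \<in> H"
    then obtain a b where h: "h = a - b" "a \<in> F" "b \<in> F" unfolding H_def by blast
    show "\<phi> h \<noteq> 0" unfolding h(1) \<phi>[OF h(2,3)] using h by (simp add: F_def)
  qed
  moreover have "m \<in> H" if "m + m \<in> H" for m
  proof -
    obtain a b where ab: "m + m = a - b" "a \<in> F" "b \<in> F" using \<open>m + m \<in> H\<close> unfolding H_def by blast
    \<comment> \<open>\<open>m + b\<close> is half of \<open>a + b\<close>: the inequalities of the
      cone monoid can be halved, and a number with nonzero square is nonzero, so
      \<open>m + b\<close> lies in \<open>F\<close>.\<close>
    have eq: "(m + b) + (m + b) = a + b" using ab(1) by (simp add: algebra_simps)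
    have abF: "a + b \<in> F" by (rule Fadd[OF ab(2,3)])
    have "0 \<le> lattice_vec (m + b) \<bullet> u" if "u \<in> \<tau>" for u
    proof -
      have "a + b \<in> cone_monoid \<tau>" using abF by (simp add: F_def)
      then have "0 \<le> lattice_vec (a + b) \<bullet> u" using that by (rule cone_monoid_nonneg)
      then have "0 \<le> lattice_vec (m + b) \<bullet> u + lattice_vec (m + b) \<bullet> u"
        unfolding eq[symmetric] lattice_vec_add[of "m + b" "m + b"] inner_add_left[of "lattice_vec (m + b)" "lattice_vec (m + b)"] .
      then show ?thesis by simp
    qed
    then have mb: "m + b \<in> cone_monoid \<tau>" by (simp add: cone_monoid_def)
    then have "x (m + b) * x (m + b) = x (a + b)" using aff_points_add[OF x mb mb] eq by simp
    then have "m + b \<in> F" using mb abF by (auto simp: F_def)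
    moreover have "m = (m + b) - b" by simp
    ultimately show "m \<in> H" unfolding H_def using ab(3) by blast
  qed
  ultimately obtain t where t: "t \<in> torus" "\<And>h. h \<in> H \<Longrightarrow> t h = \<phi> h"
    using extend_character_saturated by metis
  have "t m = x m" if "m \<in> cone_monoid \<tau>" "x m \<noteq> 0" for m
  proof -
    have m: "m \<in> F" using that by (simp add: F_def)
    then have "m - 0 \<in> H" unfolding H_def using F0 by blast
    then show ?thesis using t(2)[of "m - 0"] \<phi>[OF m F0] aff_points_0[OF x] by simp
  qed
  then show thesis using that t(1) by blast
qed

text \<open>\<open>M\<close> is a large multiple of a sum of characters, one positive on each
  generator where \<open>m\<close> is negative and all nonvanishing at \<open>x\<close>. Near
  \<open>x\<close>, \<open>m\<close> is then the quotient of \<open>m + M\<close> by the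
  nonvanishing \<open>M\<close>.\<close>

lemma absorb_negative:
  assumes G: "finite G" "\<tau> = convex_cone hull (lattice_vec ` G)" and x: "x \<in> aff_points \<tau>"
    and neg: "\<And>g. g \<in> G \<Longrightarrow> pairing m g < 0 \<Longrightarrow> \<exists>k\<in>cone_monoid \<tau>. x k \<noteq> 0 \<and> pairing k g > 0"
  obtains M where "M \<in> cone_monoid \<tau>" "x M \<noteq> 0" "m + M \<in> cone_monoid \<tau>"
proof -
  define G' where "G' = {g \<in> G. pairing m g < 0}"
  have G': "finite G'" "G' \<subseteq> G" using G(1) by (auto simp: G'_def)
  have "\<forall>g\<in>G'. \<exists>k. k \<in> cone_monoid \<tau> \<and> x k \<noteq> 0 \<and> pairing k g > 0"
    using neg by (auto simp: G'_def)
  then obtain f where f: "\<And>g. g \<in> G' \<Longrightarrow> f g \<in> cone_monoid \<tau>" "\<And>g. g \<in> G' \<Longrightarrow> x (f g) \<noteq> 0"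
      "\<And>g. g \<in> G' \<Longrightarrow> pairing (f g) g > 0" by metis
  have pos: "pairing k g \<ge> 0" if "k \<in> cone_monoid \<tau>" "g \<in> G" for k g
    using that cone_monoid_hull[of k G] G(2) by auto
  define N where "N = nat (\<Sum>g\<in>G. \<bar>pairing m g\<bar>)"
  define M where "M = nsmul N (\<Sum>g\<in>G'. f g)"
  have sm: "(\<Sum>g\<in>G'. f g) \<in> cone_monoid \<tau>" by (rule cone_monoid_sum[OF f(1)])
  then have Mm: "M \<in> cone_monoid \<tau>" unfolding M_def by (rule cone_monoid_nsmul)
  have "x (\<Sum>g\<in>G'. f g) \<noteq> 0" using aff_points_sum[OF G'(1) x f(1)] f(2) G'(1) by simp
  then have xM: "x M \<noteq> 0" unfolding M_def using aff_points_nsmul[OF x sm] by simp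
  have psum: "pairing (\<Sum>i\<in>I. a i) g = (\<Sum>i\<in>I. pairing (a i) g)" for a :: "int ^ 'a \<Rightarrow> int ^ 'a" and I g
    by (induction I rule: infinite_finite_induct) (simp_all add: pairing_add_left)
  have pM: "pairing M g = int N * (\<Sum>h\<in>G'. pairing (f h) g)" for g
  proof -
    have "pairing (nsmul N a) g = int N * pairing a g" for a
      by (simp add: pairing_def nsmul_def sum_distrib_left mult.assoc)
    then show ?thesis unfolding M_def by (simp add: psum)
  qed
  have "m + M \<in> cone_monoid \<tau>"
    unfolding G(2) cone_monoid_hull
  proof
    fix g assume g: "g \<in> G"
    show "0 \<le> pairing (m + M) g"
    proof (cases "g \<in> G'")
      case False
      then show ?thesis using pos[OF Mm g] g by (simp add: G'_def pairing_add_left)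
    next
      case True
      then have "1 \<le> pairing (f g) g" using f(3)[of g] by simp
      also have "\<dots> \<le> (\<Sum>h\<in>G'. pairing (f h) g)"
        using True G'(1) f(1) g by (intro member_le_sum[of g]) (auto intro!: pos)
      finally have "int N * 1 \<le> int N * (\<Sum>h\<in>G'. pairing (f h) g)" by (intro mult_left_mono) auto
      moreover have "\<bar>pairing m g\<bar> \<le> int N"
        using g G(1) member_le_sum[of g G "\<lambda>g. \<bar>pairing m g\<bar>"] by (simp add: N_def)
      ultimately show ?thesis unfolding pairing_add_left pM by linarith
    qed
  qed
  then show thesis using that Mm xM by blast
qed

text \<open>\<open>u\<close> is the sum of the generators orthogonal to all characters that survive
  at \<open>x\<close>, a point in the relative interior of the face whose orbit contains
  \<open>x\<close>.\<close>

lemma supporting_direction: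
  fixes x :: "int ^ 'n \<Rightarrow> real"
  assumes "rational_polyhedral_cone \<tau>" and x: "x \<in> aff_points \<tau>"
  obtains u where "\<And>m. m \<in> cone_monoid \<tau> \<Longrightarrow> x m \<noteq> 0 \<Longrightarrow> lattice_vec m \<bullet> u = 0"
    "\<And>m. m \<in> cone_monoid \<tau> \<Longrightarrow> x m = 0 \<Longrightarrow> lattice_vec m \<bullet> u > 0"
proof -
  obtain G where G: "finite G" "\<tau> = convex_cone hull (lattice_vec ` G)"
    using assms by (auto simp: rational_polyhedral_cone_def)
  define F where "F = {m \<in> cone_monoid \<tau>. x m \<noteq> 0}"
  define G0 where "G0 = {g \<in> G. \<forall>m\<in>F. pairing m g = 0}"
  have G0: "finite G0" "G0 \<subseteq> G" using G(1) by (auto simp: G0_def)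
  have pos: "pairing m g \<ge> 0" if "m \<in> cone_monoid \<tau>" "g \<in> G" for m g
    using that cone_monoid_hull[of m G] G(2) by auto
  define u where "u = (\<Sum>g\<in>G0. lattice_vec g)"
  have pu: "lattice_vec m \<bullet> u = of_int (\<Sum>g\<in>G0. pairing m g)" for m
    by (simp add: u_def inner_sum_right inner_lattice_vec)
  show thesis
  proof
    fix m assume m: "m \<in> cone_monoid \<tau>" "x m \<noteq> 0"
    then have "m \<in> F" by (simp add: F_def)
    then have "(\<Sum>g\<in>G0. pairing m g) = 0" by (intro sum.neutral) (simp add: G0_def)
    then show "lattice_vec m \<bullet> u = 0" by (simp add: pu)
  next
    fix m assume m: "m \<in> cone_monoid \<tau>" "x m = 0"
    show "lattice_vec m \<bullet> u > 0"
    proof (rule ccontr)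
      assume "\<not> ?thesis"
      then have "(\<Sum>g\<in>G0. pairing m g) \<le> 0" by (simp add: pu not_less del: of_int_sum)
      moreover have "\<And>g. g \<in> G0 \<Longrightarrow> 0 \<le> pairing m g" using pos[OF m(1)] G0(2) by blast
      ultimately have zero: "pairing m g = 0" if "g \<in> G0" for g
        using that G0(1) by (metis antisym sum_nonneg sum_nonneg_eq_0_iff)
      have m0: "pairing m g = - pairing (- m) g" for g by (simp add: pairing_def sum_negf)
      have "\<exists>k\<in>cone_monoid \<tau>. x k \<noteq> 0 \<and> pairing k g > 0" if g: "g \<in> G" "pairing (- m) g < 0" for g
      proof -
        have "g \<notin> G0" using zero[of g] g(2) m0[of g] by auto
        then obtain k where k: "k \<in> F" "pairing k g \<noteq> 0" using g(1) by (auto simp: G0_def)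
        then have "pairing k g > 0" using pos[of k g] g(1) by (simp add: F_def)
        then show ?thesis using k(1) by (auto simp: F_def)
      qed
      \<comment> \<open>If the inner product were 0, \<open>- m\<close> could be absorbed as well,
        so \<open>m\<close> would be invertible at \<open>x\<close> and \<open>x m\<close> could not
        be 0.\<close>
      then obtain M where M: "M \<in> cone_monoid \<tau>" "x M \<noteq> 0" "- m + M \<in> cone_monoid \<tau>"
        by (rule absorb_negative[OF G x])
      have "x (- m + M + m) = x (- m + M) * x m" by (rule aff_points_add[OF x M(3) m(1)])
      then show False using M(2) m(2) by simp
    qed
  qed
qed

text \<open>Extend the nonzero values of \<open>x\<close> to a real torus point and move it in the
  direction \<open>u\<close>: the nonzero values stay fixed and the remaining characters tend to
  0.\<close>

lemma real_torus_dense: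
  fixes x :: "int ^ 'n \<Rightarrow> real"
  assumes rp: "rational_polyhedral_cone \<tau>" and x: "x \<in> aff_points \<tau>" and W: "open W" "x \<in> W"
  obtains t where "t \<in> torus" "(\<lambda>m. if m \<in> cone_monoid \<tau> then t m else 0) \<in> W"
proof -
  obtain t where t: "t \<in> torus" "\<And>m. m \<in> cone_monoid \<tau> \<Longrightarrow> x m \<noteq> 0 \<Longrightarrow> t m = x m"
    using torus_part_of_point[OF x] by blast
  obtain u where u: "\<And>m. m \<in> cone_monoid \<tau> \<Longrightarrow> x m \<noteq> 0 \<Longrightarrow> lattice_vec m \<bullet> u = 0"
    "\<And>m. m \<in> cone_monoid \<tau> \<Longrightarrow> x m = 0 \<Longrightarrow> lattice_vec m \<bullet> u > 0"
    using supporting_direction[OF rp x] by blast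
  define s where "s j = (\<lambda>m. t m * exp_torus (real j *\<^sub>R u) m)" for j :: nat
  define r where "r j = (\<lambda>m. if m \<in> cone_monoid \<tau> then s j m else 0)" for j
  have lim: "(\<lambda>j. r j m) \<longlonglongrightarrow> x m" for m
  proof (cases "m \<in> cone_monoid \<tau>")
    case True
    show ?thesis
    proof (cases "x m = 0")
      case True
      then have pos: "lattice_vec m \<bullet> u > 0" using u \<open>m \<in> cone_monoid \<tau>\<close> by simp
      have "(\<lambda>j. exp (- (lattice_vec m \<bullet> u)) ^ j) \<longlonglongrightarrow> 0"
        using pos by (intro LIMSEQ_realpow_zero) auto
      from tendsto_mult[OF tendsto_const[of "t m"] this] show ?thesis
        using True \<open>m \<in> cone_monoid \<tau>\<close> by (simp add: r_def s_def exp_torus_def exp_of_nat_mult[symmetric])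
    next
      case False
      then show ?thesis using u(1)[OF \<open>m \<in> cone_monoid \<tau>\<close>] t(2)[OF \<open>m \<in> cone_monoid \<tau>\<close>] \<open>m \<in> cone_monoid \<tau>\<close>
        by (simp add: r_def s_def exp_torus_def)
    qed
  qed (simp add: r_def aff_points_outside[OF x])
  \<comment> \<open>Basic neighbourhoods constrain finitely many coordinates, so pointwise
    convergence suffices.\<close>
  obtain X where X: "x \<in> (\<Pi>\<^sub>E i\<in>UNIV. X i)" "\<And>i. open (X i)" "finite {i. X i \<noteq> UNIV}" "(\<Pi>\<^sub>E i\<in>UNIV. X i) \<subseteq> W"
    using product_topology_open_contains_basis[of "\<lambda>_. euclidean" UNIV W x] W
    by (auto simp: euclidean_product_topology open_openin[symmetric])
  have "eventually (\<lambda>j. \<forall>i\<in>{i. X i \<noteq> UNIV}. r j i \<in> X i) sequentially"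
  proof (intro eventually_ball_finite X(3) ballI)
    fix i
    show "eventually (\<lambda>j. r j i \<in> X i) sequentially"
      using X(1,2) by (intro topological_tendstoD[OF lim]) auto
  qed
  then obtain j where "\<forall>i\<in>{i. X i \<noteq> UNIV}. r j i \<in> X i"
    using eventually_happens'[OF sequentially_bot] by blast
  then have "r j \<in> (\<Pi>\<^sub>E i\<in>UNIV. X i)" by force
  then have "r j \<in> W" using X(4) by blast
  moreover have "s j \<in> torus" unfolding s_def by (rule torus_mult[OF t(1) exp_torus_in_torus])
  ultimately show thesis using that unfolding r_def by blast
qed

section \<open>Bounded characters\<close>

lemma torus_prod:
  fixes r :: "int ^ 'n \<Rightarrow> real"
  assumes r: "r \<in> torus"
  shows "r m = (\<Prod>i\<in>UNIV. r (axis i 1) powi (m $ i))"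
proof -
  have "m = (\<Sum>i\<in>UNIV. zsmul (m $ i) (axis i 1))"
    by (simp add: vec_eq_iff zsmul_def axis_def if_distrib[of "\<lambda>x. _ * x"] cong: if_cong)
  then have "r m = r (\<Sum>i\<in>UNIV. zsmul (m $ i) (axis i 1))" by simp
  also have "\<dots> = (\<Prod>i\<in>UNIV. r (zsmul (m $ i) (axis i 1)))"
    by (rule aff_points_sum[OF _ r]) simp_all
  also have "\<dots> = (\<Prod>i\<in>UNIV. r (axis i 1) powi (m $ i))"
    using r character_zsmul[of UNIV r] by (simp add: character_on_torus)
  finally show ?thesis .
qed

lemma positive_torus_log:
  fixes r :: "int ^ 'n \<Rightarrow> real"
  assumes r: "r \<in> torus" and pos: "\<And>m. r m > 0"
  obtains L where "r = exp_torus L"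
proof
  define L :: "real ^ 'n" where "L = (\<chi> i. - ln (r (axis i 1)))"
  have ax: "exp_torus L (axis i 1) = r (axis i 1)" for i
  proof -
    have "lattice_vec (axis i 1) = axis i 1" by (simp add: vec_eq_iff axis_def)
    then show ?thesis using pos by (simp add: exp_torus_def L_def inner_axis')
  qed
  show "r = exp_torus L"
  proof
    fix m
    show "r m = exp_torus L m"
      unfolding torus_prod[OF r, of m] torus_prod[OF exp_torus_in_torus, of L m] ax ..
  qed
qed

text \<open>Tychonoff's theorem for a product of unit discs indexed by the lattice; the defining
  equations of a point are closed conditions, and coordinates outside
  \<open>cone_monoid \<tau>\<close> are 0.\<close>

lemma compact_bounded_points:
  "compact {x :: int ^ 'n \<Rightarrow> complex. x \<in> aff_points \<tau> \<and> (\<forall>k\<in>cone_monoid \<tau>. norm (x k) \<le> 1)}" (is "compact ?K")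
proof -
  let ?P = "{x :: int ^ 'n \<Rightarrow> complex. \<forall>k. norm (x k) \<le> 1}"
  let ?C = "aff_points \<tau> :: (int ^ 'n \<Rightarrow> complex) set"
  have "compactin (product_topology (\<lambda>_. euclidean) UNIV) (\<Pi>\<^sub>E k\<in>(UNIV :: (int ^ 'n) set). cball (0 :: complex) 1)"
    unfolding compactin_PiE by simp
  moreover have "(\<Pi>\<^sub>E k\<in>(UNIV :: (int ^ 'n) set). cball (0 :: complex) 1) = ?P"
    by (simp add: PiE_UNIV_domain Pi_def)
  ultimately have P: "compact ?P" by (simp only: euclidean_product_topology compactin_euclidean_iff)
  have cont: "continuous_on UNIV (\<lambda>x :: int ^ 'n \<Rightarrow> complex. x k)" for k
    by (rule continuous_on_product_coordinates)
  have 1: "closed {x :: int ^ 'n \<Rightarrow> complex. x 0 = 1}"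
    by (rule closed_Collect_eq[OF cont continuous_on_const])
  have 2: "closed {x :: int ^ 'n \<Rightarrow> complex. \<forall>a\<in>cone_monoid \<tau>. \<forall>b\<in>cone_monoid \<tau>. x (a + b) = x a * x b}"
    unfolding Ball_def
    by (intro closed_Collect_all closed_Collect_imp open_Collect_const
        closed_Collect_eq[OF cont continuous_on_mult[OF cont cont]])
  have 3: "closed {x :: int ^ 'n \<Rightarrow> complex. \<forall>m. m \<notin> cone_monoid \<tau> \<longrightarrow> x m = 0}"
    by (intro closed_Collect_all closed_Collect_imp open_Collect_const closed_Collect_eq[OF cont continuous_on_const])
  have "closed ?C"
    unfolding aff_points_def by (intro closed_Collect_conj 1 2 3)
  then have "compact (?P \<inter> ?C)" by (rule compact_Int_closed[OF P])
  moreover have "?P \<inter> ?C = ?K"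
  proof (rule set_eqI)
    fix x :: "int ^ 'n \<Rightarrow> complex"
    have "norm (x k) \<le> 1" if "x \<in> ?K" for k
      using that aff_points_outside[of x \<tau> k] by (cases "k \<in> cone_monoid \<tau>") simp_all
    then show "x \<in> ?P \<inter> ?C \<longleftrightarrow> x \<in> ?K" by blast
  qed
  ultimately show ?thesis by simp
qed

section \<open>Boundedness of characters on the set\<close>

context compatible_completion
begin

text \<open>The point of the torus of \<open>X\<close> corresponding to the real torus point \<open>r\<close> of \<open>V\<close>.\<close>

definition shifted :: "(int ^ 'n \<Rightarrow> real) \<Rightarrow> int ^ 'n \<Rightarrow> complex" where
  "shifted r = (\<lambda>m. of_real (r m) * shift m)"

definition torus_part :: "(int ^ 'n \<Rightarrow> real) set" where
  "torus_part = {r \<in> torus. (\<lambda>m. if m \<in> cone_monoid \<sigma> then r m else 0) \<in> S}"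

lemma shifted_in_torus: "r \<in> torus \<Longrightarrow> shifted r \<in> torus"
  using torus_mult[OF torus_complexify[of r] shift(1)] by (simp add: shifted_def complexify_def)

lemma shifted_real: "shifted r = complexify (\<lambda>m. r m * Re (shift m))"
  by (simp add: shifted_def complexify_def shift_eq)

lemma chart_shifted:
  assumes "r \<in> torus_part" "\<tau> \<in> \<Delta>"
  shows "chart \<Delta> \<tau> (restr \<tau> (shifted r)) \<in> (\<lambda>x. \<iota> (complexify x)) ` S"
    "chart \<Delta> \<tau> (restr \<tau> (shifted r)) \<in> real_points \<Delta>"
proof -
  let ?s = "\<lambda>m. if m \<in> cone_monoid \<sigma> then r m else 0"
  have r: "r \<in> torus" "?s \<in> S"
    using assms(1) unfolding torus_part_def by blast+
  have 1: "chart \<Delta> \<tau> (restr \<tau> (shifted r)) = chart \<Delta> {0} (shifted r)"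
    by (rule chart_torus[OF assms(2) shifted_in_torus[OF r(1)]])
  have "complexify ?s = restr \<sigma> (complexify r)" by (simp add: complexify_def restr_def fun_eq_iff)
  then have "\<iota> (complexify ?s) = \<iota> (restr \<sigma> (complexify r))" by simp
  also have "\<dots> = chart \<Delta> {0} (shifted r)"
    unfolding \<iota>_torus[OF torus_complexify[OF r(1)]] by (simp add: shifted_def complexify_def)
  finally have "chart \<Delta> \<tau> (restr \<tau> (shifted r)) = \<iota> (complexify ?s)" using 1 by simp
  then show "chart \<Delta> \<tau> (restr \<tau> (shifted r)) \<in> (\<lambda>x. \<iota> (complexify x)) ` S"
    using r(2) by (rule image_eqI)
  have "(\<lambda>m. r m * Re (shift m)) \<in> torus"
  proof -
    have "(\<lambda>m. Re (shift m)) \<in> torus"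
      unfolding torus_iff
    proof (intro conjI allI)
      show "Re (shift 0) = 1" using aff_points_0[OF shift(1)] by simp
      fix a b
      have "complex_of_real (Re (shift (a + b))) = shift a * shift b"
        unfolding shift_eq by (rule torus_add[OF shift(1)])
      also have "\<dots> = of_real (Re (shift a)) * of_real (Re (shift b))" unfolding shift_eq ..
      finally have "complex_of_real (Re (shift (a + b))) = of_real (Re (shift a) * Re (shift b))" by simp
      then show "Re (shift (a + b)) = Re (shift a) * Re (shift b)" unfolding of_real_eq_iff .
    qed
    then show ?thesis by (rule torus_mult[OF r(1)])
  qed
  then show "chart \<Delta> \<tau> (restr \<tau> (shifted r)) \<in> real_points \<Delta>"
    unfolding 1 unfolding shifted_real real_points_def by (intro UN_I[OF zero_in_fan] imageI)
qed

text \<open>Reality of all coordinates is a closed condition, so a limit taken in the complex chart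
  is again a real point of \<open>X\<close>.\<close>

lemma closure_point_in_S_closure:
  assumes \<tau>: "\<tau> \<in> \<Delta>" and x: "x \<in> aff_points \<tau>" "x \<in> closure ((\<lambda>r. restr \<tau> (shifted r)) ` D)"
    and D: "D \<subseteq> torus_part"
  shows "chart \<Delta> \<tau> x \<in> S_closure"
proof -
  let ?D = "(\<lambda>r. restr \<tau> (shifted r)) ` D"
  have "closed {x :: int ^ 'n \<Rightarrow> complex. Im (x k) = 0}" for k
    by (rule closed_Collect_eq[OF continuous_on_Im[OF continuous_on_product_coordinates] continuous_on_const])
  then have cl: "closed {x :: int ^ 'n \<Rightarrow> complex. \<forall>k. Im (x k) = 0}" by (rule closed_Collect_all)
  have "?D \<subseteq> {x. \<forall>k. Im (x k) = 0}" by (auto simp: restr_def shifted_real complexify_def)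
  from closure_minimal[OF this cl] x(2) have im: "Im (x k) = 0" for k by blast
  define x' where "x' k = Re (x k)" for k
  have xr: "x = complexify x'" by (simp add: complexify_def fun_eq_iff complex_eq_iff im x'_def)
  have x': "x' \<in> aff_points \<tau>"
    using x(1) by (simp add: aff_points_def x'_def im)
  have real: "chart \<Delta> \<tau> x \<in> real_points \<Delta>"
    unfolding xr real_points_def using x' by (intro UN_I[OF \<tau>] imageI)
  have top: "chart \<Delta> \<tau> x \<in> topspace (euclidean_toric \<Delta>)"
    using \<tau> x(1) unfolding topspace_euclidean_toric by blast
  have "\<exists>y\<in>(\<lambda>x. \<iota> (complexify x)) ` S. y \<in> T"
    if T: "chart \<Delta> \<tau> x \<in> T" "openin (subtopology (euclidean_toric \<Delta>) (real_points \<Delta>)) T" for T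
  proof -
    obtain W where W: "openin (euclidean_toric \<Delta>) W" "T = W \<inter> real_points \<Delta>"
      using T(2) unfolding openin_subtopology by blast
    obtain Q where Q: "open Q" "{y \<in> aff_points \<tau>. chart \<Delta> \<tau> y \<in> W} = aff_points \<tau> \<inter> Q"
      using openin_euclidean_toric_preimage[OF W(1) \<tau>] unfolding openin_open by blast
    have "x \<in> {y \<in> aff_points \<tau>. chart \<Delta> \<tau> y \<in> W}" using x(1) T(1) W(2) by simp
    then have "x \<in> Q" unfolding Q(2) by simp
    then have "Q \<inter> closure ?D \<noteq> {}" using x(2) by blast
    then have "Q \<inter> ?D \<noteq> {}" using open_Int_closure_eq_empty[OF Q(1)] by simp
    then obtain r where r: "r \<in> D" "restr \<tau> (shifted r) \<in> Q" by auto
    have rT: "r \<in> torus_part" using r(1) D by blast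
    have "restr \<tau> (shifted r) \<in> aff_points \<tau>"
      using rT restr_in_aff_points[OF zero_subset[OF \<tau>] shifted_in_torus] by (simp add: torus_part_def)
    then have "restr \<tau> (shifted r) \<in> {y \<in> aff_points \<tau>. chart \<Delta> \<tau> y \<in> W}" unfolding Q(2) using r(2) by simp
    then have "chart \<Delta> \<tau> (restr \<tau> (shifted r)) \<in> T" using chart_shifted(2)[OF rT \<tau>] W(2) by simp
    then show ?thesis using chart_shifted(1)[OF rT \<tau>] by blast
  qed
  then show ?thesis
    unfolding S_closure_def in_closure_of topspace_subtopology using real top by simp
qed

text \<open>Near a point of the compact chart, \<open>m\<close> is a quotient of a bounded character by one bounded away from \<open>0\<close>:
  the rays on which \<open>m\<close> is negative do not belong to boundary divisors through the point.\<close>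

lemma locally_bounded:
  assumes \<tau>: "\<tau> \<in> \<Delta>" and G: "finite G" "\<tau> = convex_cone hull (lattice_vec ` G)"
    and m: "m \<in> cone_monoid \<sigma>"
    and good: "\<And>g. g \<in> G \<Longrightarrow> boundary_direction (lattice_vec g) \<Longrightarrow> meets (lattice_vec g) \<Longrightarrow> pairing m g \<ge> 0"
    and D: "D \<subseteq> torus_part" "\<And>r k. r \<in> D \<Longrightarrow> k \<in> cone_monoid \<tau> \<Longrightarrow> norm (shifted r k) \<le> 1"
    and x: "x \<in> aff_points \<tau>"
  shows "\<exists>N B. open N \<and> x \<in> N \<and> (\<forall>r\<in>D. restr \<tau> (shifted r) \<in> N \<longrightarrow> norm (shifted r m) \<le> B)"
proof (cases "x \<in> closure ((\<lambda>r. restr \<tau> (shifted r)) ` D)")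
  case False
  \<comment> \<open>Off the closure a neighbourhood contains no point coming from \<open>D\<close>,
    so any bound will do.\<close>
  then show ?thesis
    using closure_subset[of "(\<lambda>r. restr \<tau> (shifted r)) ` D"]
    by (intro exI[of _ "- closure ((\<lambda>r. restr \<tau> (shifted r)) ` D)"] exI[of _ 0]) auto
next
  case True
  have cl: "chart \<Delta> \<tau> x \<in> S_closure" by (rule closure_point_in_S_closure[OF \<tau> x True D(1)])
  have "\<exists>k\<in>cone_monoid \<tau>. x k \<noteq> 0 \<and> pairing k g > 0" if g: "g \<in> G" "pairing m g < 0" for g
  proof -
    have g\<tau>: "lattice_vec g \<in> \<tau>" using g(1) G(2) by (simp add: hull_inc)
    have "boundary_direction (lattice_vec g)" using m g(2) unfolding boundary_direction_def by (auto simp: inner_lattice_vec)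
    then have "\<not> meets (lattice_vec g)" using good[OF g(1)] g(2) by auto
    then have "x \<notin> limit_locus \<tau> (lattice_vec g)" using \<tau> g\<tau> cl unfolding meets_def by blast
    then show ?thesis using x unfolding limit_locus_def by (auto simp: inner_lattice_vec)
  qed
  then obtain M where M: "M \<in> cone_monoid \<tau>" "x M \<noteq> 0" "m + M \<in> cone_monoid \<tau>"
    by (rule absorb_negative[OF G x])
  define c where "c = norm (x M) / 2"
  have c: "c > 0" "c < norm (x M)" using M(2) by (auto simp: c_def)
  let ?N = "{y :: int ^ 'n \<Rightarrow> complex. c < norm (y M)}"
  have "open ?N"
    by (intro open_Collect_less continuous_on_norm continuous_on_product_coordinates continuous_on_const)
  moreover have "norm (shifted r m) \<le> 1 / c" if r: "r \<in> D" "restr \<tau> (shifted r) \<in> ?N" for r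
  proof -
    have t: "shifted r \<in> torus" using r(1) D(1) shifted_in_torus by (auto simp: torus_part_def)
    have big: "c < norm (shifted r M)" using r(2) M(1) by (simp add: restr_apply)
    have "norm (shifted r m) * norm (shifted r M) \<le> 1"
      using D(2)[OF r(1) M(3)] by (simp add: torus_add[OF t] norm_mult)
    moreover have "norm (shifted r m) * c \<le> norm (shifted r m) * norm (shifted r M)"
      using big by (intro mult_left_mono) auto
    ultimately show ?thesis using c(1) by (simp add: pos_le_divide_eq)
  qed
  ultimately show ?thesis using c(2) by (intro exI[of _ ?N] exI[of _ "1 / c"]) auto
qed

text \<open>The bounds by 1 place the torus points in the compact part of the chart, which finitely
  many neighbourhoods from \<open>locally_bounded\<close> cover.\<close>

lemma bounded_on_cone:
  assumes \<tau>: "\<tau> \<in> \<Delta>" and G: "finite G" "\<tau> = convex_cone hull (lattice_vec ` G)"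
    and m: "m \<in> cone_monoid \<sigma>"
    and good: "\<And>g. g \<in> G \<Longrightarrow> boundary_direction (lattice_vec g) \<Longrightarrow> meets (lattice_vec g) \<Longrightarrow> pairing m g \<ge> 0"
  shows "\<exists>B. \<forall>r\<in>torus_part. (\<forall>k\<in>cone_monoid \<tau>. norm (shifted r k) \<le> 1) \<longrightarrow> norm (shifted r m) \<le> B"
proof -
  define D where "D = {r \<in> torus_part. \<forall>k\<in>cone_monoid \<tau>. norm (shifted r k) \<le> 1}"
  let ?K = "{x :: int ^ 'n \<Rightarrow> complex. x \<in> aff_points \<tau> \<and> (\<forall>k\<in>cone_monoid \<tau>. norm (x k) \<le> 1)}"
  have "\<forall>x\<in>?K. \<exists>N B. open N \<and> x \<in> N \<and> (\<forall>r\<in>D. restr \<tau> (shifted r) \<in> N \<longrightarrow> norm (shifted r m) \<le> B)"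
  proof
    fix x assume "x \<in> ?K"
    then have x: "x \<in> aff_points \<tau>" by simp
    show "\<exists>N B. open N \<and> x \<in> N \<and> (\<forall>r\<in>D. restr \<tau> (shifted r) \<in> N \<longrightarrow> norm (shifted r m) \<le> B)"
      by (rule locally_bounded[OF \<tau> G m good _ _ x]) (simp_all add: D_def subset_iff)
  qed
  from bchoice[OF this] obtain N where
    "\<forall>x\<in>?K. \<exists>B. open (N x) \<and> x \<in> N x \<and> (\<forall>r\<in>D. restr \<tau> (shifted r) \<in> N x \<longrightarrow> norm (shifted r m) \<le> B)" ..
  from bchoice[OF this] obtain B where
    NB: "\<forall>x\<in>?K. open (N x) \<and> x \<in> N x \<and> (\<forall>r\<in>D. restr \<tau> (shifted r) \<in> N x \<longrightarrow> norm (shifted r m) \<le> B x)" ..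
  have opN: "open (N x)" if "x \<in> ?K" for x using NB that by blast
  have cover: "?K \<subseteq> (\<Union>x\<in>?K. N x)" using NB by blast
  obtain C where C: "C \<subseteq> ?K" "finite C" "?K \<subseteq> (\<Union>x\<in>C. N x)"
    by (rule compactE_image[OF compact_bounded_points[of \<tau>], of ?K N]) (use opN cover in blast)+
  have "norm (shifted r m) \<le> (\<Sum>x\<in>C. \<bar>B x\<bar>)" if r: "r \<in> D" for r
  proof -
    have t: "shifted r \<in> torus" using r shifted_in_torus by (auto simp: D_def torus_part_def)
    have "restr \<tau> (shifted r) \<in> ?K"
      using r restr_in_aff_points[OF zero_subset[OF \<tau>] t] by (auto simp: D_def restr_apply)
    then have "restr \<tau> (shifted r) \<in> (\<Union>x\<in>C. N x)" using C(3) by (elim subsetD)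
    then obtain x where x: "x \<in> C" "restr \<tau> (shifted r) \<in> N x" by (elim UN_E)
    have "norm (shifted r m) \<le> B x" using NB x C(1) r by blast
    also have "\<dots> \<le> \<bar>B x\<bar>" by simp
    also have "\<dots> \<le> (\<Sum>x\<in>C. \<bar>B x\<bar>)" using x(1) C(2) by (intro member_le_sum) auto
    finally show ?thesis .
  qed
  then show ?thesis unfolding D_def by blast
qed

text \<open>Since the fan is complete, the vector of logarithms of a torus point lies in some cone \<open>\<tau>\<close>,
  and then all characters in \<open>cone_monoid \<tau>\<close> are bounded by \<open>1\<close>.\<close>

lemma bounded_on_torus_part:
  assumes rays: "\<And>\<tau>. \<tau> \<in> \<Delta> \<Longrightarrow> finite (G \<tau>)" "\<And>\<tau>. \<tau> \<in> \<Delta> \<Longrightarrow> \<tau> = convex_cone hull (lattice_vec ` G \<tau>)"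
    and m: "m \<in> cone_monoid \<sigma>"
    and good: "\<And>\<tau> g. \<tau> \<in> \<Delta> \<Longrightarrow> g \<in> G \<tau> \<Longrightarrow> boundary_direction (lattice_vec g) \<Longrightarrow> meets (lattice_vec g) \<Longrightarrow> pairing m g \<ge> 0"
  shows "\<exists>c. \<forall>r\<in>torus_part. \<bar>r m\<bar> \<le> c"
proof -
  have "\<forall>\<tau>\<in>\<Delta>. \<exists>B. \<forall>r\<in>torus_part. (\<forall>k\<in>cone_monoid \<tau>. norm (shifted r k) \<le> 1) \<longrightarrow> norm (shifted r m) \<le> B"
  proof
    fix \<tau> assume \<tau>: "\<tau> \<in> \<Delta>"
    show "\<exists>B. \<forall>r\<in>torus_part. (\<forall>k\<in>cone_monoid \<tau>. norm (shifted r k) \<le> 1) \<longrightarrow> norm (shifted r m) \<le> B"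
      by (rule bounded_on_cone[OF \<tau> rays(1)[OF \<tau>] rays(2)[OF \<tau>] m good[OF \<tau>]])
  qed
  then obtain B where B: "\<And>\<tau> r. \<tau> \<in> \<Delta> \<Longrightarrow> r \<in> torus_part \<Longrightarrow> (\<forall>k\<in>cone_monoid \<tau>. norm (shifted r k) \<le> 1) \<Longrightarrow>
      norm (shifted r m) \<le> B \<tau>" by metis
  have fin: "finite \<Delta>" using fan by (simp add: fan_def)
  have "\<bar>r m\<bar> \<le> (\<Sum>\<tau>\<in>\<Delta>. \<bar>B \<tau>\<bar>) / norm (shift m)" if r: "r \<in> torus_part" for r
  proof -
    have t: "shifted r \<in> torus" using r shifted_in_torus by (auto simp: torus_part_def)
    have "(\<lambda>k. norm (shifted r k)) \<in> torus"
      using t by (simp add: torus_iff norm_mult)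
    moreover have "norm (shifted r k) > 0" for k using torus_nonzero[OF t] by simp
    ultimately obtain L where L: "(\<lambda>k. norm (shifted r k)) = exp_torus L" by (rule positive_torus_log)
    obtain \<tau> where \<tau>: "\<tau> \<in> \<Delta>" "L \<in> \<tau>" using complete_covers[OF complete] by blast
    have "norm (shifted r k) \<le> 1" if "k \<in> cone_monoid \<tau>" for k
      using fun_cong[OF L, of k] cone_monoid_nonneg[OF that \<tau>(2)] by (simp add: exp_torus_def)
    then have "norm (shifted r m) \<le> B \<tau>" using B[OF \<tau>(1) r] by blast
    also have "\<dots> \<le> \<bar>B \<tau>\<bar>" by simp
    also have "\<dots> \<le> (\<Sum>\<tau>\<in>\<Delta>. \<bar>B \<tau>\<bar>)" using \<tau>(1) fin by (intro member_le_sum) auto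
    finally have "\<bar>r m\<bar> * norm (shift m) \<le> (\<Sum>\<tau>\<in>\<Delta>. \<bar>B \<tau>\<bar>)"
      by (simp add: shifted_def norm_mult)
    then show ?thesis using torus_nonzero[OF shift(1), of m] by (simp add: pos_le_divide_eq)
  qed
  then show ?thesis by blast
qed

text \<open>A violation at \<open>s\<close> is an open condition, so it occurs in the interior of
  \<open>S\<close>, and there, by density, at a real torus point.\<close>

lemma bounded_character:
  assumes S: "S = top_of_set (aff_points \<sigma>) closure_of (top_of_set (aff_points \<sigma>) interior_of S)"
    and m: "m \<in> cone_monoid \<sigma>" and c: "\<And>r. r \<in> torus_part \<Longrightarrow> \<bar>r m\<bar> \<le> c" and s: "s \<in> S"
  shows "\<bar>s m\<bar> \<le> c"
proof (rule ccontr)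
  assume large: "\<not> \<bar>s m\<bar> \<le> c"
  let ?T = "top_of_set (aff_points \<sigma> :: (int ^ 'n \<Rightarrow> real) set)"
  define W where "W = {x :: int ^ 'n \<Rightarrow> real. c < \<bar>x m\<bar>}"
  have W: "open W" unfolding W_def
    by (intro open_Collect_less continuous_intros continuous_on_product_coordinates)
  have "s \<in> W" using large by (simp add: W_def)
  moreover have "s \<in> ?T closure_of (?T interior_of S)" using s S by simp
  moreover have "s \<in> aff_points \<sigma>" using s S_sub by blast
  moreover have "openin ?T (aff_points \<sigma> \<inter> W)" using W by (rule openin_open_Int)
  ultimately obtain y where y: "y \<in> ?T interior_of S" "y \<in> aff_points \<sigma> \<inter> W"
    unfolding in_closure_of by blast
  have "openin ?T (?T interior_of S)" by (rule openin_interior_of)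
  then obtain Q where Q: "open Q" "?T interior_of S = aff_points \<sigma> \<inter> Q" unfolding openin_open by blast
  have "y \<in> W \<inter> Q" "y \<in> aff_points \<sigma>" using y Q(2) by auto
  then obtain r where r: "r \<in> torus" "(\<lambda>m. if m \<in> cone_monoid \<sigma> then r m else 0) \<in> W \<inter> Q" (is "?r \<in> _")
    using real_torus_dense[OF \<sigma>_rational _ open_Int[OF W Q(1)]] by metis
  have "?r \<in> aff_points \<sigma>"
    using r(1) by (simp add: aff_points_def cone_monoid_add)
  then have "?r \<in> ?T interior_of S" using r(2) Q(2) by simp
  then have "?r \<in> S" using interior_of_subset[of ?T S] by blast
  then have "r \<in> torus_part" using r(1) by (simp add: torus_part_def)
  from c[OF this] have "\<bar>?r m\<bar> \<le> c" using m by simp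
  then show False using r(2) by (simp add: W_def)
qed

end

section \<open>Finiteness\<close>

text \<open>A decreasing integer sequence that is bounded below becomes constant, so a monotone
  subsequence can always be made nondecreasing.\<close>

lemma bounded_below_subseq:
  fixes s :: "nat \<Rightarrow> int"
  assumes "\<And>n. b \<le> s n"
  obtains g where "strict_mono (g :: nat \<Rightarrow> nat)" "\<And>m n. m \<le> n \<Longrightarrow> s (g m) \<le> s (g n)"
proof -
  obtain f where f: "strict_mono (f :: nat \<Rightarrow> nat)" "monoseq (\<lambda>n. s (f n))" using seq_monosub[of s] by blast
  consider (inc) "incseq (\<lambda>n. s (f n))" | (dec) "decseq (\<lambda>n. s (f n))"
    using f(2) by (auto simp: monoseq_iff)
  then show thesis
  proof cases
    case inc
    then show ?thesis using that[OF f(1)] by (auto simp: incseq_def)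
  next
    case dec
    obtain N where N: "\<And>n. nat (s (f N) - b) \<le> nat (s (f n) - b)"
      using ex_has_least_nat[of "\<lambda>_. True" 0 "\<lambda>n. nat (s (f n) - b)"] by auto
    have "s (f (N + n)) = s (f N)" for n
    proof -
      have "s (f (N + n)) \<le> s (f N)" using dec by (auto simp: decseq_def)
      moreover have "nat (s (f N) - b) \<le> nat (s (f (N + n)) - b)" by (rule N)
      ultimately show ?thesis using assms[of "f N"] assms[of "f (N + n)"] by linarith
    qed
    moreover have "strict_mono (\<lambda>n. f (N + n))" using f(1) by (simp add: strict_mono_def)
    ultimately show ?thesis using that[of "\<lambda>n. f (N + n)"] by simp
  qed
qed

text \<open>Pass to a subsequence for each \<open>j\<close> in turn; any two members of the final
  one are comparable under all \<open>h j\<close>.\<close>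

lemma dickson:
  fixes h :: "'j \<Rightarrow> 'a \<Rightarrow> int"
  assumes "finite J" "infinite X" "\<And>j. j \<in> J \<Longrightarrow> \<exists>b. \<forall>x\<in>X. b \<le> h j x"
  obtains x y where "x \<in> X" "y \<in> X" "x \<noteq> y" "\<And>j. j \<in> J \<Longrightarrow> h j x \<le> h j y"
proof -
  obtain a :: "nat \<Rightarrow> 'a" where a: "inj a" "range a \<subseteq> X"
    using assms(2) infinite_countable_subset by blast
  have "\<exists>f :: nat \<Rightarrow> nat. strict_mono f \<and> (\<forall>j\<in>J. \<forall>m n. m \<le> n \<longrightarrow> h j (a (f m)) \<le> h j (a (f n)))"
    using assms(1,3)
  proof (induction J rule: finite_induct)
    case empty
    show ?case by (intro exI[of _ id]) (simp add: strict_mono_def)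
  next
    case (insert j J)
    then obtain f :: "nat \<Rightarrow> nat" where f: "strict_mono f" "\<forall>j\<in>J. \<forall>m n. m \<le> n \<longrightarrow> h j (a (f m)) \<le> h j (a (f n))"
      by auto
    obtain b where b: "\<forall>x\<in>X. b \<le> h j x" using insert.prems by auto
    then have "b \<le> h j (a (f n))" for n using a(2) by blast
    then obtain g :: "nat \<Rightarrow> nat" where g: "strict_mono g" "\<And>m n. m \<le> n \<Longrightarrow> h j (a (f (g m))) \<le> h j (a (f (g n)))"
      by (rule bounded_below_subseq[where s = "\<lambda>n. h j (a (f n))"]) blast
    have "strict_mono (\<lambda>n. f (g n))" using f(1) g(1) by (simp add: strict_mono_def)
    moreover have "h i (a (f (g m))) \<le> h i (a (f (g n)))" if "i \<in> insert j J" "m \<le> n" for i m n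
    proof -
      have "g m \<le> g n" using g(1) that(2) by (simp add: strict_mono_less_eq)
      then show ?thesis using f(2) g(2)[OF that(2)] that(1) by auto
    qed
    ultimately show ?case by (intro exI[of _ "\<lambda>n. f (g n)"]) blast
  qed
  then obtain f :: "nat \<Rightarrow> nat" where f: "strict_mono f" "\<And>j. j \<in> J \<Longrightarrow> h j (a (f 0)) \<le> h j (a (f 1))" by force
  have "f 0 \<noteq> f 1" using f(1) by (metis strict_mono_eq zero_neq_one)
  then have "a (f 0) \<noteq> a (f 1)" using a(1) by (simp add: inj_eq)
  then show thesis using that[of "a (f 0)" "a (f 1)"] a(2) f(2) by blast
qed

lemma subspace_keys: "subspace {f :: 'a \<Rightarrow>\<^sub>0 real. keys f \<subseteq> A}"
proof (rule subspaceI)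
  fix f g :: "'a \<Rightarrow>\<^sub>0 real" and c :: real
  assume f: "f \<in> {f. keys f \<subseteq> A}"
  then have "keys (c *\<^sub>R f) \<subseteq> A" by (auto simp: in_keys_iff)
  then show "c *\<^sub>R f \<in> {f. keys f \<subseteq> A}" by simp
  assume "g \<in> {f. keys f \<subseteq> A}"
  then have "keys (f + g) \<subseteq> A" using f keys_add[of f g] by auto
  then show "f + g \<in> {f. keys f \<subseteq> A}" by simp
qed simp

lemma in_span_singles:
  fixes f :: "'a \<Rightarrow>\<^sub>0 real"
  assumes "keys f \<subseteq> A"
  shows "f \<in> span ((\<lambda>k. Poly_Mapping.single k 1) ` A)"
proof -
  have "f = (\<Sum>k\<in>keys f. lookup f k *\<^sub>R Poly_Mapping.single k 1)"
    by (rule poly_mapping_eqI)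
      (simp add: lookup_sum lookup_single when_def in_keys_iff if_distrib[of "\<lambda>x. _ * x"] cong: if_cong)
  also have "\<dots> \<in> span ((\<lambda>k. Poly_Mapping.single k 1) ` A)"
    using assms by (intro span_sum span_scale span_base) auto
  finally show ?thesis .
qed

context compatible_completion
begin

lemma totally_stable_of_bounded_ring:
  assumes S: "S = top_of_set (aff_points \<sigma>) closure_of (top_of_set (aff_points \<sigma>) interior_of S)"
    and bounded: "bounded_ring \<sigma> S = range (Poly_Mapping.single 0)"
  shows "totally_stable \<sigma> S"
proof -
  have "\<forall>\<tau>\<in>\<Delta>. \<exists>G. finite G \<and> \<tau> = convex_cone hull (lattice_vec ` G) \<and>
      (\<forall>g\<in>G. convex_cone hull {lattice_vec g} \<in> \<Delta>)"
    using toric_cone_rays[OF cone_toric] face_in_fan by metis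
  then obtain G where G: "\<And>\<tau>. \<tau> \<in> \<Delta> \<Longrightarrow> finite (G \<tau>)" "\<And>\<tau>. \<tau> \<in> \<Delta> \<Longrightarrow> \<tau> = convex_cone hull (lattice_vec ` G \<tau>)"
    "\<And>\<tau> g. \<tau> \<in> \<Delta> \<Longrightarrow> g \<in> G \<tau> \<Longrightarrow> convex_cone hull {lattice_vec g} \<in> \<Delta>" by metis
  define R where "R = {g \<in> (\<Union>\<tau>\<in>\<Delta>. G \<tau>). boundary_direction (lattice_vec g) \<and> meets (lattice_vec g)}"
  have "finite \<Delta>" using fan by (simp add: fan_def)
  then have finR: "finite R" using G(1) by (simp add: R_def)
  \<comment> \<open>The hypothesis on bounded functions enters here: such a character is bounded on
    \<open>S\<close>, hence constant.\<close>
  have zero: "m = 0" if m: "m \<in> cone_monoid \<sigma>" and R: "\<And>g. g \<in> R \<Longrightarrow> pairing m g \<ge> 0" for m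
  proof -
    have good: "pairing m g \<ge> 0" if "\<tau> \<in> \<Delta>" "g \<in> G \<tau>" "boundary_direction (lattice_vec g)" "meets (lattice_vec g)" for \<tau> g
      using that by (intro R) (auto simp: R_def)
    have "\<exists>c. \<forall>r\<in>torus_part. \<bar>r m\<bar> \<le> c"
      by (rule bounded_on_torus_part[of G m, OF G(1) G(2) m good])
    then obtain c where c: "\<And>r. r \<in> torus_part \<Longrightarrow> \<bar>r m\<bar> \<le> c" by blast
    have "\<forall>s\<in>S. \<bar>feval (Poly_Mapping.single m 1) s\<bar> \<le> c"
      using bounded_character[of m c] S m c by simp
    then have "Poly_Mapping.single m 1 \<in> bounded_ring \<sigma> S"
      unfolding bounded_ring_def coord_ring_def using m by auto
    then obtain d :: real where "Poly_Mapping.single m 1 = Poly_Mapping.single 0 d"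
      unfolding bounded by blast
    then have "lookup (Poly_Mapping.single m (1 :: real)) m = lookup (Poly_Mapping.single 0 d) m"
      by simp
    then show "m = 0" by (auto simp: lookup_single when_def split: if_splits)
  qed
  obtain H where H: "finite H" "\<sigma> = convex_cone hull (lattice_vec ` H)"
    using \<sigma>_rational by (auto simp: rational_polyhedral_cone_def)
  have fin: "finite {m \<in> cone_monoid \<sigma>. \<forall>g\<in>R. \<exists>k\<in>K. pairing k g \<le> pairing m g}" (is "finite ?A")
    if K: "finite K" for K
  proof (rule ccontr)
    assume inf: "infinite ?A"
    \<comment> \<open>Lower bounds come from \<open>K\<close> for the rays in \<open>R\<close>, and
      from membership in \<open>cone_monoid \<sigma>\<close> for the generators \<open>H\<close> of
      \<open>\<sigma>\<close>. Comparing also on \<open>H\<close> puts the difference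
      \<open>n - m\<close> back into \<open>cone_monoid \<sigma>\<close>.\<close>
    have "\<exists>b. \<forall>m\<in>?A. b \<le> pairing m g" if g: "g \<in> H \<union> R" for g
    proof (cases "g \<in> R")
      case True
      have "Min ((\<lambda>k. pairing k g) ` K) \<le> pairing m g" if "m \<in> ?A" for m
      proof -
        obtain k where "k \<in> K" "pairing k g \<le> pairing m g" using \<open>m \<in> ?A\<close> True by blast
        then show ?thesis using K by (meson Min_le finite_imageI image_eqI order_trans)
      qed
      then show ?thesis by blast
    next
      case False
      then have "\<forall>m\<in>?A. 0 \<le> pairing m g" using g cone_monoid_hull[of _ H] H(2) by auto
      then show ?thesis by blast
    qed
    then obtain m n where mn: "m \<in> ?A" "n \<in> ?A" "m \<noteq> n" "\<And>g. g \<in> H \<union> R \<Longrightarrow> pairing m g \<le> pairing n g"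
      using dickson[of "H \<union> R" ?A "\<lambda>g m. pairing m g"] inf H(1) finR by blast
    have d: "pairing (n - m) g = pairing n g - pairing m g" for g
      using pairing_add_left[of "n - m" m g] by simp
    have "n - m \<in> cone_monoid \<sigma>" unfolding H(2) cone_monoid_hull using mn(4) by (simp add: d)
    then have "n - m = 0" using zero[of "n - m"] mn(4) by (simp add: d)
    then show False using mn(3) by simp
  qed
  show ?thesis
    unfolding totally_stable_def
  proof (intro allI impI)
    fix U :: "(int ^ 'n \<Rightarrow>\<^sub>0 real) set"
    assume U: "U \<subseteq> coord_ring \<sigma> \<and> fin_dim_subspace U"
    then obtain B where B: "finite B" "U = span B" by (auto simp: fin_dim_subspace_def)
    define K where "K = (\<Union>b\<in>B. keys b)"
    have K: "finite K" using B(1) by (simp add: K_def)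
    have keysU: "keys f \<subseteq> K" if "f \<in> U" for f
    proof -
      have "span B \<subseteq> {f. keys f \<subseteq> K}"
        by (intro span_minimal subspace_keys) (auto simp: K_def)
      then show ?thesis using that B(2) by blast
    qed
    \<comment> \<open>\<open>A\<close> depends on \<open>U\<close> only through the exponents in
      \<open>K\<close>, and not on the summands or their number, so one \<open>W\<close> serves all
      decompositions.\<close>
    define A where "A = {m \<in> cone_monoid \<sigma>. \<forall>g\<in>R. \<exists>k\<in>K. pairing k g \<le> pairing m g}"
    have A: "finite A" "A \<subseteq> cone_monoid \<sigma>" using fin[OF K] by (auto simp: A_def)
    define W where "W = span ((\<lambda>k. Poly_Mapping.single k (1 :: real)) ` A)"
    have "W \<subseteq> coord_ring \<sigma>"
      unfolding W_def coord_ring_def using A(2) by (intro span_minimal subspace_keys) auto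
    moreover have "fin_dim_subspace W" unfolding W_def fin_dim_subspace_def using A(1) by blast
    moreover have "f i \<in> W"
      if f: "(\<forall>i\<in>{1..r}. f i \<in> psd_cone \<sigma> S) \<and> (\<Sum>i\<in>{1..r}. f i) \<in> U" and i: "i \<in> {1..r}"
      for r :: nat and f :: "nat \<Rightarrow> (int ^ 'n \<Rightarrow>\<^sub>0 real)" and i
    proof -
      have fi: "f i \<in> coord_ring \<sigma>" "(\<Sum>i\<in>{1..r}. f i) \<in> coord_ring \<sigma>" using f i U by (auto simp: psd_cone_def)
      have nonneg: "feval (f j) s \<ge> 0" if "s \<in> S" "j \<in> {1..r}" for s j
        using f that by (simp add: psd_cone_def)
      \<comment> \<open>All summands are nonnegative on \<open>S\<close>, so each is dominated there
        by the sum.\<close>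
      have dom: "\<bar>feval (f i) s\<bar> \<le> \<bar>feval (\<Sum>i\<in>{1..r}. f i) s\<bar>" if s: "s \<in> S" for s
      proof -
        have "feval (f i) s \<le> (\<Sum>j\<in>{1..r}. feval (f j) s)"
          using nonneg[OF s] i by (intro member_le_sum) auto
        then show ?thesis using nonneg[OF s i] by (simp add: feval_sum)
      qed
      have "k1 \<in> A" if k1: "k1 \<in> keys (f i)" for k1
        unfolding A_def
      proof (intro CollectI conjI ballI)
        show "k1 \<in> cone_monoid \<sigma>" using k1 fi(1) by (auto simp: coord_ring_def)
        fix g assume "g \<in> R"
        then have "convex_cone hull {lattice_vec g} \<in> \<Delta>" "boundary_direction (lattice_vec g)" "meets (lattice_vec g)"
          using G(3) by (auto simp: R_def)
        from dominated_order[OF this fi(2,1) dom k1]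
        obtain k where "k \<in> keys (\<Sum>i\<in>{1..r}. f i)" "pairing k g \<le> pairing k1 g"
          by (auto simp: inner_lattice_vec)
        then show "\<exists>k\<in>K. pairing k g \<le> pairing k1 g" using keysU f by blast
      qed
      then show ?thesis unfolding W_def by (intro in_span_singles subsetI)
    qed
    ultimately show "\<exists>W. W \<subseteq> coord_ring \<sigma> \<and> fin_dim_subspace W \<and>
         (\<forall>r\<ge>2. \<forall>f :: nat \<Rightarrow> (int ^ 'n \<Rightarrow>\<^sub>0 real).
            (\<forall>i\<in>{1..r}. f i \<in> psd_cone \<sigma> S) \<and> (\<Sum>i\<in>{1..r}. f i) \<in> U
              \<longrightarrow> (\<forall>i\<in>{1..r}. f i \<in> W))"
      by blast
  qed
qed

end

theorem theorem5p5:
  fixes \<sigma> :: "(real ^ 'n) set"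
    and S :: "(int ^ 'n \<Rightarrow> real) set"
  assumes "toric_cone \<sigma>"
    and "S \<subseteq> aff_points \<sigma>"
    and "semialgebraic \<sigma> S"
    and "closedin (top_of_set (aff_points \<sigma>)) S"
    and "S = top_of_set (aff_points \<sigma>) closure_of (top_of_set (aff_points \<sigma>) interior_of S)"
    and "bounded_ring \<sigma> S = range (Poly_Mapping.single 0)"
    and "\<exists>\<Delta> \<iota>. toric_completion \<sigma> \<Delta> \<iota> \<and> S_compatible \<sigma> \<Delta> \<iota> S"
  shows "totally_stable \<sigma> S"
proof -
  obtain \<Delta> \<iota> where \<Delta>: "toric_completion \<sigma> \<Delta> \<iota>" "S_compatible \<sigma> \<Delta> \<iota> S"
    using assms(7) by blast
  interpret compatible_completion \<Delta> \<sigma> \<iota> S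
    using \<Delta> assms(1,2) by unfold_locales (simp_all add: toric_completion_def)
  show ?thesis using assms(5,6) by (rule totally_stable_of_bounded_ring)
qed

end
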